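(* Let $D>0$ and $k_0>0$ be constants, let $\rho(z)=e^{-\frac{1}{D}z}$ for $z\in[0,1]$, let $X=L^2_\rho(0,1)$, and let $-\mathcal{A}$ be the operator $-\mathcal{A}x=D\frac{d^2x}{dz^2}-\frac{dx}{dz}-k_0x$ with domain $D(-\mathcal{A})=\{x\in H^2(0,1):\ D\frac{dx}{dz}(0)-x(0)=0=\frac{dx}{dz}(1)\}$. Then $-\mathcal{A}$ is a self-adjoint Riesz-spectral operator on the space $X_{\frac12}=H^1(0,1)$. Moreover, it is the infinitesimal generator of an exponentially stable and compact $C_0$-semigroup of bounded linear operators on $H^1(0,1)$.
   Context: $X=L^2_\rho(0,1)$ is the space $L^2(0,1)$ of real-valued square integrable functions with inner product $\langle f,g\rangle_\rho=\int_0^1f(z)g(z)\rho(z)\,dz$. Put $A=-\mathcal{A}$. It is a Sturm-Liouville operator up to sign: $\mathcal{A}f=\frac1\rho\left(\frac{d}{dz}\left(-p\frac{df}{dz}\right)+qf\right)$ with $p=D\rho$, $q=k_0\rho$. Known facts: $A$ is self-adjoint on $X$; its spectrum consists only of simple real eigenvalues $\{\lambda_n\}_{n\in\mathbb{N}}$, bounded from above; the normalized eigenfunctions $\{\phi_n\}_{n\in\mathbb{N}}$ form an orthonormal basis of $X$; and $Af=\sum_{n=1}^\infty\lambda_n\langle f,\phi_n\rangle_\rho\phi_n$ on $D(A)=D(-\mathcal{A})$. Fix $\mu=\gamma+\epsilon$ with $\epsilon>0$ and $\lambda_n<\gamma<\infty$ for all $n$. The space $X_{\frac12}:=D((\mu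 I-A)^{\frac12})=\{f\in X:\ \sum_{n=1}^\infty(\mu-\lambda_n)\langle f,\phi_n\rangle_\rho^2<\infty\}$ is a Hilbert space with inner product $\langle f,g\rangle_{\frac12}=\langle(\mu I-A)^{\frac12}f,(\mu I-A)^{\frac12}g\rangle_\rho$, where $(\mu I-A)^{\frac12}f=\sum_{n=1}^\infty(\mu-\lambda_n)^{\frac12}\langle f,\phi_n\rangle_\rho\phi_n$. The identity $X_{\frac12}=H^1(0,1)$ is understood as equality of sets with equivalent norms, and self-adjointness is with respect to $\langle\cdot,\cdot\rangle_{\frac12}$. On $X_{\frac12}$ the operator $A$ is considered with domain $D(A)_{\frac12}=\{f\in X_{\frac12}:\ \sum_{n=1}^\infty\lambda_n^2\langle f,\phi_{n,\frac12}\rangle_{\frac12}^2<\infty\}$, where $\phi_{n,\frac12}=(\mu-\lambda_n)^{-\frac12}\phi_n$. A closed linear operator on a Hilbert space is called Riesz-spectral if it has simple eigenvalues $\{\lambda_n\}_{n\in\mathbb{N}}$ whose corresponding eigenvectors form a Riesz basis of the space, and the closure of $\{\lambda_n\}_{n\in\mathbb{N}}$ is totally disconnected. A $C_0$-semigroup $(T(t))_{t\ge0}$ is exponentially stable if there are $M,\omega>0$ with $\|T(t)\|\le Me^{-\omega t}$ for all $t\ge0$, and compact if $T(t)$ is a compact operator for all $t>0$. *)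

theory Defs
  imports "HOL-Analysis.Analysis"
begin

section \<open>Operators and semigroups on a Hilbert space inside a real vector space\<close>

text \<open>
  A Hilbert space is given by a carrier \<open>V\<close> and an inner product \<open>ip\<close> that is only relevant
  on \<open>V\<close>; several such structures live on the same ambient type. Unbounded operators are
  represented by their graphs, so \<open>Domain G\<close> is the domain of the operator \<open>G\<close>.
\<close>

definition inner_product_on :: "'a::real_vector set \<Rightarrow> ('a \<Rightarrow> 'a \<Rightarrow> real) \<Rightarrow> bool" where
  "inner_product_on V ip \<longleftrightarrow> subspace V
     \<and> (\<forall>x\<in>V. \<forall>y\<in>V. ip x y = ip y x)
     \<and> (\<forall>x\<in>V. \<forall>y\<in>V. \<forall>z\<in>V. ip (x + y) z = ip x z + ip y z)
     \<and> (\<forall>c. \<forall>x\<in>V. \<forall>y\<in>V. ip (c *\<^sub>R x) y = c * ip x y)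
     \<and> (\<forall>x\<in>V. 0 \<le> ip x x)
     \<and> (\<forall>x\<in>V. ip x x = 0 \<longrightarrow> x = 0)"

definition ip_norm :: "('a::real_vector \<Rightarrow> 'a \<Rightarrow> real) \<Rightarrow> 'a \<Rightarrow> real" where
  "ip_norm ip x = sqrt (ip x x)"

text \<open>
  The locale \<open>Metric_space\<close> demands symmetry and nonnegativity also outside the carrier,
  hence the default value there.
\<close>

definition ip_dist :: "'a::real_vector set \<Rightarrow> ('a \<Rightarrow> 'a \<Rightarrow> real) \<Rightarrow> 'a \<Rightarrow> 'a \<Rightarrow> real" where
  "ip_dist V ip x y = (if x \<in> V \<and> y \<in> V then ip_norm ip (x - y) else 0)"

definition ip_topology :: "'a::real_vector set \<Rightarrow> ('a \<Rightarrow> 'a \<Rightarrow> real) \<Rightarrow> 'a topology" where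
  "ip_topology V ip = Metric_space.mtopology V (ip_dist V ip)"

definition hilbert_space_on :: "'a::real_vector set \<Rightarrow> ('a \<Rightarrow> 'a \<Rightarrow> real) \<Rightarrow> bool" where
  "hilbert_space_on V ip \<longleftrightarrow> inner_product_on V ip \<and> Metric_space.mcomplete V (ip_dist V ip)"

definition equivalent_norms_on :: "'a set \<Rightarrow> ('a \<Rightarrow> real) \<Rightarrow> ('a \<Rightarrow> real) \<Rightarrow> bool" where
  "equivalent_norms_on V n1 n2 \<longleftrightarrow>
     (\<exists>c>0. \<exists>C>0. \<forall>x\<in>V. c * n1 x \<le> n2 x \<and> n2 x \<le> C * n1 x)"

definition linear_operator_on :: "'a::real_vector set \<Rightarrow> ('a \<times> 'a) set \<Rightarrow> bool" where
  "linear_operator_on V G \<longleftrightarrow> subspace G \<and> single_valued G \<and> G \<subseteq> V \<times> V"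

definition closed_operator_on ::
    "'a::real_vector set \<Rightarrow> ('a \<Rightarrow> 'a \<Rightarrow> real) \<Rightarrow> ('a \<times> 'a) set \<Rightarrow> bool" where
  "closed_operator_on V ip G \<longleftrightarrow> linear_operator_on V G
     \<and> closedin (prod_topology (ip_topology V ip) (ip_topology V ip)) G"

definition adjoint_on ::
    "'a::real_vector set \<Rightarrow> ('a \<Rightarrow> 'a \<Rightarrow> real) \<Rightarrow> ('a \<times> 'a) set \<Rightarrow> ('a \<times> 'a) set" where
  "adjoint_on V ip G = {(y, z). y \<in> V \<and> z \<in> V \<and> (\<forall>(x, w)\<in>G. ip w y = ip x z)}"

definition self_adjoint_on ::
    "'a::real_vector set \<Rightarrow> ('a \<Rightarrow> 'a \<Rightarrow> real) \<Rightarrow> ('a \<times> 'a) set \<Rightarrow> bool" where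
  "self_adjoint_on V ip G \<longleftrightarrow> hilbert_space_on V ip \<and> linear_operator_on V G
     \<and> ip_topology V ip closure_of Domain G = V
     \<and> adjoint_on V ip G = G"

definition eigenspace :: "('a::real_vector \<times> 'a) set \<Rightarrow> real \<Rightarrow> 'a set" where
  "eigenspace G l = {x. (x, l *\<^sub>R x) \<in> G}"

definition eigenvalues :: "('a::real_vector \<times> 'a) set \<Rightarrow> real set" where
  "eigenvalues G = {l. \<exists>x\<in>eigenspace G l. x \<noteq> 0}"

text \<open>
  Simple means algebraic multiplicity one: the eigenspace is a line, and there are no further
  generalised eigenvectors.
\<close>

definition simple_eigenvalue :: "('a::real_vector \<times> 'a) set \<Rightarrow> real \<Rightarrow> bool" where
  "simple_eigenvalue G l \<longleftrightarrow> (\<exists>x. x \<noteq> 0 \<and> eigenspace G l = span {x})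
     \<and> (\<forall>(y, w)\<in>G. w - l *\<^sub>R y \<in> eigenspace G l \<longrightarrow> y \<in> eigenspace G l)"

definition riesz_basis_on ::
    "'a::real_vector set \<Rightarrow> ('a \<Rightarrow> 'a \<Rightarrow> real) \<Rightarrow> (nat \<Rightarrow> 'a) \<Rightarrow> bool" where
  "riesz_basis_on V ip e \<longleftrightarrow> range e \<subseteq> V
     \<and> ip_topology V ip closure_of span (range e) = V
     \<and> (\<exists>m>0. \<exists>M>0. \<forall>N. \<forall>a :: nat \<Rightarrow> real.
          m * (\<Sum>n<N. (a n)\<^sup>2) \<le> (ip_norm ip (\<Sum>n<N. a n *\<^sub>R e n))\<^sup>2
          \<and> (ip_norm ip (\<Sum>n<N. a n *\<^sub>R e n))\<^sup>2 \<le> M * (\<Sum>n<N. (a n)\<^sup>2))"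

definition totally_disconnected :: "real set \<Rightarrow> bool" where
  "totally_disconnected S \<longleftrightarrow> (\<forall>C\<subseteq>S. connected C \<longrightarrow> (\<exists>a. C \<subseteq> {a}))"

definition riesz_spectral_on ::
    "'a::real_vector set \<Rightarrow> ('a \<Rightarrow> 'a \<Rightarrow> real) \<Rightarrow> ('a \<times> 'a) set \<Rightarrow> bool" where
  "riesz_spectral_on V ip G \<longleftrightarrow> hilbert_space_on V ip \<and> closed_operator_on V ip G
     \<and> (\<exists>l :: nat \<Rightarrow> real. \<exists>e.
          inj l \<and> range l = eigenvalues G
          \<and> (\<forall>n. simple_eigenvalue G (l n) \<and> e n \<in> eigenspace G (l n))
          \<and> riesz_basis_on V ip e
          \<and> totally_disconnected (closure (range l)))"

definition bounded_operator_on ::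
    "'a::real_vector set \<Rightarrow> ('a \<Rightarrow> 'a \<Rightarrow> real) \<Rightarrow> ('a \<Rightarrow> 'a) \<Rightarrow> bool" where
  "bounded_operator_on V ip T \<longleftrightarrow> T ` V \<subseteq> V
     \<and> (\<forall>x\<in>V. \<forall>y\<in>V. T (x + y) = T x + T y)
     \<and> (\<forall>c. \<forall>x\<in>V. T (c *\<^sub>R x) = c *\<^sub>R T x)
     \<and> (\<exists>B. \<forall>x\<in>V. ip_norm ip (T x) \<le> B * ip_norm ip x)"

definition compact_operator_on ::
    "'a::real_vector set \<Rightarrow> ('a \<Rightarrow> 'a \<Rightarrow> real) \<Rightarrow> ('a \<Rightarrow> 'a) \<Rightarrow> bool" where
  "compact_operator_on V ip T \<longleftrightarrow> bounded_operator_on V ip T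
     \<and> compactin (ip_topology V ip)
         (ip_topology V ip closure_of (T ` {x \<in> V. ip_norm ip x \<le> 1}))"

definition c0_semigroup_on ::
    "'a::real_vector set \<Rightarrow> ('a \<Rightarrow> 'a \<Rightarrow> real) \<Rightarrow> (real \<Rightarrow> 'a \<Rightarrow> 'a) \<Rightarrow> bool" where
  "c0_semigroup_on V ip T \<longleftrightarrow> hilbert_space_on V ip
     \<and> (\<forall>t\<ge>0. bounded_operator_on V ip (T t))
     \<and> (\<forall>x\<in>V. T 0 x = x)
     \<and> (\<forall>s\<ge>0. \<forall>t\<ge>0. \<forall>x\<in>V. T (s + t) x = T s (T t x))
     \<and> (\<forall>x\<in>V. limitin (ip_topology V ip) (\<lambda>t. T t x) x (at_right 0))"

definition generator_on ::
    "'a::real_vector set \<Rightarrow> ('a \<Rightarrow> 'a \<Rightarrow> real) \<Rightarrow> (real \<Rightarrow> 'a \<Rightarrow> 'a) \<Rightarrow> ('a \<times> 'a) set" where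
  "generator_on V ip T = {(x, y). x \<in> V \<and> y \<in> V
     \<and> limitin (ip_topology V ip) (\<lambda>h. (1 / h) *\<^sub>R (T h x - x)) y (at_right 0)}"

definition exponentially_stable_on ::
    "'a::real_vector set \<Rightarrow> ('a \<Rightarrow> 'a \<Rightarrow> real) \<Rightarrow> (real \<Rightarrow> 'a \<Rightarrow> 'a) \<Rightarrow> bool" where
  "exponentially_stable_on V ip T \<longleftrightarrow>
     (\<exists>M>0. \<exists>\<omega>>0. \<forall>t\<ge>0. \<forall>x\<in>V. ip_norm ip (T t x) \<le> M * exp (- \<omega> * t) * ip_norm ip x)"

definition compact_semigroup_on ::
    "'a::real_vector set \<Rightarrow> ('a \<Rightarrow> 'a \<Rightarrow> real) \<Rightarrow> (real \<Rightarrow> 'a \<Rightarrow> 'a) \<Rightarrow> bool" where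
  "compact_semigroup_on V ip T \<longleftrightarrow> (\<forall>t>0. compact_operator_on V ip (T t))"


section \<open>The space $L^2(0,1)$\<close>

definition sq_integrable :: "(real \<Rightarrow> real) \<Rightarrow> bool" where
  "sq_integrable f \<longleftrightarrow> f \<in> borel_measurable (lebesgue_on {0..1})
     \<and> integrable (lebesgue_on {0..1}) (\<lambda>x. (f x)\<^sup>2)"

definition L2_rel :: "(real \<Rightarrow> real) \<Rightarrow> (real \<Rightarrow> real) \<Rightarrow> bool" where
  "L2_rel f g \<longleftrightarrow> sq_integrable f \<and> sq_integrable g \<and> (AE x in lebesgue_on {0..1}. f x = g x)"

lemma sq_integrable_zero: "sq_integrable (\<lambda>x. 0)"
  by (simp add: sq_integrable_def)

lemma sq_integrable_scale: "sq_integrable f \<Longrightarrow> sq_integrable (\<lambda>x. c * f x)"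
  by (auto simp: sq_integrable_def power_mult_distrib)

lemma sq_integrable_add:
  assumes "sq_integrable f" "sq_integrable g"
  shows "sq_integrable (\<lambda>x. f x + g x)"
proof -
  have m: "f \<in> borel_measurable (lebesgue_on {0..1})" "g \<in> borel_measurable (lebesgue_on {0..1})"
    using assms by (auto simp: sq_integrable_def)
  have "integrable (lebesgue_on {0..1}) (\<lambda>x. (f x + g x)\<^sup>2)"
  proof (rule Bochner_Integration.integrable_bound)
    show "integrable (lebesgue_on {0..1}) (\<lambda>x. 2 * (f x)\<^sup>2 + 2 * (g x)\<^sup>2)"
      using assms by (auto simp: sq_integrable_def)
    have "(a + b)\<^sup>2 \<le> 2 * a\<^sup>2 + 2 * b\<^sup>2" for a b :: real
      using zero_le_power2[of "a - b"] by (simp add: power2_sum power2_diff)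
    then show "AE x in lebesgue_on {0..1}.
        norm ((f x + g x)\<^sup>2) \<le> norm (2 * (f x)\<^sup>2 + 2 * (g x)\<^sup>2)"
      by (simp add: abs_of_nonneg)
  qed (use m in measurable)
  then show ?thesis using m by (simp add: sq_integrable_def)
qed

lemma sq_integrable_minus: "sq_integrable f \<Longrightarrow> sq_integrable (\<lambda>x. - f x)"
  using sq_integrable_scale[of f "-1"] by simp

lemma sq_integrable_diff:
  "sq_integrable f \<Longrightarrow> sq_integrable g \<Longrightarrow> sq_integrable (\<lambda>x. f x - g x)"
  using sq_integrable_add[OF _ sq_integrable_minus[of g], of f] by simp

lemma L2_rel_part_equivp: "part_equivp L2_rel"
proof (rule part_equivpI)
  show "\<exists>x. L2_rel x x"
    using sq_integrable_zero by (auto simp: L2_rel_def)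
  show "symp L2_rel"
    by (rule sympI) (auto simp: L2_rel_def)
  show "transp L2_rel"
  proof (rule transpI)
    fix f g h assume "L2_rel f g" "L2_rel g h"
    moreover from this have "AE x in lebesgue_on {0..1}. f x = g x"
        "AE x in lebesgue_on {0..1}. g x = h x"
      by (auto simp: L2_rel_def)
    then have "AE x in lebesgue_on {0..1}. f x = h x"
      by eventually_elim simp
    ultimately show "L2_rel f h" by (auto simp: L2_rel_def)
  qed
qed

quotient_type l2 = "real \<Rightarrow> real" / partial: L2_rel
  by (rule L2_rel_part_equivp)

instantiation l2 :: real_vector
begin

lift_definition zero_l2 :: l2 is "\<lambda>x. 0"
  by (simp add: L2_rel_def sq_integrable_zero)

lift_definition plus_l2 :: "l2 \<Rightarrow> l2 \<Rightarrow> l2" is "\<lambda>f g x. f x + g x"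
  by (auto simp: L2_rel_def sq_integrable_add)

lift_definition minus_l2 :: "l2 \<Rightarrow> l2 \<Rightarrow> l2" is "\<lambda>f g x. f x - g x"
  by (auto simp: L2_rel_def sq_integrable_diff)

lift_definition uminus_l2 :: "l2 \<Rightarrow> l2" is "\<lambda>f x. - f x"
  by (auto simp: L2_rel_def sq_integrable_minus)

lift_definition scaleR_l2 :: "real \<Rightarrow> l2 \<Rightarrow> l2" is "\<lambda>c f x. c * f x"
  by (auto simp: L2_rel_def sq_integrable_scale)

instance
  by standard
    (transfer; auto simp: L2_rel_def sq_integrable_add sq_integrable_diff sq_integrable_minus
       sq_integrable_scale sq_integrable_zero algebra_simps)+

end

definition rho :: "real \<Rightarrow> real \<Rightarrow> real" where
  "rho D z = exp (- (1 / D) * z)"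

text \<open>As \<open>rho D\<close> is bounded above and below on $[0,1]$, the weight changes only the inner product.\<close>

lift_definition ip_rho :: "real \<Rightarrow> l2 \<Rightarrow> l2 \<Rightarrow> real" is
  "\<lambda>D f g. \<integral>z. f z * g z * rho D z \<partial>lebesgue_on {0..1}"
proof -
  fix D :: real and f f' g g' :: "real \<Rightarrow> real"
  assume "L2_rel f f'" "L2_rel g g'"
  then have [measurable]: "f \<in> borel_measurable (lebesgue_on {0..1})"
      "f' \<in> borel_measurable (lebesgue_on {0..1})" "g \<in> borel_measurable (lebesgue_on {0..1})"
      "g' \<in> borel_measurable (lebesgue_on {0..1})"
    and ae: "AE x in lebesgue_on {0..1}. f x = f' x" "AE x in lebesgue_on {0..1}. g x = g' x"
    by (auto simp: L2_rel_def sq_integrable_def)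
  have "rho D \<in> borel_measurable borel"
    unfolding rho_def by measurable
  then have [measurable]: "rho D \<in> borel_measurable (lebesgue_on {0..1})"
    by (intro measurable_restrict_space1 measurable_completion) simp
  show "(\<integral>z. f z * g z * rho D z \<partial>lebesgue_on {0..1})
      = (\<integral>z. f' z * g' z * rho D z \<partial>lebesgue_on {0..1})"
  proof (rule integral_cong_AE)
    show "AE z in lebesgue_on {0..1}. f z * g z * rho D z = f' z * g' z * rho D z"
      using ae by eventually_elim simp
  qed measurable
qed


section \<open>Sobolev spaces and the differential operator\<close>

text \<open>
  \<open>L2_deriv f f'\<close>: on $[0,1]$ the function \<open>f\<close> is absolutely continuous with derivative
  \<open>f'\<close> in $L^2(0,1)$, i.e. \<open>f\<close> is the continuous representative of an element of $H^1(0,1)$.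
  Boundary values are those of this representative. If moreover \<open>L2_deriv f' f''\<close>, then \<open>f'\<close>
  is itself the continuous representative of the derivative.
\<close>

definition L2_deriv :: "(real \<Rightarrow> real) \<Rightarrow> (real \<Rightarrow> real) \<Rightarrow> bool" where
  "L2_deriv f f' \<longleftrightarrow> sq_integrable f' \<and> (\<forall>x\<in>{0..1}. (f' has_integral (f x - f 0)) {0..x})"

definition H1 :: "l2 set" where
  "H1 = {abs_l2 f | f f'. L2_deriv f f'}"

definition H1_norm :: "l2 \<Rightarrow> real" where
  "H1_norm u = (THE r. \<exists>f f'. L2_deriv f f' \<and> u = abs_l2 f
     \<and> r = sqrt ((\<integral>z. (f z)\<^sup>2 \<partial>lebesgue_on {0..1}) + (\<integral>z. (f' z)\<^sup>2 \<partial>lebesgue_on {0..1})))"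

definition A_op :: "real \<Rightarrow> real \<Rightarrow> (l2 \<times> l2) set" where
  "A_op D k0 = {(abs_l2 f, abs_l2 (\<lambda>z. D * f'' z - f' z - k0 * f z)) | f f' f''.
     L2_deriv f f' \<and> L2_deriv f' f'' \<and> D * f' 0 - f 0 = 0 \<and> f' 1 = 0}"

text \<open>\<open>l\<close> enumerates the eigenvalues of the operator, \<open>\<phi>\<close> consists of normalized eigenfunctions.\<close>

definition eigen_system :: "real \<Rightarrow> real \<Rightarrow> (nat \<Rightarrow> real) \<Rightarrow> (nat \<Rightarrow> l2) \<Rightarrow> bool" where
  "eigen_system D k0 l \<phi> \<longleftrightarrow> inj l \<and> range l = eigenvalues (A_op D k0)
     \<and> (\<forall>n. \<phi> n \<in> eigenspace (A_op D k0) (l n) \<and> ip_norm (ip_rho D) (\<phi> n) = 1)"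

definition X_half :: "real \<Rightarrow> (nat \<Rightarrow> real) \<Rightarrow> (nat \<Rightarrow> l2) \<Rightarrow> real \<Rightarrow> l2 set" where
  "X_half D l \<phi> \<mu> = {f. summable (\<lambda>n. (\<mu> - l n) * (ip_rho D f (\<phi> n))\<^sup>2)}"

text \<open>The series defining $(\mu I - A)^{1/2} f$ converges in $L^2_\rho(0,1)$.\<close>

definition half_power :: "real \<Rightarrow> (nat \<Rightarrow> real) \<Rightarrow> (nat \<Rightarrow> l2) \<Rightarrow> real \<Rightarrow> l2 \<Rightarrow> l2" where
  "half_power D l \<phi> \<mu> f = (THE w. limitin (ip_topology UNIV (ip_rho D))
     (\<lambda>N. \<Sum>n<N. (sqrt (\<mu> - l n) * ip_rho D f (\<phi> n)) *\<^sub>R \<phi> n) w sequentially)"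

definition ip_half :: "real \<Rightarrow> (nat \<Rightarrow> real) \<Rightarrow> (nat \<Rightarrow> l2) \<Rightarrow> real \<Rightarrow> l2 \<Rightarrow> l2 \<Rightarrow> real" where
  "ip_half D l \<phi> \<mu> f g = ip_rho D (half_power D l \<phi> \<mu> f) (half_power D l \<phi> \<mu> g)"

definition phi_half :: "(nat \<Rightarrow> real) \<Rightarrow> (nat \<Rightarrow> l2) \<Rightarrow> real \<Rightarrow> nat \<Rightarrow> l2" where
  "phi_half l \<phi> \<mu> n = (1 / sqrt (\<mu> - l n)) *\<^sub>R \<phi> n"

definition dom_half :: "real \<Rightarrow> (nat \<Rightarrow> real) \<Rightarrow> (nat \<Rightarrow> l2) \<Rightarrow> real \<Rightarrow> l2 set" where
  "dom_half D l \<phi> \<mu> = {f \<in> X_half D l \<phi> \<mu>.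
     summable (\<lambda>n. (l n)\<^sup>2 * (ip_half D l \<phi> \<mu> f (phi_half l \<phi> \<mu> n))\<^sup>2)}"

text \<open>
  \<open>dom_half\<close> is contained in the domain of \<open>A_op\<close>, because for \<open>f\<close> in \<open>X_half\<close> the inner product
  of \<open>f\<close> with \<open>phi_half n\<close> in \<open>ip_half\<close> is $(\mu - \lambda_n)^{1/2} \langle f, \phi_n \rangle_\rho$.
  So intersecting with the graph of \<open>A_op\<close> does not shrink the prescribed domain.
\<close>

definition A_half ::
    "real \<Rightarrow> real \<Rightarrow> (nat \<Rightarrow> real) \<Rightarrow> (nat \<Rightarrow> l2) \<Rightarrow> real \<Rightarrow> (l2 \<times> l2) set" where
  "A_half D k0 l \<phi> \<mu> = {(u, v) \<in> A_op D k0. u \<in> dom_half D l \<phi> \<mu>}"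

end

theory Submission
  imports Defs "HOL-Complex_Analysis.Great_Picard"
begin

text \<open>
  Write \<open>L = A + k0\<close>. A pair \<open>(b, g)\<close> in \<open>real \<times> L2\<close> codes the $H^1$ function with value \<open>b\<close> at
  \<open>0\<close> and derivative \<open>g\<close>. Integration by parts gives $\langle -L f, h\rangle_\rho = f(0)h(0) + D\int f'h'\rho$
  for \<open>f\<close> in the domain and \<open>h\<close> in $H^1$, and two integrations solve \<open>L f = q\<close>. Hence the inverse of \<open>- L\<close>
  factors through the compact embedding of $H^1$ as \<open>K Y\<close> with \<open>Y\<close> adjoint to \<open>K\<close>: it is positive and
  compact, so its eigenvectors are complete. Eigenvalues are simple because an eigenfunction with
  zero Cauchy data at \<open>1\<close> vanishes. The form also shows that the eigenfunctions are orthogonal in $H^1$,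
  and comparing the two orthonormal bases identifies $X_{1/2}$ with $H^1$. In the coordinates of
  $X_{1/2}$ the operator is multiplication by \<open>l n \<le> - k0\<close>, \<open>l n \<longrightarrow> - \<infinity>\<close>, from which everything follows.
\<close>

section \<open>Orthonormal bases and multipliers\<close>

text \<open>The constant \<open>k0\<close> is split off because the energy form of
  \<open>- L\<close> is definite by itself: the boundary term at \<open>0\<close> takes over the
  role of a zero-order term. So \<open>L\<close> is invertible, and \<open>k0\<close> reappears as
  the decay rate. No spectral fact is presupposed: existence, infinitude, simplicity and
  completeness are all derived, so that the claim about every eigensystem is not vacuous. An
  eigensystem may list the eigenvalues in any order, hence
  \<open>l n \<longrightarrow> - \<infinity>\<close> has to come from compactness and not from
  monotonicity. Two weights compete: \<open>\<nu> n = - (l n + k0)\<close>, dictated by the energy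
  form, and \<open>\<mu> - l n\<close>, dictated by \<open>X_half\<close>. They differ by the
  constant \<open>\<mu> + k0\<close>, which may have either sign, and are comparable because both
  stay away from zero. Several inner products live on one type, so the abstract part is proved in a
  type class Hilbert space with an orthonormal basis and transported along isometries.\<close>

locale orthonormal_basis =
  fixes e :: "nat \<Rightarrow> 'a::{real_inner,banach}"
  assumes orthonormal: "inner (e m) (e n) = (if m = n then 1 else 0)"
    and total: "(\<And>n. inner x (e n) = 0) \<Longrightarrow> x = 0"
begin

lemma coord_eqI: "(\<And>n. inner x (e n) = inner y (e n)) \<Longrightarrow> x = y"
  using total[of "x - y"] by (simp add: inner_diff_left)

lemma norm_e [simp]: "norm (e n) = 1"
  by (simp add: norm_eq_sqrt_inner orthonormal)

lemma inner_finite_sum: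
  assumes "finite F"
  shows "inner (\<Sum>n\<in>F. a n *\<^sub>R e n) (e m) = (if m \<in> F then a m else 0)"
proof -
  have "inner (\<Sum>n\<in>F. a n *\<^sub>R e n) (e m) = (\<Sum>n\<in>F. if n = m then a n else 0)"
    by (simp add: inner_sum_left orthonormal if_distrib cong: if_cong)
  then show ?thesis using assms by simp
qed

lemma norm_finite_sum:
  assumes "finite F"
  shows "(norm (\<Sum>n\<in>F. a n *\<^sub>R e n))\<^sup>2 = (\<Sum>n\<in>F. (a n)\<^sup>2)"
proof -
  have "(norm (\<Sum>n\<in>F. a n *\<^sub>R e n))\<^sup>2
      = inner (\<Sum>n\<in>F. a n *\<^sub>R e n) (\<Sum>m\<in>F. a m *\<^sub>R e m)"
    by (simp add: power2_norm_eq_inner)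
  also have "\<dots> = (\<Sum>m\<in>F. a m * inner (\<Sum>n\<in>F. a n *\<^sub>R e n) (e m))"
    by (simp only: inner_sum_right inner_scaleR_right)
  also have "\<dots> = (\<Sum>n\<in>F. (a n)\<^sup>2)"
    using assms by (simp add: inner_finite_sum power2_eq_square)
  finally show ?thesis .
qed

lemma bessel:
  assumes "finite F"
  shows "(\<Sum>n\<in>F. (inner x (e n))\<^sup>2) \<le> (norm x)\<^sup>2"
proof -
  let ?s = "\<Sum>n\<in>F. inner x (e n) *\<^sub>R e n"
  have xs: "inner x ?s = (\<Sum>n\<in>F. (inner x (e n))\<^sup>2)"
    by (simp add: inner_sum_right power2_eq_square)
  have "0 \<le> (norm (x - ?s))\<^sup>2" by simp
  also have "\<dots> = (norm x)\<^sup>2 - 2 * inner x ?s + (norm ?s)\<^sup>2"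
    by (simp only: power2_norm_eq_inner) (simp add: inner_diff inner_commute)
  finally show ?thesis using assms by (simp add: xs norm_finite_sum)
qed

lemma summable_coord: "summable (\<lambda>n. (inner x (e n))\<^sup>2)"
  by (rule bounded_imp_summable[where B = "(norm x)\<^sup>2"])
    (auto simp: bessel)

text \<open>Riesz-Fischer: by Pythagoras a block of the series has squared norm equal to the
  matching block of the summable series of squares, so completeness gives convergence.\<close>

lemma summable_combination:
  assumes "summable (\<lambda>n. (a n)\<^sup>2)"
  shows "summable (\<lambda>n. a n *\<^sub>R e n)"
  unfolding summable_Cauchy
proof (intro allI impI)
  fix \<epsilon> :: real assume "\<epsilon> > 0"
  then obtain N where N: "\<And>m n. m \<ge> N \<Longrightarrow> norm (\<Sum>k=m..<n. (a k)\<^sup>2) < \<epsilon>\<^sup>2"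
    using assms unfolding summable_Cauchy by (meson zero_less_power)
  have "norm (\<Sum>k=m..<n. a k *\<^sub>R e k) < \<epsilon>" if "m \<ge> N" for m n
  proof (rule power2_less_imp_less)
    show "(norm (\<Sum>k=m..<n. a k *\<^sub>R e k))\<^sup>2 < \<epsilon>\<^sup>2"
      using N[OF that, of n] by (simp add: norm_finite_sum abs_of_nonneg sum_nonneg)
  qed (use \<open>\<epsilon> > 0\<close> in simp)
  then show "\<exists>N. \<forall>m\<ge>N. \<forall>n. norm (\<Sum>k=m..<n. a k *\<^sub>R e k) < \<epsilon>"
    by blast
qed

definition combination :: "(nat \<Rightarrow> real) \<Rightarrow> 'a" where
  "combination a = (\<Sum>n. a n *\<^sub>R e n)"

lemma combination_sums:
  "summable (\<lambda>n. (a n)\<^sup>2) \<Longrightarrow> (\<lambda>n. a n *\<^sub>R e n) sums combination a"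
  unfolding combination_def by (simp add: summable_combination summable_sums)

lemma inner_combination [simp]:
  assumes "summable (\<lambda>n. (a n)\<^sup>2)"
  shows "inner (combination a) (e m) = a m"
proof (rule LIMSEQ_unique)
  show "(\<lambda>N. inner (\<Sum>n<N. a n *\<^sub>R e n) (e m)) \<longlonglongrightarrow> inner (combination a) (e m)"
    using combination_sums[OF assms] unfolding sums_def by (intro tendsto_intros)
  show "(\<lambda>N. inner (\<Sum>n<N. a n *\<^sub>R e n) (e m)) \<longlonglongrightarrow> a m"
    by (rule tendsto_eventually)
      (auto simp: inner_finite_sum eventually_at_top_linorder intro!: exI[of _ "Suc m"])
qed

text \<open>Bessel makes the coefficients square summable, so their combination exists; it has the
  coordinates of \<open>x\<close>, and totality identifies the two.\<close>

lemma expansion: "(\<lambda>n. inner x (e n) *\<^sub>R e n) sums x"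
proof -
  have "combination (\<lambda>n. inner x (e n)) = x"
    by (rule coord_eqI) (simp add: summable_coord)
  with combination_sums[OF summable_coord[of x]] show ?thesis by simp
qed

lemma parseval: "(\<lambda>n. inner x (e n) * inner y (e n)) sums inner x y"
proof -
  have "(\<lambda>n. inner y (inner x (e n) *\<^sub>R e n)) sums inner y x"
    by (rule bounded_linear.sums[OF bounded_linear_inner_right expansion])
  then show ?thesis by (simp add: inner_commute)
qed

lemma parseval_norm: "(\<lambda>n. (inner x (e n))\<^sup>2) sums (norm x)\<^sup>2"
  using parseval[of x x] by (simp add: power2_norm_eq_inner flip: power2_eq_square)

text \<open>Functional calculus of a diagonal operator. For an unbounded \<open>m\<close> the series
  may diverge and the value is meaningless, so the facts below carry a uniform bound on
  \<open>m\<close>.\<close>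

definition multiplier :: "(nat \<Rightarrow> real) \<Rightarrow> 'a \<Rightarrow> 'a" where
  "multiplier m x = combination (\<lambda>n. m n * inner x (e n))"

lemma summable_bounded_mult:
  assumes "\<And>n. \<bar>m n\<bar> \<le> B"
  shows "summable (\<lambda>n. (m n * inner x (e n))\<^sup>2)"
proof (rule summable_comparison_test')
  show "summable (\<lambda>n. B\<^sup>2 * (inner x (e n))\<^sup>2)"
    by (intro summable_mult summable_coord)
  show "norm ((m n * inner x (e n))\<^sup>2) \<le> B\<^sup>2 * (inner x (e n))\<^sup>2" if "n \<ge> 0" for n
    using assms[of n] by (auto simp: power_mult_distrib intro!: mult_right_mono abs_le_square_iff[THEN iffD1])
qed

lemma inner_multiplier:
  assumes "\<And>n. \<bar>m n\<bar> \<le> B"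
  shows "inner (multiplier m x) (e n) = m n * inner x (e n)"
  unfolding multiplier_def by (simp add: summable_bounded_mult[OF assms])

lemma norm_multiplier_le:
  assumes "\<And>n. \<bar>m n\<bar> \<le> B"
  shows "norm (multiplier m x) \<le> B * norm x"
proof (rule power2_le_imp_le)
  have B: "B \<ge> 0" using assms[of 0] by linarith
  have "(norm (multiplier m x))\<^sup>2 = (\<Sum>n. (m n * inner x (e n))\<^sup>2)"
    using parseval_norm[of "multiplier m x"] by (simp add: inner_multiplier[OF assms] sums_iff)
  also have "\<dots> \<le> (\<Sum>n. B\<^sup>2 * (inner x (e n))\<^sup>2)"
  proof (rule suminf_le)
    show "(m n * inner x (e n))\<^sup>2 \<le> B\<^sup>2 * (inner x (e n))\<^sup>2" for n
      using assms[of n]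
      by (auto simp: power_mult_distrib intro!: mult_right_mono abs_le_square_iff[THEN iffD1])
  qed (intro summable_mult summable_coord summable_bounded_mult[OF assms])+
  also have "\<dots> = (B * norm x)\<^sup>2"
    using parseval_norm[of x] by (simp add: suminf_mult summable_coord sums_iff power_mult_distrib)
  finally show "(norm (multiplier m x))\<^sup>2 \<le> (B * norm x)\<^sup>2" .
  show "0 \<le> B * norm x" using B by simp
qed

text \<open>Dominated convergence for series: by Parseval the squared distance is a series whose
  terms tend to zero and are dominated through the uniform bound. Pointwise convergence of
  multipliers is therefore enough, both for strong continuity and for the generator.\<close>

lemma multiplier_tendsto:
  assumes lim: "\<And>n. ((\<lambda>h. m h n) \<longlongrightarrow> m0 n) F"
    and bound: "\<forall>\<^sub>F h in F. \<forall>n. \<bar>m h n\<bar> \<le> B" and "F \<noteq> bot"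
  shows "((\<lambda>h. multiplier (m h) x) \<longlongrightarrow> multiplier m0 x) F"
proof -
  \<comment> \<open>The limit inherits the bound, so differences are at most \<open>2 * B\<close>,
    the constant in the majorant.\<close>
  have bound0: "\<bar>m0 n\<bar> \<le> B" for n
    by (rule tendsto_upperbound[OF tendsto_rabs[OF lim]])
      (use bound \<open>F \<noteq> bot\<close> in \<open>auto elim: eventually_mono\<close>)
  let ?a = "\<lambda>n h. ((m h n - m0 n) * inner x (e n))\<^sup>2"
  have b: "\<forall>\<^sub>F h in F. \<forall>n. norm (?a n h) \<le> (2 * B)\<^sup>2 * (inner x (e n))\<^sup>2"
    using bound
  proof eventually_elim
    case (elim h)
    have "(m h n - m0 n)\<^sup>2 \<le> (2 * B)\<^sup>2" for n
      using elim[rule_format, of n] bound0[of n] abs_le_square_iff[of "m h n - m0 n" "2 * B"] by linarith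
    then show ?case by (auto simp: power_mult_distrib[of "_ - _"] intro!: mult_right_mono)
  qed
  have "((\<lambda>h. \<Sum>n. ?a n h) \<longlongrightarrow> (\<Sum>n. 0)) F"
  proof (rule conjunct2[OF conjunct2[OF tannerys_theorem]])
    show "(?a n \<longlongrightarrow> 0) F" for n
      by (rule tendsto_eq_intros refl lim | simp)+
    show "\<forall>\<^sub>F (k, h) in at_top \<times>\<^sub>F F. norm (?a k h) \<le> (2 * B)\<^sup>2 * (inner x (e k))\<^sup>2"
      unfolding eventually_prod_filter
      by (rule exI[of _ "\<lambda>_. True"], rule exI[of _ "\<lambda>h. \<forall>n. norm (?a n h) \<le> (2 * B)\<^sup>2 * (inner x (e n))\<^sup>2"])
        (use b in auto)
    show "summable (\<lambda>n. (2 * B)\<^sup>2 * (inner x (e n))\<^sup>2)"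
      by (intro summable_mult summable_coord)
  qed fact
  moreover have "\<forall>\<^sub>F h in F. (\<Sum>n. ?a n h) = (norm (multiplier (m h) x - multiplier m0 x))\<^sup>2"
    using bound
  proof eventually_elim
    case (elim h)
    then have "inner (multiplier (m h) x - multiplier m0 x) (e n) = (m h n - m0 n) * inner x (e n)" for n
      using inner_multiplier[of "m h" B] inner_multiplier[OF bound0] 
      by (simp add: inner_diff_left left_diff_distrib)
    then show ?case
      using parseval_norm[of "multiplier (m h) x - multiplier m0 x"] by (simp add: sums_iff)
  qed
  ultimately have "((\<lambda>h. (norm (multiplier (m h) x - multiplier m0 x))\<^sup>2) \<longlongrightarrow> 0) F"
    by (auto simp: filterlim_cong)
  then have "((\<lambda>h. norm (multiplier (m h) x - multiplier m0 x)) \<longlongrightarrow> 0) F"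
    using tendsto_real_sqrt by fastforce
  then show ?thesis
    using LIM_zero_cancel tendsto_norm_zero_iff by blast
qed

text \<open>A multiplier tending to zero is a uniform limit of finite rank ones: cutting off at a
  large \<open>N\<close> costs little, and the truncated images lie in a box of a finite-dimensional
  space.\<close>

lemma compact_closure_multiplier:
  assumes bound: "\<And>n. \<bar>m n\<bar> \<le> B" and lim: "m \<longlonglongrightarrow> 0"
  shows "compact (closure (multiplier m ` cball 0 1))"
proof -
  let ?S = "multiplier m ` cball 0 1"
  \<comment> \<open>The box with sides \<open>{- B..B}\<close> along the first \<open>N\<close>
    basis vectors; it is compact by induction, adding one compact segment at a time.\<close>
  define C where "C N = {(\<Sum>n<N. a n *\<^sub>R e n) | a. \<forall>n. \<bar>a n\<bar> \<le> B}" for N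
  have compC: "compact (C N)" for N
  proof (induction N)
    case 0
    have "C 0 \<subseteq> {0}" by (auto simp: C_def)
    then show ?case using compact_insert finite_imp_compact finite_subset by blast
  next
    case (Suc N)
    have "compact ((\<lambda>c. c *\<^sub>R e N) ` {-B..B})"
      by (intro compact_continuous_image continuous_intros) auto
    then have "compact {x + y | x y. x \<in> C N \<and> y \<in> (\<lambda>c. c *\<^sub>R e N) ` {-B..B}}"
      using compact_sums Suc by blast
    also have "{x + y | x y. x \<in> C N \<and> y \<in> (\<lambda>c. c *\<^sub>R e N) ` {-B..B}} = C (Suc N)"
    proof safe
      fix x c assume "x \<in> C N" "c \<in> {-B..B}"
      then obtain a where a: "x = (\<Sum>n<N. a n *\<^sub>R e n)" "\<forall>n. \<bar>a n\<bar> \<le> B"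
        unfolding C_def by blast
      have "x + c *\<^sub>R e N = (\<Sum>n<Suc N. (a(N := c)) n *\<^sub>R e n)" using a by simp
      moreover have "\<forall>n. \<bar>(a(N := c)) n\<bar> \<le> B" using a \<open>c \<in> _\<close> by auto
      ultimately show "x + c *\<^sub>R e N \<in> C (Suc N)" unfolding C_def by blast
    next
      fix y assume "y \<in> C (Suc N)"
      then obtain a where a: "y = (\<Sum>n<N. a n *\<^sub>R e n) + a N *\<^sub>R e N" "\<forall>n. \<bar>a n\<bar> \<le> B"
        unfolding C_def by auto
      then show "\<exists>x z. y = x + z \<and> x \<in> C N \<and> z \<in> (\<lambda>c. c *\<^sub>R e N) ` {-B..B}"
        unfolding C_def using abs_le_iff
        by (intro exI[of _ "\<Sum>n<N. a n *\<^sub>R e n"] exI[of _ "a N *\<^sub>R e N"]) (auto simp: abs_le_iff minus_le_iff)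
    qed
    finally show ?case .
  qed
  have net: "\<exists>k. finite k \<and> closure ?S \<subseteq> (\<Union>x\<in>k. ball x \<epsilon>)" if "\<epsilon> > 0" for \<epsilon>
  proof -
    have "\<exists>N. \<forall>n\<ge>N. \<bar>m n\<bar> < \<epsilon> / 4"
      using LIMSEQ_D[OF lim, of "\<epsilon> / 4"] that by simp
    then obtain N where N: "\<And>n. n \<ge> N \<Longrightarrow> \<bar>m n\<bar> < \<epsilon> / 4"
      by blast
    have pos: "0 < \<epsilon> / 4" using that by simp
    obtain k where k: "finite k" "C N \<subseteq> (\<Union>x\<in>k. ball x (\<epsilon> / 4))"
      using compC[of N, unfolded compact_eq_totally_bounded, THEN conjunct2, rule_format, OF pos]
      by blast
    \<comment> \<open>Truncation and the net of the box cost \<open>\<epsilon> / 4\<close> each.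
      Closed balls make the finite union closed, so it also covers the closure, with room left for
      open balls of radius \<open>\<epsilon>\<close>.\<close>
    have "?S \<subseteq> (\<Union>x\<in>k. cball x (\<epsilon> / 2))"
    proof safe
      fix x :: 'a assume x: "x \<in> cball 0 1"
      let ?y = "\<Sum>n<N. inner (multiplier m x) (e n) *\<^sub>R e n"
      let ?m = "\<lambda>n. if n < N then 0 else m n"
      have m': "\<bar>?m n\<bar> \<le> \<epsilon> / 4" for n using N[of n] that by auto
      have "multiplier m x - ?y = multiplier ?m x"
        by (rule coord_eqI)
          (simp add: inner_diff_left inner_finite_sum inner_multiplier[OF m'] inner_multiplier[OF bound])
      moreover have "norm (multiplier ?m x) \<le> \<epsilon> / 4 * norm x"
        by (rule norm_multiplier_le[OF m'])
      moreover have "\<epsilon> / 4 * norm x \<le> \<epsilon> / 4 * 1"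
        using x that by (intro mult_left_mono) auto
      ultimately have 1: "dist (multiplier m x) ?y \<le> \<epsilon> / 4"
        by (simp add: dist_norm)
      have "\<bar>inner (multiplier m x) (e n)\<bar> \<le> B" for n
      proof -
        have "\<bar>inner (multiplier m x) (e n)\<bar> \<le> norm (multiplier m x) * norm (e n)"
          by (rule Cauchy_Schwarz_ineq2)
        also have "\<dots> \<le> B * norm x" using norm_multiplier_le[OF bound] by simp
        also have "\<dots> \<le> B * 1"
          using x bound[of 0] by (intro mult_left_mono) auto
        finally show ?thesis by simp
      qed
      then have "?y \<in> C N"
        unfolding C_def by (intro CollectI exI[of _ "\<lambda>n. inner (multiplier m x) (e n)"]) simp
      then obtain z where "z \<in> k" "dist z ?y < \<epsilon> / 4" using k by fastforce
      then have "dist z (multiplier m x) \<le> \<epsilon> / 2"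
        using 1 dist_triangle_half_l[of z ?y "\<epsilon>/2" "multiplier m x"] dist_triangle[of z "multiplier m x" ?y]
        by (simp add: dist_commute)
      then show "multiplier m x \<in> (\<Union>x\<in>k. cball x (\<epsilon> / 2))" using \<open>z \<in> k\<close> by auto
    qed
    moreover have "closed (\<Union>x\<in>k. cball x (\<epsilon> / 2))" using k by (intro closed_UN) auto
    ultimately have "closure ?S \<subseteq> (\<Union>x\<in>k. cball x (\<epsilon> / 2))" by (rule closure_minimal)
    also have "\<dots> \<subseteq> (\<Union>x\<in>k. ball x \<epsilon>)" using that by (intro UN_mono) auto
    finally show ?thesis using k by blast
  qed
  show ?thesis
    unfolding compact_eq_totally_bounded using net by (auto simp: complete_eq_closed)
qed

end

section \<open>Diagonal operators\<close>

text \<open>The spaces of the statement carry their own inner products on one common type. An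
  isometry onto a complete type class space turns their metric notions into class notions, and its
  surjectivity supplies their completeness.\<close>

locale isometric_model =
  fixes V :: "'b::real_vector set" and ip :: "'b \<Rightarrow> 'b \<Rightarrow> real"
    and U :: "'b \<Rightarrow> 'a::{real_inner,banach}"
  assumes subspace: "subspace V"
    and U_add: "x \<in> V \<Longrightarrow> y \<in> V \<Longrightarrow> U (x + y) = U x + U y"
    and U_scale: "x \<in> V \<Longrightarrow> U (c *\<^sub>R x) = c *\<^sub>R U x"
    and bij: "bij_betw U V UNIV"
    and ip_eq: "x \<in> V \<Longrightarrow> y \<in> V \<Longrightarrow> ip x y = inner (U x) (U y)"
begin

definition W :: "'a \<Rightarrow> 'b" where
  "W = inv_into V U"

lemma W_in [simp]: "W y \<in> V"
  unfolding W_def using bij by (metis UNIV_I bij_betw_imp_surj_on inv_into_into)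

lemma U_W [simp]: "U (W y) = y"
  unfolding W_def using bij by (metis UNIV_I bij_betw_imp_surj_on f_inv_into_f)

lemma W_U [simp]: "x \<in> V \<Longrightarrow> W (U x) = x"
  unfolding W_def using bij by (meson bij_betw_imp_inj_on inv_into_f_f)

lemma U_inject: "x \<in> V \<Longrightarrow> y \<in> V \<Longrightarrow> U x = U y \<longleftrightarrow> x = y"
  using W_U by metis

lemma add_in: "x \<in> V \<Longrightarrow> y \<in> V \<Longrightarrow> x + y \<in> V"
  and scale_in: "x \<in> V \<Longrightarrow> c *\<^sub>R x \<in> V"
  and diff_in: "x \<in> V \<Longrightarrow> y \<in> V \<Longrightarrow> x - y \<in> V"
  and zero_in: "0 \<in> V"
  using subspace by (simp_all add: subspace_add subspace_scale subspace_diff subspace_0)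

lemma U_diff: "x \<in> V \<Longrightarrow> y \<in> V \<Longrightarrow> U (x - y) = U x - U y"
  using U_add[of x "(-1) *\<^sub>R y"] U_scale[of y "-1"] scale_in[of y "-1"] by simp

lemma U_zero [simp]: "U 0 = 0"
  using U_diff[OF zero_in zero_in] by simp

lemma U_sum: "finite F \<Longrightarrow> (\<And>n. n \<in> F \<Longrightarrow> x n \<in> V) \<Longrightarrow> U (\<Sum>n\<in>F. x n) = (\<Sum>n\<in>F. U (x n))"
  by (induction F rule: finite_induct) (simp_all add: U_add subspace_sum[OF subspace])

lemma ip_norm_eq: "x \<in> V \<Longrightarrow> ip_norm ip x = norm (U x)"
  by (simp add: ip_norm_def ip_eq norm_eq_sqrt_inner)

lemma ip_dist_eq: "x \<in> V \<Longrightarrow> y \<in> V \<Longrightarrow> ip_dist V ip x y = dist (U x) (U y)"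
  by (simp add: ip_dist_def diff_in ip_norm_eq U_diff dist_norm)

lemma Metric_space_ip: "Metric_space V (ip_dist V ip)"
proof
  show "0 \<le> ip_dist V ip x y" for x y
    by (simp add: ip_dist_def diff_in ip_norm_eq)
  show "ip_dist V ip x y = ip_dist V ip y x" for x y
    by (simp add: ip_dist_def diff_in ip_norm_eq U_diff norm_minus_commute)
  show "ip_dist V ip x y = 0 \<longleftrightarrow> x = y" if "x \<in> V" "y \<in> V" for x y
    using that by (simp add: ip_dist_eq U_inject)
  show "ip_dist V ip x z \<le> ip_dist V ip x y + ip_dist V ip y z"
    if "x \<in> V" "y \<in> V" "z \<in> V" for x y z
    using that by (simp add: ip_dist_eq dist_triangle)
qed

sublocale V: Metric_space V "ip_dist V ip"
  by (rule Metric_space_ip)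

abbreviation "top_V \<equiv> ip_topology V ip"

lemma topspace_top_V [simp]: "topspace top_V = V"
  by (simp add: ip_topology_def)

text \<open>Replaces the abstract metric topology by filters in the model space; later limits in
  \<open>V\<close> are settled through this form.\<close>

lemma limitin_iff:
  "limitin top_V f x F \<longleftrightarrow> x \<in> V \<and> (\<forall>\<^sub>F h in F. f h \<in> V) \<and> ((\<lambda>h. U (f h)) \<longlongrightarrow> U x) F"
proof
  assume "limitin top_V f x F"
  then have x: "x \<in> V" and *: "\<And>\<epsilon>. \<epsilon> > 0 \<Longrightarrow> \<forall>\<^sub>F h in F. f h \<in> V \<and> ip_dist V ip (f h) x < \<epsilon>"
    unfolding ip_topology_def V.limitin_metric by auto
  have "\<forall>\<^sub>F h in F. f h \<in> V" using *[of 1] by (auto elim: eventually_mono)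
  moreover have "((\<lambda>h. U (f h)) \<longlongrightarrow> U x) F"
    by (rule tendstoI) (use * x in \<open>force simp: ip_dist_eq elim: eventually_mono\<close>)
  ultimately show "x \<in> V \<and> (\<forall>\<^sub>F h in F. f h \<in> V) \<and> ((\<lambda>h. U (f h)) \<longlongrightarrow> U x) F"
    using x by blast
next
  assume *: "x \<in> V \<and> (\<forall>\<^sub>F h in F. f h \<in> V) \<and> ((\<lambda>h. U (f h)) \<longlongrightarrow> U x) F"
  have "\<forall>\<^sub>F h in F. f h \<in> V \<and> ip_dist V ip (f h) x < \<epsilon>" if "\<epsilon> > 0" for \<epsilon>
    using *[THEN conjunct2, THEN conjunct1] tendstoD[OF *[THEN conjunct2, THEN conjunct2] that]
    by eventually_elim (use * in \<open>simp add: ip_dist_eq\<close>)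
  then show "limitin top_V f x F"
    unfolding ip_topology_def V.limitin_metric using * by auto
qed

lemma hilbert_space_V: "hilbert_space_on V ip"
proof -
  have "inner_product_on V ip"
    unfolding inner_product_on_def
    using U_inject[OF _ zero_in]
    by (auto simp: subspace ip_eq add_in scale_in U_add U_scale inner_add_left intro: inner_commute)
  moreover have "V.mcomplete"
    unfolding V.mcomplete_def
  proof (intro allI impI)
    fix \<sigma> assume \<sigma>: "V.MCauchy \<sigma>"
    then have in_V: "\<sigma> n \<in> V" for n by (auto simp: V.MCauchy_def)
    with \<sigma> have "Cauchy (\<lambda>n. U (\<sigma> n))"
      unfolding V.MCauchy_def Cauchy_def by (simp add: ip_dist_eq)
    then obtain y where "(\<lambda>n. U (\<sigma> n)) \<longlonglongrightarrow> y"
      using Cauchy_convergent_iff convergent_def by blast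
    then have "limitin top_V \<sigma> (W y) sequentially"
      by (simp add: limitin_iff in_V)
    then show "\<exists>x. limitin V.mtopology \<sigma> x sequentially"
      unfolding ip_topology_def by blast
  qed
  ultimately show ?thesis by (simp add: hilbert_space_on_def)
qed

text \<open>Balls correspond to balls under an isometry. The homeomorphism transports closed graphs
  and compact closures, which are phrased topologically and not by sequences.\<close>

lemma homeomorphic_maps: "homeomorphic_maps top_V euclidean U W"
  unfolding homeomorphic_maps_def
proof (intro conjI)
  show "continuous_map top_V euclidean U"
    unfolding continuous_map_def
  proof (intro conjI allI impI)
    fix S :: "'a set" assume "openin euclidean S"
    then have S: "open S" by simp
    show "openin top_V {x \<in> topspace top_V. U x \<in> S}"
      unfolding ip_topology_def V.openin_mtopology
    proof (intro conjI allI impI)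
      fix x assume "x \<in> {x \<in> topspace V.mtopology. U x \<in> S}"
      then have x: "x \<in> V" "U x \<in> S" by auto
      then obtain r where r: "r > 0" "ball (U x) r \<subseteq> S" using S openE by blast
      have "V.mball x r \<subseteq> {x \<in> topspace V.mtopology. U x \<in> S}"
        using r x by (auto simp: ip_dist_eq subset_iff)
      then show "\<exists>r>0. V.mball x r \<subseteq> {x \<in> topspace V.mtopology. U x \<in> S}" using r by blast
    qed auto
  qed auto
  show "continuous_map euclidean top_V W"
    unfolding continuous_map_def
  proof (intro conjI allI impI)
    fix S assume "openin top_V S"
    then have S: "S \<subseteq> V" "\<And>x. x \<in> S \<Longrightarrow> \<exists>r>0. V.mball x r \<subseteq> S"
      unfolding ip_topology_def V.openin_mtopology by auto
    have "\<exists>r>0. ball y r \<subseteq> {y. W y \<in> S}" if y: "W y \<in> S" for y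
    proof -
      obtain r where r: "r > 0" "V.mball (W y) r \<subseteq> S" using S(2)[OF y] by blast
      have "ball y r \<subseteq> {y. W y \<in> S}"
        using r by (auto simp: ip_dist_eq subset_iff)
      then show ?thesis using r by blast
    qed
    then have "open {y. W y \<in> S}" unfolding open_contains_ball by blast
    then show "openin euclidean {y \<in> topspace euclidean. W y \<in> S}" by simp
  qed auto
qed auto

lemma homeomorphic_map_U: "homeomorphic_map top_V euclidean U"
  using homeomorphic_maps homeomorphic_maps_imp_map by blast

lemma closedin_prod_iff:
  assumes "G \<subseteq> V \<times> V"
  shows "closedin (prod_topology top_V top_V) G \<longleftrightarrow> closed (map_prod U U ` G)"
proof -
  have "homeomorphic_maps (prod_topology top_V top_V) (prod_topology euclidean euclidean)
      (\<lambda>(x, y). (U x, U y)) (\<lambda>(x, y). (W x, W y))"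
    unfolding homeomorphic_maps_prod using homeomorphic_maps by blast
  then have "homeomorphic_map (prod_topology top_V top_V) euclidean (map_prod U U)"
    by (simp add: homeomorphic_maps_imp_map map_prod_def)
  from homeomorphic_map_closedness[OF this, of G] show ?thesis using assms by simp
qed

lemma closure_of_eq_V_I:
  assumes "S \<subseteq> V" "\<And>x. x \<in> V \<Longrightarrow> \<exists>\<sigma>. (\<forall>n::nat. \<sigma> n \<in> S) \<and> (\<lambda>n. U (\<sigma> n)) \<longlonglongrightarrow> U x"
  shows "top_V closure_of S = V"
proof
  show "top_V closure_of S \<subseteq> V"
    using closure_of_subset_topspace[of top_V] by simp
  show "V \<subseteq> top_V closure_of S"
  proof
    fix x assume x: "x \<in> V"
    then obtain \<sigma> where \<sigma>: "\<And>n::nat. \<sigma> n \<in> S" "(\<lambda>n. U (\<sigma> n)) \<longlonglongrightarrow> U x"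
      using assms by blast
    have "\<exists>y\<in>S. y \<in> V.mball x r" if r: "r > 0" for r
    proof -
      obtain n where "dist (U (\<sigma> n)) (U x) < r"
        using tendstoD[OF \<sigma>(2) r] by (auto simp: eventually_sequentially)
      moreover have "\<sigma> n \<in> V" using \<sigma>(1) assms(1) by auto
      ultimately have "\<sigma> n \<in> V.mball x r" using x by (simp add: ip_dist_eq dist_commute)
      then show ?thesis using \<sigma>(1) by blast
    qed
    then show "x \<in> top_V closure_of S"
      unfolding ip_topology_def V.metric_closure_of using x by blast
  qed
qed

end

text \<open>\<open>G\<close> is the maximal multiplication operator: the existence of an image
  \<open>y\<close> in \<open>V\<close> encodes square summability of \<open>l n\<close> times the
  coordinates, so no separate domain condition appears.\<close>

locale diagonal_operator = orthonormal_basis e + isometric_model V ip U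
  for e :: "nat \<Rightarrow> 'a::{real_inner,banach}" and V :: "'b::real_vector set" and ip and U :: "'b \<Rightarrow> 'a" +
  fixes l :: "nat \<Rightarrow> real" and \<omega> :: real and G :: "('b \<times> 'b) set"
  assumes inj_l: "inj l"
    and \<omega>_pos: "\<omega> > 0" and l_le: "l n \<le> - \<omega>"
    and l_lim: "filterlim l at_bot sequentially"
    and G_iff: "(x, y) \<in> G \<longleftrightarrow> x \<in> V \<and> y \<in> V \<and> (\<forall>n. inner (U y) (e n) = l n * inner (U x) (e n))"
begin

definition f :: "nat \<Rightarrow> 'b" where
  "f n = W (e n)"

lemma f_in [simp]: "f n \<in> V" and U_f [simp]: "U (f n) = e n"
  by (simp_all add: f_def)

lemma V_eqI: "x \<in> V \<Longrightarrow> y \<in> V \<Longrightarrow> (\<And>n. inner (U x) (e n) = inner (U y) (e n)) \<Longrightarrow> x = y"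
  using coord_eqI U_inject by blast

lemma f_eigen: "(f n, l n *\<^sub>R f n) \<in> G"
  by (simp add: G_iff scale_in U_scale orthonormal)

lemma subspace_G: "subspace G"
  unfolding subspace_def
  by (auto simp: zero_prod_def G_iff zero_in add_in scale_in U_add U_scale inner_add_left algebra_simps)

lemma linear_G: "linear_operator_on V G"
proof -
  have "single_valued G"
    by (rule single_valuedI) (simp add: G_iff V_eqI)
  then show ?thesis
    unfolding linear_operator_on_def using subspace_G by (auto simp: G_iff)
qed

text \<open>Each coordinate condition is closed in the product of the model space with itself, and
  the graph is carried onto their intersection.\<close>

lemma closed_G: "closed_operator_on V ip G"
proof -
  have "map_prod U U ` G = (\<Inter>n. {p. inner (snd p) (e n) = l n * inner (fst p) (e n)})"
  proof safe
    fix a b assume "(a, b) \<in> (\<Inter>n. {p. inner (snd p) (e n) = l n * inner (fst p) (e n)})"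
    then have "(W a, W b) \<in> G" by (auto simp: G_iff)
    then show "(a, b) \<in> map_prod U U ` G" by (force simp: map_prod_def)
  qed (auto simp: G_iff)
  moreover have "closed (\<Inter>n. {p. inner (snd p) (e n) = l n * inner (fst p) (e n)})"
    by (intro closed_INT ballI closed_Collect_eq continuous_intros)
  ultimately have "closed (map_prod U U ` G)" by simp
  moreover have "G \<subseteq> V \<times> V" by (auto simp: G_iff)
  ultimately show ?thesis
    unfolding closed_operator_on_def using linear_G closedin_prod_iff by blast
qed

lemma U_lincomb: "U (\<Sum>n<N. a n *\<^sub>R f n) = (\<Sum>n<N. a n *\<^sub>R e n)"
  by (simp add: U_sum U_scale scale_in)

lemma span_f_subset: "span (range f) \<subseteq> V"
  by (intro span_minimal subspace) auto

lemma dense_span_f: "ip_topology V ip closure_of span (range f) = V"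
proof (rule closure_of_eq_V_I[OF span_f_subset])
  fix x assume "x \<in> V"
  show "\<exists>\<sigma>. (\<forall>n::nat. \<sigma> n \<in> span (range f)) \<and> (\<lambda>n. U (\<sigma> n)) \<longlonglongrightarrow> U x"
    using expansion[of "U x"] unfolding sums_def
    by (intro exI[of _ "\<lambda>N. \<Sum>n<N. inner (U x) (e n) *\<^sub>R f n"])
      (auto simp: U_lincomb intro!: span_sum intro: span_scale span_base)
qed

lemma dense_Domain: "ip_topology V ip closure_of Domain G = V"
proof -
  have "subspace (Domain G)"
  proof (rule subspaceI)
    show "0 \<in> Domain G"
      using subspace_0[OF subspace_G] by (auto simp: zero_prod_def)
    show "x + y \<in> Domain G" if "x \<in> Domain G" "y \<in> Domain G" for x y
      using that subspace_add[OF subspace_G] by (fastforce simp: Domain_iff)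
    show "c *\<^sub>R x \<in> Domain G" if "x \<in> Domain G" for c x
      using that subspace_scale[OF subspace_G] by (fastforce simp: Domain_iff)
  qed
  then have "span (range f) \<subseteq> Domain G"
    using f_eigen by (intro span_minimal) auto
  then have "V \<subseteq> ip_topology V ip closure_of Domain G"
    using closure_of_mono[of "span (range f)" "Domain G" top_V] by (simp add: dense_span_f)
  then show ?thesis
    using closure_of_subset_topspace[of top_V] by simp blast
qed

text \<open>Testing the adjoint relation on the eigenvectors \<open>f n\<close> alone already forces
  \<open>G_iff\<close>; the converse is Parseval, as moving the real factor \<open>l n\<close>
  between the two coordinates leaves the series unchanged.\<close>

lemma adjoint_G: "adjoint_on V ip G = G"
proof -
  have "(y, z) \<in> G" if y: "y \<in> V" "z \<in> V" and *: "\<And>x w. (x, w) \<in> G \<Longrightarrow> ip w y = ip x z" for y z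
    using *[OF f_eigen] y
    by (auto simp: G_iff ip_eq scale_in U_scale inner_commute)
  moreover have "ip w y = ip x z" if "(y, z) \<in> G" "(x, w) \<in> G" for x y z w
  proof -
    have "(\<lambda>n. inner (U w) (e n) * inner (U y) (e n)) = (\<lambda>n. inner (U x) (e n) * inner (U z) (e n))"
      using that by (auto simp: G_iff)
    then have "inner (U w) (U y) = inner (U x) (U z)"
      using parseval[of "U w" "U y"] parseval[of "U x" "U z"] sums_unique2 by metis
    then show ?thesis using that by (simp add: G_iff ip_eq)
  qed
  moreover have "G \<subseteq> V \<times> V" by (auto simp: G_iff)
  ultimately show ?thesis
    unfolding adjoint_on_def by blast
qed

theorem self_adjoint: "self_adjoint_on V ip G"
  unfolding self_adjoint_on_def
  using hilbert_space_V linear_G dense_Domain adjoint_G by blast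

lemma eigenspace_iff:
  "x \<in> eigenspace G c \<longleftrightarrow> x \<in> V \<and> (\<forall>n. l n \<noteq> c \<longrightarrow> inner (U x) (e n) = 0)"
proof -
  have "c * a = l n * a \<longleftrightarrow> (l n \<noteq> c \<longrightarrow> a = 0)" for n a by auto
  then show ?thesis
    unfolding eigenspace_def mem_Collect_eq G_iff
    by (metis inner_scaleR_left scale_in U_scale)
qed

lemma eigenspace_eq: "eigenspace G (l n) = span {f n}"
proof
  show "eigenspace G (l n) \<subseteq> span {f n}"
  proof
    fix x assume "x \<in> eigenspace G (l n)"
    then have x: "x \<in> V" "\<And>m. m \<noteq> n \<Longrightarrow> inner (U x) (e m) = 0"
      using inj_l by (auto simp: eigenspace_iff inj_eq)
    then have "x = inner (U x) (e n) *\<^sub>R f n"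
      by (intro V_eqI) (auto simp: scale_in U_scale orthonormal)
    then show "x \<in> span {f n}" by (metis span_base span_scale singletonI)
  qed
  show "span {f n} \<subseteq> eigenspace G (l n)"
    unfolding span_singleton
    by (auto simp: eigenspace_iff scale_in U_scale orthonormal)
qed

lemma f_nonzero: "f n \<noteq> 0"
  using U_f[of n] U_zero norm_e[of n] by (metis norm_zero zero_neq_one)

lemma eigenvalues_eq: "eigenvalues G = range l"
proof
  show "eigenvalues G \<subseteq> range l"
  proof
    fix c assume "c \<in> eigenvalues G"
    then obtain x where x: "x \<in> eigenspace G c" "x \<noteq> 0" unfolding eigenvalues_def by blast
    show "c \<in> range l"
    proof (rule ccontr)
      assume "c \<notin> range l"
      then have "x = 0"
        using x(1) by (intro V_eqI) (auto simp: eigenspace_iff zero_in)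
      then show False using x by blast
    qed
  qed
  show "range l \<subseteq> eigenvalues G"
    unfolding eigenvalues_def using f_nonzero eigenspace_eq span_base by fastforce
qed

text \<open>For \<open>m\<close> different from \<open>n\<close>, coordinate \<open>m\<close> of
  \<open>w - l n *\<^sub>R y\<close> is \<open>l m - l n\<close> times that of \<open>y\<close>. If
  the former vanishes so does the latter, which excludes generalised eigenvectors.\<close>

lemma simple: "simple_eigenvalue G (l n)"
  unfolding simple_eigenvalue_def
proof (intro conjI ballI exI)
  show "f n \<noteq> 0" by (rule f_nonzero)
  show "eigenspace G (l n) = span {f n}" by (rule eigenspace_eq)
  fix p assume "p \<in> G"
  then obtain y w where p: "p = (y, w)" "(y, w) \<in> G" by (cases p) auto
  show "case p of (y, w) \<Rightarrow> w - l n *\<^sub>R y \<in> eigenspace G (l n) \<longrightarrow> y \<in> eigenspace G (l n)"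
    using p(2) by (auto simp: p(1) eigenspace_iff G_iff U_diff U_scale scale_in inner_diff_left)
qed

lemma riesz_basis_f: "riesz_basis_on V ip f"
  unfolding riesz_basis_on_def
proof (intro conjI exI allI)
  show "range f \<subseteq> V" by auto
  show "ip_topology V ip closure_of span (range f) = V" by (rule dense_span_f)
  show "(0::real) < 1" "(0::real) < 1" by simp_all
  have "(ip_norm ip (\<Sum>n<N. a n *\<^sub>R f n))\<^sup>2 = (\<Sum>n<N. (a n)\<^sup>2)" for N a
    by (simp add: ip_norm_eq subspace_sum[OF subspace] scale_in U_lincomb norm_finite_sum)
  then show "1 * (\<Sum>n<N. (a n)\<^sup>2) \<le> (ip_norm ip (\<Sum>n<N. a n *\<^sub>R f n))\<^sup>2"
    "(ip_norm ip (\<Sum>n<N. a n *\<^sub>R f n))\<^sup>2 \<le> 1 * (\<Sum>n<N. (a n)\<^sup>2)" for N a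
    by simp_all
qed

text \<open>Only finitely many \<open>l n\<close> lie above a given real, so a connected set with
  two points \<open>a < b\<close> would put the infinite interval \<open>{a<..b}\<close> into a
  finite set.\<close>

lemma totally_disconnected_spectrum: "totally_disconnected (closure (range l))"
  unfolding totally_disconnected_def
proof (intro allI impI)
  fix C assume C: "C \<subseteq> closure (range l)" "connected C"
  have "a = b" if "a \<in> C" "b \<in> C" "a \<le> b" for a b
  proof (rule ccontr)
    assume "a \<noteq> b"
    obtain N where N: "\<And>n. n \<ge> N \<Longrightarrow> l n \<le> a"
      using l_lim unfolding filterlim_at_bot eventually_sequentially by blast
    let ?F = "l ` {..<N}"
    have "range l \<subseteq> ?F \<union> {..a}" using N by (force simp: not_less[symmetric])
    then have "closure (range l) \<subseteq> ?F \<union> {..a}"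
      by (intro closure_minimal closed_Un closed_atMost) (auto intro: finite_imp_closed)
    moreover have "{a..b} \<subseteq> C"
      using C(2) that by (meson connected_contains_Icc)
    moreover have "{a<..b} \<subseteq> {a..b}" by auto
    ultimately have "{a<..b} \<subseteq> ?F \<union> {..a}" using C(1) by blast
    moreover have "{a<..b} \<inter> {..a} = {}" by auto
    ultimately have "{a<..b} \<subseteq> ?F" by blast
    then have "finite {a<..b}" by (rule finite_subset) simp
    then show False using \<open>a \<le> b\<close> \<open>a \<noteq> b\<close> infinite_Ioc[of a b] by simp
  qed
  then have "\<And>a b. a \<in> C \<Longrightarrow> b \<in> C \<Longrightarrow> a = b" by (metis linear)
  then show "\<exists>a. C \<subseteq> {a}" by blast
qed

theorem riesz_spectral: "riesz_spectral_on V ip G"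
  unfolding riesz_spectral_on_def
proof (intro conjI exI allI)
  show "range l = eigenvalues G" by (simp add: eigenvalues_eq)
  show "f n \<in> eigenspace G (l n)" for n by (simp add: eigenspace_eq span_base)
qed (rule hilbert_space_V closed_G inj_l simple riesz_basis_f totally_disconnected_spectrum)+

section \<open>The semigroup, its generator and its compactness\<close>

definition T :: "real \<Rightarrow> 'b \<Rightarrow> 'b" where
  "T t x = W (multiplier (\<lambda>n. exp (l n * t)) (U x))"

lemma exp_bound: "t \<ge> 0 \<Longrightarrow> \<bar>exp (l n * t)\<bar> \<le> exp (- \<omega> * t)"
  using mult_right_mono[OF l_le[of n]] by simp

lemma T_in [simp]: "T t x \<in> V"
  by (simp add: T_def)

lemma inner_T: "t \<ge> 0 \<Longrightarrow> inner (U (T t x)) (e n) = exp (l n * t) * inner (U x) (e n)"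
  unfolding T_def U_W by (rule inner_multiplier[OF exp_bound])

lemma norm_T_le: "t \<ge> 0 \<Longrightarrow> x \<in> V \<Longrightarrow> ip_norm ip (T t x) \<le> exp (- \<omega> * t) * ip_norm ip x"
  using norm_multiplier_le[OF exp_bound, where x = "U x"] by (simp add: ip_norm_eq T_def)

lemma bounded_T: "t \<ge> 0 \<Longrightarrow> bounded_operator_on V ip (T t)"
  unfolding bounded_operator_on_def
proof (intro conjI ballI allI exI)
  assume t: "t \<ge> 0"
  show "T t ` V \<subseteq> V" by auto
  show "T t (x + y) = T t x + T t y" if "x \<in> V" "y \<in> V" for x y
    using that t by (intro V_eqI) (simp_all add: add_in inner_T U_add inner_add_left distrib_left)
  show "T t (c *\<^sub>R x) = c *\<^sub>R T t x" if "x \<in> V" for c x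
    using that t by (intro V_eqI) (simp_all add: scale_in inner_T U_scale)
  show "ip_norm ip (T t x) \<le> exp (- \<omega> * t) * ip_norm ip x" if "x \<in> V" for x
    using that t by (rule norm_T_le[rotated])
qed

lemma multiplier_one: "multiplier (\<lambda>_. 1) x = x"
  by (rule coord_eqI) (simp add: inner_multiplier[of _ 1])

theorem c0_semigroup: "c0_semigroup_on V ip T"
  unfolding c0_semigroup_on_def
proof (intro conjI allI impI ballI)
  show "T 0 x = x" if "x \<in> V" for x
    using that by (intro V_eqI) (simp_all add: inner_T)
  show "T (s + t) x = T s (T t x)" if "s \<ge> 0" "t \<ge> 0" for s t x
    using that by (intro V_eqI) (simp_all add: inner_T distrib_left exp_add)
  show "limitin (ip_topology V ip) (\<lambda>t. T t x) x (at_right 0)" if "x \<in> V" for x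
  proof -
    have "((\<lambda>t. multiplier (\<lambda>n. exp (l n * t)) (U x)) \<longlongrightarrow> multiplier (\<lambda>_. 1) (U x)) (at_right 0)"
    proof (rule multiplier_tendsto)
      show "((\<lambda>t. exp (l n * t)) \<longlongrightarrow> 1) (at_right 0)" for n
        by (rule tendsto_eq_intros refl | simp)+
      have "\<bar>exp (l n * t)\<bar> \<le> 1" if "t > 0" for n t
        using exp_bound[of t n] that \<omega>_pos by (smt (verit) exp_le_one_iff mult_nonneg_nonneg mult_minus_left)
      then show "\<forall>\<^sub>F t in at_right 0. \<forall>n. \<bar>exp (l n * t)\<bar> \<le> 1"
        by (intro eventually_mono[OF eventually_at_right_less[of 0]]) blast
    qed simp
    then show ?thesis using that by (simp add: limitin_iff T_def multiplier_one)
  qed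
qed (simp_all add: hilbert_space_V bounded_T)

text \<open>Convergence of the quotients gives the relation one coordinate at a time. The converse
  requires domination uniformly in \<open>n\<close>, achieved by letting a multiplier act on
  \<open>U y\<close> instead of \<open>U x\<close>.\<close>

theorem generator: "generator_on V ip T = G"
proof -
  have quot: "inner (U ((1 / h) *\<^sub>R (T h x - x))) (e n) = (exp (l n * h) - 1) / h * inner (U x) (e n)"
    if "h > 0" "x \<in> V" for h x n
  proof -
    have "inner (U (T h x - x)) (e n) = (exp (l n * h) - 1) * inner (U x) (e n)"
      using that by (simp add: U_diff inner_diff_left inner_T left_diff_distrib)
    then show ?thesis using that by (simp add: U_scale diff_in del: scaleR_diff_right)
  qed
  have deriv: "((\<lambda>h. (exp (c * h) - 1) / h) \<longlongrightarrow> c) (at_right 0)" for c :: real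
  proof -
    have "((\<lambda>h. exp (c * h)) has_real_derivative c) (at 0)"
      by (auto intro!: derivative_eq_intros)
    then have "((\<lambda>h. (exp (c * h) - 1) / h) \<longlongrightarrow> c) (at 0)"
      unfolding DERIV_def by simp
    then show ?thesis by (rule filterlim_mono) (simp_all add: at_within_le_at)
  qed
  have "(x, y) \<in> G" if x: "x \<in> V" and y: "y \<in> V"
    and lim: "limitin (ip_topology V ip) (\<lambda>h. (1 / h) *\<^sub>R (T h x - x)) y (at_right 0)" for x y
  proof -
    have "inner (U y) (e n) = l n * inner (U x) (e n)" for n
    proof (rule tendsto_unique[OF trivial_limit_at_right_real])
      show "((\<lambda>h. inner (U ((1 / h) *\<^sub>R (T h x - x))) (e n)) \<longlongrightarrow> inner (U y) (e n)) (at_right 0)"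
        using lim by (intro tendsto_intros) (simp add: limitin_iff)
      have "((\<lambda>h. (exp (l n * h) - 1) / h * inner (U x) (e n)) \<longlongrightarrow> l n * inner (U x) (e n)) (at_right 0)"
        by (intro tendsto_intros deriv)
      then show "((\<lambda>h. inner (U ((1 / h) *\<^sub>R (T h x - x))) (e n)) \<longlongrightarrow> l n * inner (U x) (e n)) (at_right 0)"
        by (rule Lim_transform_eventually)
          (use eventually_at_right_less[of 0] in \<open>auto elim!: eventually_mono simp: quot x\<close>)
    qed
    then show ?thesis using x y by (simp add: G_iff)
  qed
  moreover have "limitin (ip_topology V ip) (\<lambda>h. (1 / h) *\<^sub>R (T h x - x)) y (at_right 0)"
    if "(x, y) \<in> G" for x y
  proof -
    have x: "x \<in> V" and y: "y \<in> V" and xy: "\<And>n. inner (U y) (e n) = l n * inner (U x) (e n)"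
      using that by (auto simp: G_iff)
    have l_neg: "l n < 0" for n using l_le[of n] \<omega>_pos by linarith
    \<comment> \<open>Dividing by \<open>l n\<close> moves the unbounded factor into
      \<open>y\<close>: for \<open>s < 0\<close> the value \<open>exp s - 1\<close> lies between
      \<open>s\<close> and \<open>0\<close>, so the quotient lies in \<open>{0..1}\<close>.\<close>
    define m where "m h n = (exp (l n * h) - 1) / (l n * h)" for h n
    have m_bound: "\<bar>m h n\<bar> \<le> 1" if "h > 0" for h n
    proof -
      have neg: "l n * h < 0" using l_neg[of n] that by (simp add: mult_neg_pos)
      have "exp (l n * h) - 1 \<ge> l n * h" using exp_ge_add_one_self[of "l n * h"] by linarith
      moreover have "exp (l n * h) - 1 \<le> 0" using neg by simp
      ultimately show ?thesis using neg by (simp add: m_def abs_le_iff field_simps)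
    qed
    have lim: "((\<lambda>h. multiplier (m h) (U y)) \<longlongrightarrow> multiplier (\<lambda>_. 1) (U y)) (at_right 0)"
    proof (rule multiplier_tendsto)
      fix n
      have "((\<lambda>h. (exp (l n * h) - 1) / h / l n) \<longlongrightarrow> l n / l n) (at_right 0)"
        by (intro tendsto_intros deriv) (use l_neg[of n] in simp)
      then show "((\<lambda>h. m h n) \<longlongrightarrow> 1) (at_right 0)"
        using l_neg[of n] by (simp add: m_def mult.commute)
      show "\<forall>\<^sub>F h in at_right 0. \<forall>n. \<bar>m h n\<bar> \<le> 1"
        using eventually_at_right_less[of 0] by (auto elim!: eventually_mono intro: m_bound)
    qed simp
    have eq: "multiplier (m h) (U y) = U ((1 / h) *\<^sub>R (T h x - x))" if "h > 0" for h
    proof (rule coord_eqI)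
      fix n
      show "inner (multiplier (m h) (U y)) (e n) = inner (U ((1 / h) *\<^sub>R (T h x - x))) (e n)"
        unfolding inner_multiplier[OF m_bound[OF that]] quot[OF that x] xy
        using l_neg[of n] that by (simp add: m_def)
    qed
    have "((\<lambda>h. U ((1 / h) *\<^sub>R (T h x - x))) \<longlongrightarrow> U y) (at_right 0)"
      by (rule Lim_transform_eventually[OF lim[unfolded multiplier_one]])
        (rule eventually_mono[OF eventually_at_right_less[of 0] eq])
    then show ?thesis
      using x y by (simp add: limitin_iff scale_in diff_in)
  qed
  moreover have "G \<subseteq> V \<times> V" by (auto simp: G_iff)
  ultimately show ?thesis
    unfolding generator_on_def by blast
qed

theorem exponentially_stable: "exponentially_stable_on V ip T"
  unfolding exponentially_stable_on_def
  using norm_T_le \<omega>_pos by (intro exI[of _ 1] conjI exI[of _ \<omega>]) auto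

text \<open>For \<open>t > 0\<close> the factors \<open>exp (l n * t)\<close> tend to zero, because
  \<open>l\<close> tends to minus infinity.\<close>

theorem compact_semigroup: "compact_semigroup_on V ip T"
  unfolding compact_semigroup_on_def
proof (intro allI impI)
  fix t :: real assume t: "t > 0"
  let ?m = "\<lambda>n. exp (l n * t)"
  have "filterlim (\<lambda>n. l n * t) at_bot sequentially"
    using filterlim_tendsto_pos_mult_at_bot[OF tendsto_const t l_lim] by (simp add: mult.commute)
  then have "?m \<longlonglongrightarrow> 0"
    by (rule filterlim_compose[OF exp_at_bot])
  then have comp: "compact (closure (multiplier ?m ` cball 0 1))"
    by (intro compact_closure_multiplier[OF exp_bound]) (use t in simp_all)
  let ?S = "T t ` {x \<in> V. ip_norm ip x \<le> 1}"
  have S: "?S \<subseteq> V" by auto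
  have "U ` ?S = multiplier ?m ` cball 0 1"
  proof safe
    fix y :: 'a assume "y \<in> cball 0 1"
    then have "W y \<in> V \<and> ip_norm ip (W y) \<le> 1" by (simp add: ip_norm_eq)
    moreover have "multiplier ?m y = U (T t (W y))" by (simp add: T_def)
    ultimately show "multiplier ?m y \<in> U ` ?S" by blast
  qed (auto simp: T_def ip_norm_eq)
  then have "U ` (ip_topology V ip closure_of ?S) = closure (multiplier ?m ` cball 0 1)"
    using homeomorphic_map_closure_of[OF homeomorphic_map_U, of ?S] S by simp
  moreover have "ip_topology V ip closure_of ?S \<subseteq> V"
    using closure_of_subset_topspace[of top_V] by simp
  ultimately have "compactin (ip_topology V ip) (ip_topology V ip closure_of ?S)"
    using homeomorphic_map_compactness[OF homeomorphic_map_U, of "ip_topology V ip closure_of ?S"] comp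
    by simp
  then show "compact_operator_on V ip (T t)"
    unfolding compact_operator_on_def using bounded_T t by auto
qed

end

section \<open>Compact positive operators and the Hilbert space L2\<close>

text \<open>The form at \<open>x + t *\<^sub>R y\<close> is a nonnegative polynomial in
  \<open>t\<close>, whose minimum gives the bound. The form may be degenerate, hence the case
  split.\<close>

lemma positive_form_Cauchy_Schwarz:
  fixes R :: "'a::real_inner \<Rightarrow> 'a"
  assumes lin: "linear R" and sym: "\<And>x y. inner (R x) y = inner x (R y)"
    and pos: "\<And>x. inner (R x) x \<ge> 0"
  shows "(inner (R x) y)\<^sup>2 \<le> inner (R x) x * inner (R y) y"
proof -
  let ?a = "inner (R x) x" and ?b = "inner (R x) y" and ?c = "inner (R y) y"
  have q: "0 \<le> ?a + 2 * t * ?b + t\<^sup>2 * ?c" for t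
  proof -
    have "inner (R y) x = ?b" using sym[of y x] by (simp add: inner_commute)
    then have "inner (R (x + t *\<^sub>R y)) (x + t *\<^sub>R y) = ?a + 2 * t * ?b + t\<^sup>2 * ?c"
      by (simp add: linear_add[OF lin] linear_scale[OF lin] inner_add_left inner_add_right
          power2_eq_square algebra_simps)
    then show ?thesis using pos by metis
  qed
  show ?thesis
  proof (cases "?c = 0")
    case True
    have "?b = 0"
    proof (rule ccontr)
      assume "?b \<noteq> 0"
      \<comment> \<open>Without a quadratic term the polynomial is affine; at this \<open>t\<close>
        it takes the value \<open>- 1\<close>.\<close>
      then have "?a + 2 * (- (?a + 1) / (2 * ?b)) * ?b = -1" by (simp add: field_simps)
      then show False using q[of "- (?a + 1) / (2 * ?b)"] True by simp
    qed
    then show ?thesis using True by simp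
  next
    case False
    then have c: "?c > 0" using pos[of y] by linarith
    have "?a + 2 * (- ?b / ?c) * ?b + (- ?b / ?c)\<^sup>2 * ?c = ?a - ?b\<^sup>2 / ?c"
      using c by (simp add: field_simps power2_eq_square)
    then have "?b\<^sup>2 / ?c \<le> ?a" using q[of "- ?b / ?c"] by linarith
    then show ?thesis using c by (simp add: field_simps)
  qed
qed

text \<open>The supremum \<open>M\<close> of the form on the unit ball of \<open>W\<close> is
  attained: along a maximising sequence \<open>R x - M *\<^sub>R x\<close> tends to zero, and
  compactness turns this into convergence of a subsequence. In the application \<open>W\<close> is
  the orthogonal complement of all eigenvectors.\<close>

lemma compact_positive_eigenvector:
  fixes R :: "'a::real_inner \<Rightarrow> 'a"
  assumes lin: "bounded_linear R" and sym: "\<And>x y. inner (R x) y = inner x (R y)"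
    and pos: "\<And>x. inner (R x) x \<ge> 0"
    and comp: "\<And>X :: nat \<Rightarrow> 'a. (\<And>n. norm (X n) \<le> 1)
      \<Longrightarrow> \<exists>r l. strict_mono (r :: nat \<Rightarrow> nat) \<and> (\<lambda>n. R (X (r n))) \<longlonglongrightarrow> l"
    and W: "subspace W" "closed W" "R ` W \<subseteq> W"
    and x0: "x0 \<in> W" "R x0 \<noteq> 0"
  obtains x c where "x \<in> W" "x \<noteq> 0" "c > 0" "R x = c *\<^sub>R x"
proof -
  interpret R: bounded_linear R by fact
  note CS = positive_form_Cauchy_Schwarz[OF R.linear sym pos]
  obtain B where B: "B > 0" "\<And>x. norm (R x) \<le> norm x * B" using R.pos_bounded by blast
  let ?Q = "(\<lambda>x. inner (R x) x) ` (W \<inter> cball 0 1)"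
  define M where "M = Sup ?Q"
  have Q_le: "inner (R x) x \<le> B" if "norm x \<le> 1" for x
  proof -
    have "inner (R x) x \<le> norm (R x) * norm x" by (rule norm_cauchy_schwarz)
    also have "\<dots> \<le> norm x * B * norm x" by (intro mult_right_mono B) auto
    also have "\<dots> \<le> 1 * B * 1" using that B(1) by (intro mult_mono) auto
    finally show ?thesis by simp
  qed
  have bdd: "bdd_above ?Q" by (rule bdd_aboveI[of _ B]) (use Q_le in auto)
  have M_upper: "inner (R x) x \<le> M" if "x \<in> W" "norm x \<le> 1" for x
    unfolding M_def using bdd that by (intro cSup_upper) auto
  have M_form: "inner (R x) x \<le> M * (norm x)\<^sup>2" if x: "x \<in> W" for x
  proof (cases "x = 0")
    case False
    have "inner (R (x /\<^sub>R norm x)) (x /\<^sub>R norm x) \<le> M"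
      using False x by (intro M_upper) (auto simp: subspace_scale[OF W(1)])
    then show ?thesis using False by (simp add: R.scaleR field_simps power2_eq_square)
  qed (simp add: R.zero)
  have M_pos: "M > 0"
  proof -
    have "0 < (inner (R x0) (R x0))\<^sup>2" using x0 by simp
    also have "\<dots> \<le> inner (R x0) x0 * inner (R (R x0)) (R x0)" by (rule CS)
    finally have "inner (R x0) x0 \<noteq> 0" by auto
    then have "0 < inner (R x0) x0" using pos[of x0] by linarith
    also have "\<dots> \<le> M * (norm x0)\<^sup>2" by (rule M_form[OF x0(1)])
    finally show ?thesis by (simp add: zero_less_mult_iff)
  qed
  \<comment> \<open>Cauchy-Schwarz for the form with \<open>y = R x\<close>, followed by
    \<open>M_form\<close> at \<open>R x\<close>, which is where invariance of \<open>W\<close>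
    enters; one factor \<open>(norm (R x))\<^sup>2\<close> cancels.\<close>
  have norm_R: "(norm (R x))\<^sup>2 \<le> M * inner (R x) x" if x: "x \<in> W" for x
  proof (cases "R x = 0")
    case False
    have "(norm (R x))\<^sup>2 * (norm (R x))\<^sup>2 = (inner (R x) (R x))\<^sup>2"
      unfolding power2_norm_eq_inner by (rule power2_eq_square[symmetric])
    also have "\<dots> \<le> inner (R x) x * inner (R (R x)) (R x)" by (rule CS)
    also have "\<dots> \<le> inner (R x) x * (M * (norm (R x))\<^sup>2)"
      using W(3) x by (intro mult_left_mono M_form pos) auto
    finally have "(norm (R x))\<^sup>2 * (norm (R x))\<^sup>2 \<le> (M * inner (R x) x) * (norm (R x))\<^sup>2"
      by (simp only: mult_ac)
    then show ?thesis by (rule mult_right_le_imp_le) (use False in simp)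
  qed (simp add: R.zero)
  have "\<exists>x\<in>W. norm x \<le> 1 \<and> inner (R x) x > M - 1 / real (Suc n)" for n
  proof -
    have ne: "?Q \<noteq> {}" using subspace_0[OF W(1)] by auto
    have "M - 1 / real (Suc n) < Sup ?Q" unfolding M_def by simp
    then show ?thesis using less_cSup_iff[OF ne bdd] by auto
  qed
  then obtain X where X: "\<And>n. X n \<in> W" "\<And>n. norm (X n) \<le> 1"
      "\<And>n. inner (R (X n)) (X n) > M - 1 / real (Suc n)" by metis
  obtain r l where r: "strict_mono r" and l: "(\<lambda>n. R (X (r n))) \<longlonglongrightarrow> l"
    using comp[of X] X by blast
  \<comment> \<open>Expanding the square and inserting \<open>norm_R\<close> leaves
    \<open>M * (M - inner (R (X n)) (X n))\<close>: near-maximisers are near-eigenvectors.\<close>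
  have defect: "(norm (R (X n) - M *\<^sub>R X n))\<^sup>2 \<le> M / real (Suc n)" for n
  proof -
    have "(norm (R (X n) - M *\<^sub>R X n))\<^sup>2
        = (norm (R (X n)))\<^sup>2 - 2 * M * inner (R (X n)) (X n) + M\<^sup>2 * (norm (X n))\<^sup>2"
      by (simp only: power2_norm_eq_inner)
        (simp add: inner_diff inner_commute power2_eq_square algebra_simps)
    also have "\<dots> \<le> M * inner (R (X n)) (X n) - 2 * M * inner (R (X n)) (X n) + M\<^sup>2 * 1"
      using norm_R[OF X(1)[of n]] X(2)[of n]
      using M_pos by (intro add_mono diff_mono mult_left_mono) (auto simp: power_le_one)
    also have "\<dots> = M * (M - inner (R (X n)) (X n))" by (simp add: power2_eq_square algebra_simps)
    also have "\<dots> \<le> M * (1 / real (Suc n))"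
      using X(3)[of n] M_pos by (intro mult_left_mono) auto
    finally show ?thesis by simp
  qed
  have "(\<lambda>n. (norm (R (X n) - M *\<^sub>R X n))\<^sup>2) \<longlonglongrightarrow> 0"
  proof (rule tendsto_sandwich[OF _ _ tendsto_const])
    show "(\<lambda>n. M / real (Suc n)) \<longlonglongrightarrow> 0" by real_asymp
  qed (use defect in auto)
  then have "(\<lambda>n. norm (R (X n) - M *\<^sub>R X n)) \<longlonglongrightarrow> 0"
    using tendsto_real_sqrt by fastforce
  then have "(\<lambda>n. R (X n) - M *\<^sub>R X n) \<longlonglongrightarrow> 0" using tendsto_norm_zero_iff by blast
  \<comment> \<open>\<open>M *\<^sub>R X (r n)\<close> is a convergent sequence minus a null
    sequence; dividing by \<open>M\<close> makes \<open>X (r n)\<close> itself converge.\<close>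
  from LIMSEQ_subseq_LIMSEQ[OF this r]
  have "(\<lambda>n. (1 / M) *\<^sub>R (R (X (r n)) - (R (X (r n)) - M *\<^sub>R X (r n)))) \<longlonglongrightarrow> (1 / M) *\<^sub>R (l - 0)"
    unfolding o_def by (intro tendsto_intros l)
  then have lim: "(\<lambda>n. X (r n)) \<longlonglongrightarrow> (1 / M) *\<^sub>R l" using M_pos by simp
  define x where "x = (1 / M) *\<^sub>R l"
  have limx: "(\<lambda>n. X (r n)) \<longlonglongrightarrow> x" using lim by (simp add: x_def)
  have limR: "(\<lambda>n. R (X (r n))) \<longlonglongrightarrow> R x" by (rule R.tendsto[OF limx])
  have "R x = M *\<^sub>R x" using LIMSEQ_unique[OF limR l] M_pos by (simp add: x_def)
  moreover have "x \<in> W" using closed_sequentially[OF W(2) _ limx] X by blast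
  \<comment> \<open>The vectors \<open>X n\<close> are not normalised; nonvanishing comes from the
    form, whose value at the limit is at least \<open>M > 0\<close>.\<close>
  moreover have "x \<noteq> 0"
  proof
    assume "x = 0"
    have "(\<lambda>n. inner (R (X (r n))) (X (r n))) \<longlonglongrightarrow> inner (R x) x"
      by (intro tendsto_intros limx limR)
    moreover have "(\<lambda>n. M - 1 / real (Suc (r n))) \<longlonglongrightarrow> M"
    proof -
      have "(\<lambda>n. M - 1 / real (Suc n)) \<longlonglongrightarrow> M" by real_asymp
      from LIMSEQ_subseq_LIMSEQ[OF this r] show ?thesis by (simp add: o_def)
    qed
    ultimately have "M \<le> inner (R x) x"
      using X(3) by (intro LIMSEQ_le[of _ M]) (auto intro: less_imp_le)
    then show False using M_pos \<open>x = 0\<close> by simp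
  qed
  ultimately show ?thesis using that M_pos by blast
qed

section \<open>The real Hilbert space of square integrable functions on the unit interval\<close>

abbreviation leb01 :: "real measure" where
  "leb01 \<equiv> lebesgue_on {0..1}"

interpretation leb01: finite_measure leb01
  by (rule finite_measure_lebesgue_on) simp

lemma measure_leb01 [simp]: "measure leb01 {0..1} = 1"
  by (simp add: measure_restrict_space)

lemma sq_integrable_measurable: "sq_integrable f \<Longrightarrow> f \<in> borel_measurable leb01"
  by (simp add: sq_integrable_def)

lemma sq_integrable_mult:
  assumes "sq_integrable f" "sq_integrable g"
  shows "integrable leb01 (\<lambda>x. f x * g x)"
proof (rule Bochner_Integration.integrable_bound)
  show "integrable leb01 (\<lambda>x. (f x)\<^sup>2 + (g x)\<^sup>2)"
    using assms by (auto simp: sq_integrable_def)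
  have "\<bar>a * b\<bar> \<le> a\<^sup>2 + b\<^sup>2" for a b :: real
  proof -
    have "0 \<le> \<bar>a\<bar> * \<bar>b\<bar>" by simp
    then show ?thesis
      using sum_squares_bound[of "\<bar>a\<bar>" "\<bar>b\<bar>"] unfolding abs_mult power2_abs by linarith
  qed
  then show "AE x in leb01. norm (f x * g x) \<le> norm ((f x)\<^sup>2 + (g x)\<^sup>2)"
    by simp
  show "(\<lambda>x. f x * g x) \<in> borel_measurable leb01"
    using assms by (auto simp: sq_integrable_def)
qed

lemma sq_integrable_bounded:
  assumes "f \<in> borel_measurable leb01" "\<And>x. x \<in> {0..1} \<Longrightarrow> \<bar>f x\<bar> \<le> B"
  shows "sq_integrable f"
proof -
  have "integrable leb01 (\<lambda>x. (f x)\<^sup>2)"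
  proof (rule leb01.integrable_const_bound[where B = "B\<^sup>2"])
    show "AE x in leb01. norm ((f x)\<^sup>2) \<le> B\<^sup>2"
      using assms(2) abs_le_square_iff by (intro AE_I2) force
  qed (use assms in measurable)
  then show ?thesis using assms by (simp add: sq_integrable_def)
qed

lemma sq_integrable_bounded_mult:
  assumes "sq_integrable f" "g \<in> borel_measurable leb01" "\<And>x. x \<in> {0..1} \<Longrightarrow> \<bar>g x\<bar> \<le> B"
  shows "sq_integrable (\<lambda>x. g x * f x)"
proof -
  have m: "(\<lambda>x. g x * f x) \<in> borel_measurable leb01"
    using assms by (auto simp: sq_integrable_def)
  have "integrable leb01 (\<lambda>x. (g x * f x)\<^sup>2)"
  proof (rule Bochner_Integration.integrable_bound)
    show "integrable leb01 (\<lambda>x. B\<^sup>2 * (f x)\<^sup>2)"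
      using assms by (auto simp: sq_integrable_def)
    have "(g x * f x)\<^sup>2 \<le> B\<^sup>2 * (f x)\<^sup>2" if "x \<in> {0..1}" for x
      using assms(3)[OF that] abs_le_square_iff[of "g x" B]
      by (auto simp: power_mult_distrib intro!: mult_right_mono)
    then show "AE x in leb01. norm ((g x * f x)\<^sup>2) \<le> norm (B\<^sup>2 * (f x)\<^sup>2)"
      by (intro AE_I2) simp
  qed (use m in measurable)
  then show ?thesis using m by (simp add: sq_integrable_def)
qed

lemma sq_integrable_const: "sq_integrable (\<lambda>x. c)"
  by (rule sq_integrable_bounded[where B = "\<bar>c\<bar>"]) auto

lemma sq_integrable_integrable: "sq_integrable f \<Longrightarrow> integrable leb01 f"
  using sq_integrable_mult[OF _ sq_integrable_const[of 1]] by simp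

lemma L2_rel_refl: "sq_integrable f \<Longrightarrow> L2_rel f f"
  by (simp add: L2_rel_def)

lemma l2_cases: obtains f where "sq_integrable f" "u = abs_l2 f"
  using Quotient3_abs_rep[OF Quotient3_l2, of u] Quotient3_rep_reflp[OF Quotient3_l2, of u]
  unfolding L2_rel_def by metis

lemma abs_l2_eq_iff:
  "sq_integrable f \<Longrightarrow> sq_integrable g \<Longrightarrow> abs_l2 f = abs_l2 g \<longleftrightarrow> (AE x in leb01. f x = g x)"
  using Quotient3_rel[OF Quotient3_l2, of f g] L2_rel_refl by (auto simp: L2_rel_def)

lemma abs_l2_add: "sq_integrable f \<Longrightarrow> sq_integrable g \<Longrightarrow> abs_l2 f + abs_l2 g = abs_l2 (\<lambda>x. f x + g x)"
  and abs_l2_diff: "sq_integrable f \<Longrightarrow> sq_integrable g \<Longrightarrow> abs_l2 f - abs_l2 g = abs_l2 (\<lambda>x. f x - g x)"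
  and abs_l2_scale: "sq_integrable f \<Longrightarrow> c *\<^sub>R abs_l2 f = abs_l2 (\<lambda>x. c * f x)"
  by (simp_all add: plus_l2.abs_eq minus_l2.abs_eq scaleR_l2.abs_eq L2_rel_refl)

instantiation l2 :: real_inner
begin

lift_definition inner_l2 :: "l2 \<Rightarrow> l2 \<Rightarrow> real" is "\<lambda>f g. \<integral>z. f z * g z \<partial>leb01"
proof -
  fix f f' g g' :: "real \<Rightarrow> real"
  assume "L2_rel f f'" "L2_rel g g'"
  then have [measurable]: "f \<in> borel_measurable leb01" "f' \<in> borel_measurable leb01"
      "g \<in> borel_measurable leb01" "g' \<in> borel_measurable leb01"
    and ae: "AE x in leb01. f x = f' x" "AE x in leb01. g x = g' x"
    by (auto simp: L2_rel_def sq_integrable_def)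
  show "(\<integral>z. f z * g z \<partial>leb01) = (\<integral>z. f' z * g' z \<partial>leb01)"
  proof (rule integral_cong_AE)
    show "AE z in leb01. f z * g z = f' z * g' z" using ae by eventually_elim simp
  qed measurable
qed

definition norm_l2 :: "l2 \<Rightarrow> real" where "norm_l2 u = sqrt (inner u u)"

definition dist_l2 :: "l2 \<Rightarrow> l2 \<Rightarrow> real" where "dist_l2 u v = norm (u - v)"

definition sgn_l2 :: "l2 \<Rightarrow> l2" where "sgn_l2 u = u /\<^sub>R norm u"

definition uniformity_l2 :: "(l2 \<times> l2) filter" where
  "uniformity_l2 = (INF e\<in>{0<..}. principal {(x, y). dist x y < e})"

definition open_l2 :: "l2 set \<Rightarrow> bool" where
  "open_l2 S \<longleftrightarrow> (\<forall>x\<in>S. eventually (\<lambda>(x', y). x' = x \<longrightarrow> y \<in> S) uniformity)"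

instance
proof
  fix x y z :: l2 and c :: real
  show "inner x y = inner y x" by transfer (simp add: mult.commute)
  show "inner (x + y) z = inner x z + inner y z"
    by transfer (simp add: L2_rel_def distrib_right sq_integrable_mult)
  show "inner (c *\<^sub>R x) y = c * inner x y"
    by transfer (simp add: mult.assoc)
  show "inner x x \<ge> 0" by transfer simp
  show "inner x x = 0 \<longleftrightarrow> x = 0"
  proof transfer
    fix f assume "L2_rel f f"
    then have f: "sq_integrable f" by (simp add: L2_rel_def)
    then have "integrable leb01 (\<lambda>z. f z * f z)" by (simp add: sq_integrable_mult)
    then have "(\<integral>z. f z * f z \<partial>leb01) = 0 \<longleftrightarrow> (AE z in leb01. f z * f z = 0)"
      by (rule integral_nonneg_eq_0_iff_AE) simp
    then show "((\<integral>z. f z * f z \<partial>leb01) = 0) = L2_rel f (\<lambda>x. 0)"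
      using f by (simp add: L2_rel_def sq_integrable_zero)
  qed
qed (rule dist_l2_def sgn_l2_def uniformity_l2_def open_l2_def norm_l2_def)+

end

lemma inner_abs_l2:
  "sq_integrable f \<Longrightarrow> sq_integrable g \<Longrightarrow> inner (abs_l2 f) (abs_l2 g) = (\<integral>z. f z * g z \<partial>leb01)"
  by (simp add: inner_l2.abs_eq L2_rel_refl)

lemma norm_abs_l2:
  "sq_integrable f \<Longrightarrow> (norm (abs_l2 f))\<^sup>2 = (\<integral>z. (f z)\<^sup>2 \<partial>leb01)"
  unfolding power2_norm_eq_inner by (simp add: inner_abs_l2 power2_eq_square)

lemma norm_const_l2: "norm (abs_l2 (\<lambda>x. c)) = \<bar>c\<bar>"
proof -
  have "(norm (abs_l2 (\<lambda>x. c)))\<^sup>2 = \<bar>c\<bar>\<^sup>2"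
    by (simp add: norm_abs_l2 sq_integrable_const)
  then show ?thesis by (simp only: power2_eq_iff_nonneg norm_ge_zero abs_ge_zero)
qed

lemma L1_le_L2:
  assumes "sq_integrable f"
  shows "(\<integral>z. \<bar>f z\<bar> \<partial>leb01) \<le> norm (abs_l2 f)"
proof -
  have abs: "sq_integrable (\<lambda>x. \<bar>f x\<bar>)" using assms borel_measurable_abs by (auto simp: sq_integrable_def)
  have "(\<integral>z. \<bar>f z\<bar> \<partial>leb01) = inner (abs_l2 (\<lambda>x. \<bar>f x\<bar>)) (abs_l2 (\<lambda>x. 1))"
    by (simp add: inner_abs_l2 abs sq_integrable_const)
  also have "\<dots> \<le> norm (abs_l2 (\<lambda>x. \<bar>f x\<bar>)) * norm (abs_l2 (\<lambda>x. 1))"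
    by (rule norm_cauchy_schwarz)
  also have "norm (abs_l2 (\<lambda>x. \<bar>f x\<bar>)) = norm (abs_l2 f)"
    by (simp add: norm_eq_sqrt_inner inner_abs_l2 abs assms)
  finally show ?thesis by (simp add: norm_const_l2)
qed

text \<open>Riesz-Fischer by the classical route: a subsequence with geometrically decreasing
  increments converges almost everywhere, and Fatou's lemma upgrades this to convergence in
  norm.\<close>

instance l2 :: banach
proof
  fix X :: "nat \<Rightarrow> l2" assume X: "Cauchy X"
  have "\<forall>n. \<exists>f. sq_integrable f \<and> X n = abs_l2 f" by (meson l2_cases)
  then obtain f where f: "\<And>n. sq_integrable (f n)" and Xf: "\<And>n. X n = abs_l2 (f n)" by metis
  have [measurable]: "f n \<in> borel_measurable leb01" for n by (rule sq_integrable_measurable[OF f])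
  have "\<exists>N. \<forall>m\<ge>N. \<forall>n\<ge>N. norm (X m - X n) < (1/2) ^ k" for k :: nat
    using CauchyD[OF X, of "(1/2) ^ k"] by simp
  then obtain N where N: "\<And>k m n. m \<ge> N k \<Longrightarrow> n \<ge> N k \<Longrightarrow> norm (X m - X n) < (1/2) ^ k"
    by metis
  \<comment> \<open>Summing the \<open>N i\<close> makes \<open>r\<close> monotone and at least
    \<open>N k\<close>; the added \<open>k\<close> makes it at least \<open>k\<close>, hence
    unbounded.\<close>
  define r where "r k = k + (\<Sum>i\<le>k. N i)" for k
  have r: "r k \<ge> N k" "r k \<ge> k" "r (Suc k) \<ge> r k" for k
    by (auto simp: r_def member_le_sum intro: trans_le_add2 member_le_sum)
  define g where "g k x = f (r (Suc k)) x - f (r k) x" for k x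
  have g: "sq_integrable (g k)" for k unfolding g_def by (intro sq_integrable_diff f)
  have [measurable]: "g n \<in> borel_measurable leb01" for n by (rule sq_integrable_measurable[OF g])
  have g_int: "(\<integral>z. \<bar>g k z\<bar> \<partial>leb01) \<le> (1/2) ^ k" for k
  proof -
    have "(\<integral>z. \<bar>g k z\<bar> \<partial>leb01) \<le> norm (abs_l2 (g k))" by (rule L1_le_L2[OF g])
    also have "abs_l2 (g k) = X (r (Suc k)) - X (r k)"
      by (simp add: Xf abs_l2_diff f g_def[abs_def])
    also have "norm \<dots> \<le> (1/2) ^ k"
      using N[of k "r (Suc k)" "r k"] r(1)[of k] r(3)[of k] by linarith
    finally show ?thesis .
  qed
  \<comment> \<open>The integrals of \<open>\<bar>g k x\<bar>\<close> have a finite sum, so the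
    integral of their series is finite and the series converges almost everywhere.\<close>
  have ae_summable: "AE x in leb01. summable (\<lambda>k. \<bar>g k x\<bar>)"
  proof -
    have "(\<integral>\<^sup>+x. (\<Sum>k. ennreal \<bar>g k x\<bar>) \<partial>leb01) = (\<Sum>k. \<integral>\<^sup>+x. ennreal \<bar>g k x\<bar> \<partial>leb01)"
      by (rule nn_integral_suminf) measurable
    also have "\<dots> = (\<Sum>k. ennreal (\<integral>x. \<bar>g k x\<bar> \<partial>leb01))"
      by (intro suminf_cong nn_integral_eq_integral integrable_abs sq_integrable_integrable g) simp
    also have "\<dots> \<le> (\<Sum>k. ennreal ((1/2) ^ k))"
      by (intro suminf_le ennreal_leI g_int) auto
    also have "\<dots> = ennreal (\<Sum>k. (1/2) ^ k)"
      by (rule suminf_ennreal2) (auto intro: summable_geometric)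
    also have "\<dots> < \<infinity>" by simp
    finally have "AE x in leb01. (\<Sum>k. ennreal \<bar>g k x\<bar>) \<noteq> \<infinity>"
      by (intro nn_integral_PInf_AE) auto
    then show ?thesis
      by eventually_elim (rule summable_suminf_not_top, auto)
  qed
  define F where "F x = lim (\<lambda>k. f (r k) x)" for x
  have [measurable]: "F \<in> borel_measurable leb01" unfolding F_def[abs_def] by measurable
  have F_lim: "AE x in leb01. (\<lambda>k. f (r k) x) \<longlonglongrightarrow> F x"
    using ae_summable
  proof eventually_elim
    case (elim x)
    then have "summable (\<lambda>k. g k x)" by (rule summable_rabs_cancel)
    then have "convergent (\<lambda>n. f (r 0) x + (\<Sum>k<n. g k x))"
      by (intro convergent_add convergent_const) (simp add: summable_iff_convergent)
    moreover have "f (r 0) x + (\<Sum>k<n. g k x) = f (r n) x" for n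
      unfolding g_def by (subst sum_lessThan_telescope) simp
    ultimately show ?case unfolding F_def by (simp add: convergent_LIMSEQ_iff)
  qed
  \<comment> \<open>Fatou's lemma along the subsequence: for fixed \<open>m\<close> the squared
    distance to the limit is at most the liminf of those to later members.\<close>
  have close: "(\<integral>\<^sup>+x. ennreal ((F x - f m x)\<^sup>2) \<partial>leb01) \<le> ennreal (((1/2) ^ j)\<^sup>2)" if m: "m \<ge> N j" for m j
  proof -
    have "(\<integral>\<^sup>+x. ennreal ((F x - f m x)\<^sup>2) \<partial>leb01)
        = (\<integral>\<^sup>+x. liminf (\<lambda>k. ennreal ((f (r k) x - f m x)\<^sup>2)) \<partial>leb01)"
    proof (rule nn_integral_cong_AE)
      show "AE x in leb01. ennreal ((F x - f m x)\<^sup>2) = liminf (\<lambda>k. ennreal ((f (r k) x - f m x)\<^sup>2))"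
        using F_lim
      proof eventually_elim
        case (elim x)
        then have "(\<lambda>k. ennreal ((f (r k) x - f m x)\<^sup>2)) \<longlonglongrightarrow> ennreal ((F x - f m x)\<^sup>2)"
          by (intro tendsto_intros)
        then show ?case by (rule lim_imp_Liminf[OF sequentially_bot, symmetric])
      qed
    qed
    also have "\<dots> \<le> liminf (\<lambda>k. \<integral>\<^sup>+x. ennreal ((f (r k) x - f m x)\<^sup>2) \<partial>leb01)"
      by (rule nn_integral_liminf) measurable
    also have "\<dots> \<le> ennreal (((1/2) ^ j)\<^sup>2)"
    proof (rule order_trans[OF Liminf_le_Limsup Limsup_bounded])
      show "\<forall>\<^sub>F k in sequentially. (\<integral>\<^sup>+x. ennreal ((f (r k) x - f m x)\<^sup>2) \<partial>leb01) \<le> ennreal (((1/2) ^ j)\<^sup>2)"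
        using eventually_ge_at_top[of "N j"]
      proof eventually_elim
        case (elim k)
        have sq: "sq_integrable (\<lambda>x. f (r k) x - f m x)" by (intro sq_integrable_diff f)
        have "(\<integral>\<^sup>+x. ennreal ((f (r k) x - f m x)\<^sup>2) \<partial>leb01) = ennreal (\<integral>x. (f (r k) x - f m x)\<^sup>2 \<partial>leb01)"
          using sq by (intro nn_integral_eq_integral) (auto simp: sq_integrable_def)
        also have "(\<integral>x. (f (r k) x - f m x)\<^sup>2 \<partial>leb01) = (norm (X (r k) - X m))\<^sup>2"
          by (simp add: Xf abs_l2_diff f norm_abs_l2[OF sq])
        also have "\<dots> \<le> ((1/2) ^ j)\<^sup>2"
          using N[of j "r k" m] elim m r(2)[of k] by (intro power_mono) auto
        finally show ?case by (simp add: ennreal_leI)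
      qed
    qed simp
    finally show ?thesis .
  qed
  have sq_close: "sq_integrable (\<lambda>x. F x - f m x)" if "m \<ge> N j" for m j
  proof -
    have "(\<integral>\<^sup>+x. ennreal ((F x - f m x)\<^sup>2) \<partial>leb01) < \<infinity>"
      using close[OF that] by (simp add: le_less_trans)
    then have "integrable leb01 (\<lambda>x. (F x - f m x)\<^sup>2)"
      by (intro integrableI_nonneg) auto
    then show ?thesis by (simp add: sq_integrable_def)
  qed
  have F: "sq_integrable F"
    using sq_integrable_add[OF sq_close[OF order_refl, of 0] f[of "N 0"]] by simp
  have "X \<longlonglongrightarrow> abs_l2 F"
  proof (rule LIMSEQ_I)
    fix \<epsilon> :: real assume "\<epsilon> > 0"
    then obtain j where j: "(1/2) ^ j < \<epsilon>" using real_arch_pow_inv[of \<epsilon> "1/2"] by auto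
    have "norm (X m - abs_l2 F) < \<epsilon>" if m: "m \<ge> N j" for m
    proof -
      have "(norm (abs_l2 F - X m))\<^sup>2 = (\<integral>x. (F x - f m x)\<^sup>2 \<partial>leb01)"
        by (simp add: Xf abs_l2_diff F f norm_abs_l2[OF sq_close[OF m]])
      then have "ennreal ((norm (abs_l2 F - X m))\<^sup>2) = (\<integral>\<^sup>+x. ennreal ((F x - f m x)\<^sup>2) \<partial>leb01)"
        using sq_close[OF m] by (subst nn_integral_eq_integral) (auto simp: sq_integrable_def)
      also have "\<dots> \<le> ennreal (((1/2) ^ j)\<^sup>2)" by (rule close[OF m])
      finally have "(norm (abs_l2 F - X m))\<^sup>2 \<le> ((1/2) ^ j)\<^sup>2"
        by (rule ennreal_le_iff[THEN iffD1, rotated]) (rule zero_le_power2)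
      then have "norm (abs_l2 F - X m) \<le> (1/2) ^ j" by (rule power2_le_imp_le) simp
      then show ?thesis using j by (simp add: norm_minus_commute)
    qed
    then show "\<exists>no. \<forall>n\<ge>no. norm (X n - abs_l2 F) < \<epsilon>" by blast
  qed
  then show "convergent X" by (auto simp: convergent_def)
qed

section \<open>Primitives of square integrable functions\<close>

text \<open>Initial intervals form a generator stable under intersection, so vanishing integrals
  over them spread to all Borel sets; a Lebesgue set differs from a Borel set by a null set
  only.\<close>

lemma set_integral_zero_AE:
  assumes f: "sq_integrable f"
    and zero: "\<And>x. x \<in> {0..1} \<Longrightarrow> (\<integral>z. indicator {0..x} z * f z \<partial>leb01) = 0"
  shows "AE x in leb01. f x = 0"
proof -
  have int: "integrable leb01 f" by (rule sq_integrable_integrable[OF f])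
  have sets: "A \<inter> {0..1} \<in> sets leb01" if "A \<in> sets borel" for A
    using that by (simp add: sets_restrict_space_iff)
  have set_int: "set_integrable leb01 A f" if "A \<in> sets leb01" for A
    unfolding set_integrable_def using int that by (intro integrable_mult_indicator)
  have zero': "set_lebesgue_integral leb01 {0..x} f = 0" if "x \<in> {0..1}" for x
    using zero[OF that] by (simp add: set_lebesgue_integral_def)
  have borel: "set_lebesgue_integral leb01 (A \<inter> {0..1}) f = 0" if A: "A \<in> sets borel" for A
  proof -
    have A_sigma: "A \<in> sigma_sets UNIV (range atMost)"
      using A by (simp add: borel_eq_atMost)
    have stable: "Int_stable (range (atMost :: real \<Rightarrow> _))"
      by (auto simp: Int_stable_def)
    have sigma_borel: "B \<in> sets borel" if "B \<in> sigma_sets UNIV (range (atMost :: real \<Rightarrow> _))" for B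
      using that by (simp add: borel_eq_atMost)
    have "range (atMost :: real \<Rightarrow> _) \<subseteq> Pow UNIV" by simp
    from stable this A_sigma show ?thesis
    proof (induction A rule: sigma_sets_induct_disjoint)
      case (basic B)
      then obtain a where B: "B = {..a}" by auto
      consider "a < 0" | "0 \<le> a" "a \<le> 1" | "a > 1" by linarith
      then show ?case
      proof cases
        case 1
        then have "B \<inter> {0..1} = {}" using B by auto
        then show ?thesis by (simp add: set_lebesgue_integral_def)
      next
        case 2
        then have "B \<inter> {0..1} = {0..a}" using B by auto
        then show ?thesis using zero'[of a] 2 by simp
      next
        case 3
        then have "B \<inter> {0..1} = {0..1}" using B by auto
        then show ?thesis using zero'[of 1] by simp
      qed
    next
      case (compl B)
      have "set_lebesgue_integral leb01 (B \<inter> {0..1} \<union> (UNIV - B) \<inter> {0..1}) f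
          = set_lebesgue_integral leb01 (B \<inter> {0..1}) f + set_lebesgue_integral leb01 ((UNIV - B) \<inter> {0..1}) f"
        using sigma_borel[OF compl(1)] by (intro set_integral_Un set_int sets) auto
      moreover have "B \<inter> {0..1} \<union> (UNIV - B) \<inter> {0..1} = {0..1}" by auto
      ultimately show ?case using compl zero'[of 1] by simp
    next
      case (union B)
      have "set_lebesgue_integral leb01 (\<Union>i. B i \<inter> {0..1}) f
          = (\<Sum>i. set_lebesgue_integral leb01 (B i \<inter> {0..1}) f)"
      proof (rule lebesgue_integral_countable_add)
        show B: "B i \<inter> {0..1} \<in> sets leb01" for i
          using union(2) sigma_borel by (intro sets) auto
        show "B i \<inter> {0..1} \<inter> (B j \<inter> {0..1}) = {}" if "i \<noteq> j" for i j
          using union(1) that by (auto simp: disjoint_family_on_def)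
        show "set_integrable leb01 (\<Union>i. B i \<inter> {0..1}) f"
          by (intro set_int sets.countable_UN) (use B in auto)
      qed
      moreover have "(\<Union>i. B i) \<inter> {0..1} = (\<Union>i. B i \<inter> {0..1})" by blast
      ultimately have "set_lebesgue_integral leb01 ((\<Union>i. B i) \<inter> {0..1}) f = (\<Sum>i::nat. 0)"
        by (simp only: union(3))
      then show ?case by simp
    qed (simp_all add: set_lebesgue_integral_def)
  qed
  show ?thesis
  proof (rule leb01.density_zero[OF int])
    fix A assume A: "A \<in> sets leb01"
    then have A': "A \<in> sets lebesgue" "A \<subseteq> {0..1}"
      by (auto simp: sets_restrict_space_iff)
    obtain S N N' where S: "A = S \<union> N" "N \<subseteq> N'" "N' \<in> null_sets lborel" "S \<in> sets lborel"
      using A'(1) by (rule sets_completionE)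
    have "AE x in lebesgue. x \<notin> N'"
      by (rule AE_completion[OF AE_not_in[OF S(3)]])
    then have "AE x in leb01. x \<notin> N'"
      by (subst AE_restrict_space_iff) auto
    then have ae: "AE x in leb01. indicator A x *\<^sub>R f x = indicator (S \<inter> {0..1}) x *\<^sub>R f x"
    proof eventually_elim
      case (elim x)
      then have "x \<in> A \<longleftrightarrow> x \<in> S \<inter> {0..1}" using S A'(2) by auto
      then show ?case by (simp add: indicator_def)
    qed
    have "set_lebesgue_integral leb01 A f = set_lebesgue_integral leb01 (S \<inter> {0..1}) f"
      unfolding set_lebesgue_integral_def
    proof (rule integral_cong_AE[OF _ _ ae])
      have "f \<in> borel_measurable leb01" by (rule sq_integrable_measurable[OF f])
      then show "(\<lambda>x. indicator A x *\<^sub>R f x) \<in> borel_measurable leb01"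
        "(\<lambda>x. indicator (S \<inter> {0..1}) x *\<^sub>R f x) \<in> borel_measurable leb01"
        using A sets[of S] S(4) by (auto intro!: borel_measurable_scaleR borel_measurable_indicator)
    qed
    then show "set_lebesgue_integral leb01 A f = 0" using borel S(4) by simp
  qed
qed

text \<open>Pairing with this element is integration from \<open>0\<close> to \<open>x\<close>.
  Primitives of L2 classes are thus defined without choosing representatives, and their estimates
  reduce to Cauchy-Schwarz.\<close>

definition l2_ind :: "real \<Rightarrow> l2" where
  "l2_ind x = abs_l2 (indicator {0..x})"

lemma sq_integrable_indicator: "sq_integrable (indicator {a..b})"
proof (rule sq_integrable_bounded[where B = 1])
  have "(indicator {a..b} :: real \<Rightarrow> real) \<in> borel_measurable lebesgue"
    by (intro borel_measurable_indicator) simp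
  then show "(indicator {a..b} :: real \<Rightarrow> real) \<in> borel_measurable leb01"
    by (rule measurable_restrict_space1)
qed (simp add: indicator_def)

lemma inner_ind:
  "sq_integrable f \<Longrightarrow> inner (l2_ind x) (abs_l2 f) = (\<integral>z. indicator {0..x} z * f z \<partial>leb01)"
  unfolding l2_ind_def by (intro inner_abs_l2 sq_integrable_indicator)

lemma l2_eqI:
  assumes "\<And>x. x \<in> {0..1} \<Longrightarrow> inner (l2_ind x) g = inner (l2_ind x) h"
  shows "g = h"
proof -
  obtain f where f: "sq_integrable f" "g - h = abs_l2 f" by (rule l2_cases)
  have "AE x in leb01. f x = 0"
  proof (rule set_integral_zero_AE[OF f(1)])
    fix x :: real assume "x \<in> {0..1}"
    then have "inner (l2_ind x) (abs_l2 f) = 0" using assms by (simp add: inner_diff_right flip: f(2))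
    then show "(\<integral>z. indicator {0..x} z * f z \<partial>leb01) = 0" using f(1) by (simp add: inner_ind)
  qed
  then have "abs_l2 f = abs_l2 (\<lambda>x. 0)"
    using f(1) sq_integrable_zero by (simp add: abs_l2_eq_iff)
  then show ?thesis using f(2) by (simp add: zero_l2_def[symmetric])
qed

lemma has_integral_indicator:
  assumes f: "sq_integrable f" and ab: "0 \<le> a" "b \<le> 1"
  shows "(f has_integral (\<integral>z. indicator {a..b} z * f z \<partial>leb01)) {a..b}"
proof -
  have "((\<lambda>z. indicator {a..b} z * f z) has_integral (\<integral>z. indicator {a..b} z * f z \<partial>leb01)) {0..1}"
    by (intro has_integral_integral_lebesgue_on sq_integrable_mult f sq_integrable_indicator) simp
  then have "((\<lambda>z. if z \<in> {a..b} then f z else 0) has_integral (\<integral>z. indicator {a..b} z * f z \<partial>leb01)) {0..1}"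
    by (rule has_integral_eq[rotated]) (simp add: indicator_def)
  moreover have "{a..b} \<subseteq> {0..1}" using ab by auto
  ultimately show ?thesis by (simp only: has_integral_restrict)
qed

lemma L2_deriv_iff:
  "L2_deriv f f' \<longleftrightarrow> sq_integrable f' \<and> (\<forall>x\<in>{0..1}. f x = f 0 + inner (l2_ind x) (abs_l2 f'))"
proof -
  have "(f' has_integral (f x - f 0)) {0..x} \<longleftrightarrow> f x = f 0 + inner (l2_ind x) (abs_l2 f')"
    if "sq_integrable f'" "x \<in> {0..1}" for x
    using has_integral_indicator[OF that(1), of 0 x] that(2)
    by (auto simp: inner_ind that(1) dest: has_integral_unique)
  then show ?thesis unfolding L2_deriv_def by blast
qed

text \<open>This distance makes every primitive Hoelder continuous of exponent one half, with the
  norm of the derivative as constant.\<close>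

lemma norm_ind_diff:
  assumes "x \<in> {0..1}" "y \<in> {0..1}"
  shows "(norm (l2_ind x - l2_ind y))\<^sup>2 = \<bar>x - y\<bar>"
proof -
  have *: "(norm (l2_ind x - l2_ind y))\<^sup>2 = \<bar>x - y\<bar>" if "0 \<le> y" "y \<le> x" "x \<le> 1" for x y :: real
  proof -
    have overlap: "inner (l2_ind a) (l2_ind b) = b" if "0 \<le> b" "b \<le> a" "a \<le> 1" for a b :: real
    proof -
      have "(\<lambda>z. indicator {0..a} z * indicator {0..b} z) = (indicator {0..b} :: real \<Rightarrow> real)"
        using that by (auto simp: indicator_def fun_eq_iff)
      moreover have "{0..b} \<inter> {0..1} = {0..b}" using that by auto
      ultimately show ?thesis
        unfolding l2_ind_def using that
        by (simp add: inner_abs_l2 sq_integrable_indicator measure_restrict_space)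
    qed
    have "(norm (l2_ind x - l2_ind y))\<^sup>2
        = inner (l2_ind x) (l2_ind x) - 2 * inner (l2_ind x) (l2_ind y) + inner (l2_ind y) (l2_ind y)"
      by (simp only: power2_norm_eq_inner) (simp add: inner_diff inner_commute)
    then show ?thesis using that by (simp add: overlap)
  qed
  show ?thesis
  proof (cases "y \<le> x")
    case True
    then show ?thesis using *[of y x] assms by simp
  next
    case False
    then show ?thesis using *[of x y] assms by (simp add: norm_minus_commute)
  qed
qed

lemma ind_0 [simp]: "l2_ind 0 = 0"
proof (rule l2_eqI)
  fix x :: real assume "x \<in> {0..1}"
  have "inner (l2_ind x) (l2_ind 0) = (\<integral>z. indicator {0..x} z * indicator {0..0} z \<partial>leb01)"
    unfolding l2_ind_def[of 0] by (rule inner_ind[OF sq_integrable_indicator])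
  also have "\<dots> = (\<integral>z. 0 \<partial>leb01)"
  proof (rule integral_cong_AE)
    have "AE z in lebesgue. z \<noteq> (0::real)" by (intro AE_completion AE_lborel_singleton)
    then have "AE z in leb01. z \<noteq> 0" by (subst AE_restrict_space_iff) auto
    then show "AE z in leb01. indicator {0..x} z * indicator {0..0} z = (0::real)"
      by eventually_elim (simp add: indicator_def)
  qed (rule borel_measurable_const borel_measurable_times sq_integrable_measurable[OF sq_integrable_indicator])+
  finally show "inner (l2_ind x) (l2_ind 0) = inner (l2_ind x) 0" by simp
qed

lemma norm_ind_le: "x \<in> {0..1} \<Longrightarrow> norm (l2_ind x) \<le> 1"
  by (rule power2_le_imp_le) (use norm_ind_diff[of x 0] in auto)

definition prim :: "real \<Rightarrow> l2 \<Rightarrow> real \<Rightarrow> real" where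
  "prim b g x = b + inner (l2_ind x) g"

lemma prim_0 [simp]: "prim b g 0 = b"
  by (simp add: prim_def)

lemma prim_diff_le:
  assumes "x \<in> {0..1}" "y \<in> {0..1}"
  shows "\<bar>prim b g x - prim b g y\<bar> \<le> sqrt \<bar>x - y\<bar> * norm g"
proof -
  have "\<bar>prim b g x - prim b g y\<bar> = \<bar>inner (l2_ind x - l2_ind y) g\<bar>"
    by (simp add: prim_def inner_diff_left)
  also have "\<dots> \<le> norm (l2_ind x - l2_ind y) * norm g" by (rule Cauchy_Schwarz_ineq2)
  also have "norm (l2_ind x - l2_ind y) = sqrt \<bar>x - y\<bar>"
    using norm_ind_diff[OF assms] by (metis norm_ge_zero real_sqrt_unique)
  finally show ?thesis .
qed

lemma continuous_on_prim: "continuous_on {0..1} (prim b g)"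
  unfolding continuous_on_def
proof
  fix x :: real assume x: "x \<in> {0..1}"
  have "((\<lambda>y. prim b g y - prim b g x) \<longlongrightarrow> 0) (at x within {0..1})"
  proof (rule Lim_null_comparison)
    show "\<forall>\<^sub>F y in at x within {0..1}. norm (prim b g y - prim b g x) \<le> sqrt \<bar>y - x\<bar> * norm g"
      using prim_diff_le[of _ x] x by (auto simp: eventually_at_filter)
    have "((\<lambda>y. sqrt \<bar>y - x\<bar> * norm g) \<longlongrightarrow> sqrt \<bar>x - x\<bar> * norm g) (at x within {0..1})"
      by (intro tendsto_intros)
    then show "((\<lambda>y. sqrt \<bar>y - x\<bar> * norm g) \<longlongrightarrow> 0) (at x within {0..1})" by simp
  qed
  then show "(prim b g \<longlongrightarrow> prim b g x) (at x within {0..1})" by (rule LIM_zero_cancel)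
qed

lemma sq_integrable_continuous:
  assumes "continuous_on {0..1} f"
  shows "sq_integrable f"
proof -
  have "bounded (f ` {0..1})"
    using assms by (intro compact_imp_bounded compact_continuous_image) auto
  then obtain B where "\<forall>y\<in>f ` {0..1}. norm y \<le> B" unfolding bounded_iff by blast
  then have "\<And>x. x \<in> {0..1} \<Longrightarrow> \<bar>f x\<bar> \<le> B" by auto
  then show ?thesis
    using assms by (intro sq_integrable_bounded continuous_imp_measurable_on_sets_lebesgue) auto
qed

lemma sq_integrable_prim: "sq_integrable (prim b g)"
  by (intro sq_integrable_continuous continuous_on_prim)

lemma L2_deriv_prim: "sq_integrable g \<Longrightarrow> L2_deriv (prim b (abs_l2 g)) g"
  by (simp add: L2_deriv_iff) (simp add: prim_def)

lemma L2_deriv_eq_prim: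
  "L2_deriv f f' \<Longrightarrow> x \<in> {0..1} \<Longrightarrow> f x = prim (f 0) (abs_l2 f') x"
  unfolding L2_deriv_iff prim_def by blast

lemma L2_deriv_sq: "L2_deriv f f' \<Longrightarrow> sq_integrable f'"
  by (simp add: L2_deriv_def)

lemma L2_deriv_continuous: "L2_deriv f f' \<Longrightarrow> continuous_on {0..1} f"
  by (rule continuous_on_eq[OF continuous_on_prim L2_deriv_eq_prim[symmetric]])

lemma L2_deriv_sq_fun: "L2_deriv f f' \<Longrightarrow> sq_integrable f"
  by (intro sq_integrable_continuous L2_deriv_continuous)

definition primitive :: "real \<times> l2 \<Rightarrow> l2" where
  "primitive y = abs_l2 (prim (fst y) (snd y))"

lemma abs_l2_cong: "(\<And>x. x \<in> {0..1} \<Longrightarrow> f x = g x) \<Longrightarrow> sq_integrable f \<Longrightarrow> sq_integrable g \<Longrightarrow> abs_l2 f = abs_l2 g"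
  by (subst abs_l2_eq_iff) (auto intro!: AE_I2)

lemma L2_deriv_primitive: "L2_deriv f f' \<Longrightarrow> abs_l2 f = primitive (f 0, abs_l2 f')"
  unfolding primitive_def using L2_deriv_eq_prim
  by (intro abs_l2_cong) (auto intro: L2_deriv_sq_fun sq_integrable_prim)

text \<open>A null set contains no interval of positive length, so continuous functions equal almost
  everywhere agree at points arbitrarily close to \<open>x\<close>.\<close>

lemma abs_l2_continuous_inject:
  assumes f: "continuous_on {0..1} f" and g: "continuous_on {0..1} g" and eq: "abs_l2 f = abs_l2 g"
    and x: "x \<in> {0..1}"
  shows "f x = g x"
proof -
  have "AE x in leb01. f x = g x"
    using eq f g by (simp add: abs_l2_eq_iff sq_integrable_continuous)
  then have ae: "AE x in lebesgue. x \<in> {0..1} \<longrightarrow> f x = g x"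
    by (subst (asm) AE_restrict_space_iff) auto
  have "\<exists>y. y \<in> {0..1} \<and> y \<in> ball x e \<and> f y = g y" if "e > 0" for e
  proof (rule ccontr)
    assume *: "\<nexists>y. y \<in> {0..1} \<and> y \<in> ball x e \<and> f y = g y"
    \<comment> \<open>Clipping to the unit interval leaves positive length even when
      \<open>x\<close> is an end point; half the radius keeps the closed interval inside the open
      ball.\<close>
    define a b where "a = max 0 (x - e / 2)" and "b = min 1 (x + e / 2)"
    have ab: "a < b" and sub: "{a..b} \<subseteq> {0..1} \<inter> ball x e"
      using x that by (auto simp: a_def b_def dist_real_def max_def min_def split: if_splits)
    have "AE x in lebesgue. x \<notin> {a..b}"
      using ae by eventually_elim (use * sub in blast)
    then have "emeasure lebesgue {a..b} = 0"
      by (subst (asm) AE_iff_measurable[where N = "{a..b}"]) auto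
    then show False using ab by simp
  qed
  then have "\<exists>y. y \<in> {0..1} \<and> dist y x < e \<and> f y = g y" if "e > 0" for e
    using that by (auto simp: dist_commute)
  then have "\<forall>n. \<exists>y. y \<in> {0..1} \<and> dist y x < 1 / real (Suc n) \<and> f y = g y" by simp
  then obtain s where s: "\<And>n. s n \<in> {0..1}" "\<And>n. dist (s n) x < 1 / real (Suc n)" "\<And>n. f (s n) = g (s n)"
    by metis
  have lim: "s \<longlonglongrightarrow> x"
  proof (rule tendsto_dist_iff[THEN iffD2], rule tendsto_sandwich[OF _ _ tendsto_const])
    show "(\<lambda>n. 1 / real (Suc n)) \<longlonglongrightarrow> 0" by real_asymp
  qed (use s in \<open>auto intro!: always_eventually less_imp_le\<close>)
  have "(\<lambda>n. f (s n)) \<longlonglongrightarrow> f x" "(\<lambda>n. g (s n)) \<longlonglongrightarrow> g x"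
    using f g lim s(1) x by (auto intro: continuous_on_tendsto_compose)
  then show ?thesis using s(3) LIMSEQ_unique by (simp only:)
qed

text \<open>The value at \<open>0\<close> recovers the first component, and the increments, as
  pairings with all \<open>l2_ind x\<close>, the second. Boundary value and weak derivative of an
  element of \<open>H1\<close> are therefore functions of its class.\<close>

lemma inj_primitive: "inj primitive"
proof (rule injI)
  fix y y' assume "primitive y = primitive y'"
  then have eq: "prim (fst y) (snd y) x = prim (fst y') (snd y') x" if "x \<in> {0..1}" for x
    unfolding primitive_def using abs_l2_continuous_inject continuous_on_prim that by blast
  have fst: "fst y = fst y'" using eq[of 0] by simp
  moreover have "snd y = snd y'"
    by (rule l2_eqI) (use eq fst in \<open>simp add: prim_def\<close>)
  ultimately show "y = y'" by (rule prod_eqI)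
qed

lemma linear_primitive: "linear primitive"
proof (rule linearI)
  show "primitive (x + y) = primitive x + primitive y" for x y
    unfolding primitive_def by (simp add: abs_l2_add sq_integrable_prim)
      (simp add: prim_def[abs_def] inner_add_right add_ac)
  show "primitive (c *\<^sub>R x) = c *\<^sub>R primitive x" for c x
    unfolding primitive_def by (simp add: abs_l2_scale sq_integrable_prim)
      (simp add: prim_def[abs_def] distrib_left)
qed

lemma H1_eq: "H1 = range primitive"
proof
  show "H1 \<subseteq> range primitive" unfolding H1_def using L2_deriv_primitive by blast
  show "range primitive \<subseteq> H1"
  proof
    fix u assume "u \<in> range primitive"
    then obtain b g where u: "u = primitive (b, g)" by auto
    obtain h where h: "sq_integrable h" "g = abs_l2 h" by (rule l2_cases)
    then show "u \<in> H1" unfolding H1_def u primitive_def using L2_deriv_prim by auto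
  qed
qed

lemma norm_primitive_zero_le: "norm (primitive (0, g)) \<le> norm g"
proof (rule power2_le_imp_le)
  have "(norm (primitive (0, g)))\<^sup>2 = (\<integral>x. (prim 0 g x)\<^sup>2 \<partial>leb01)"
    by (simp add: primitive_def norm_abs_l2 sq_integrable_prim)
  also have "\<dots> \<le> (\<integral>x. (norm g)\<^sup>2 \<partial>leb01)"
  proof (rule integral_mono)
    show "integrable leb01 (\<lambda>x. (prim 0 g x)\<^sup>2)" using sq_integrable_prim by (auto simp: sq_integrable_def)
    fix x assume "x \<in> space leb01"
    then have "\<bar>prim 0 g x\<bar> \<le> 1 * norm g"
      using Cauchy_Schwarz_ineq2[of "l2_ind x" g] mult_right_mono[OF norm_ind_le[of x], of "norm g"]
      by (simp add: prim_def)
    then show "(prim 0 g x)\<^sup>2 \<le> (norm g)\<^sup>2" by (metis abs_le_square_iff abs_norm_cancel mult_1)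
  qed simp
  also have "\<dots> = (norm g)\<^sup>2" by simp
  finally show "(norm (primitive (0, g)))\<^sup>2 \<le> (norm g)\<^sup>2" .
qed simp

lemma primitive_const: "primitive (b, 0) = abs_l2 (\<lambda>x. b)"
  by (simp add: primitive_def prim_def[abs_def])

lemma primitive_split: "primitive (b, g) = abs_l2 (\<lambda>x. b) + primitive (0, g)"
  using linear_add[OF linear_primitive, of "(b, 0)" "(0, g)"] by (simp add: primitive_const)

lemma norm_primitive_le: "norm (primitive (b, g)) \<le> \<bar>b\<bar> + norm g"
  unfolding primitive_split[of b g]
  using norm_triangle_ineq[of "abs_l2 (\<lambda>x. b)" "primitive (0, g)"] norm_primitive_zero_le[of g] norm_const_l2[of b]
  by linarith

text \<open>Trace inequality: the constant \<open>b\<close> is the difference of the given function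
  and the primitive of \<open>g\<close> starting at \<open>0\<close>. It bounds the coding pair by
  the norm of \<open>H1\<close>.\<close>

lemma boundary_le: "\<bar>b\<bar> \<le> norm (primitive (b, g)) + norm g"
proof -
  have "abs_l2 (\<lambda>x. b) = primitive (b, g) - primitive (0, g)" using primitive_split[of b g] by simp
  then show ?thesis
    using norm_triangle_ineq4[of "primitive (b, g)" "primitive (0, g)"] norm_primitive_zero_le[of g] norm_const_l2[of b]
    by simp
qed

lemma bounded_linear_primitive: "bounded_linear primitive"
proof (rule bounded_linear_intro[where K = 2])
  show "primitive (x + y) = primitive x + primitive y" "primitive (c *\<^sub>R x) = c *\<^sub>R primitive x" for x y c
    using linear_add[OF linear_primitive] linear_scale[OF linear_primitive] by auto
  show "norm (primitive x) \<le> norm x * 2" for x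
    using norm_primitive_le[of "fst x" "snd x"] norm_fst_le[of "fst x" "snd x"] norm_snd_le[of "snd x" "fst x"]
    by simp
qed

text \<open>Rellich compactness in one dimension: the uniform Hoelder bound gives equicontinuity,
  Arzela-Ascoli a uniformly convergent subsequence, and uniform convergence implies convergence in
  L2.\<close>

lemma compact_primitive:
  assumes "\<And>n::nat. norm (X n) \<le> B"
  shows "\<exists>r l. strict_mono (r :: nat \<Rightarrow> nat) \<and> (\<lambda>n. primitive (X (r n))) \<longlonglongrightarrow> l"
proof -
  define F where "F n = prim (fst (X n)) (snd (X n))" for n
  have bd: "\<bar>fst (X n)\<bar> \<le> B" "norm (snd (X n)) \<le> B" for n
    using assms[of n] norm_fst_le[of "fst (X n)" "snd (X n)"] norm_snd_le[of "snd (X n)" "fst (X n)"]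
    by (auto intro: order_trans)
  have B: "B \<ge> 0" using bd(2)[of 0] norm_ge_zero order_trans by blast
  have F_diff: "\<bar>F n x - F n y\<bar> \<le> sqrt \<bar>x - y\<bar> * B" if "x \<in> {0..1}" "y \<in> {0..1}" for n x y
    unfolding F_def
    by (rule order_trans[OF prim_diff_le[OF that]]) (intro mult_left_mono bd, simp)
  have F_bound: "norm (F n x) \<le> 2 * B" if "x \<in> {0..1}" for n x
  proof -
    have "sqrt \<bar>x - 0\<bar> * B \<le> 1 * B" using that B by (intro mult_right_mono) auto
    then show ?thesis using F_diff[OF that, of 0 n] bd(1)[of n] by (simp add: F_def)
  qed
  \<comment> \<open>The radius \<open>(e / (B + 1))\<^sup>2\<close> keeps the Hoelder modulus below
    \<open>e\<close>; \<open>B + 1\<close> avoids division by zero.\<close>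
  have equi: "\<exists>d>0. \<forall>n y. y \<in> {0..1} \<and> norm (x - y) < d \<longrightarrow> norm (F n x - F n y) < e"
    if x: "x \<in> {0..1}" and e: "e > 0" for x e :: real
  proof (intro exI[of _ "(e / (B + 1))\<^sup>2"] conjI allI impI)
    show "(e / (B + 1))\<^sup>2 > 0" using e B by simp
    fix n y assume y: "y \<in> {0..1} \<and> norm (x - y) < (e / (B + 1))\<^sup>2"
    then have "sqrt \<bar>x - y\<bar> < e / (B + 1)"
      using e B by (intro real_less_lsqrt) auto
    then have "sqrt \<bar>x - y\<bar> * (B + 1) < e" using B by (simp add: field_simps)
    moreover have "sqrt \<bar>x - y\<bar> * B \<le> sqrt \<bar>x - y\<bar> * (B + 1)" by (intro mult_left_mono) auto
    ultimately show "norm (F n x - F n y) < e" using F_diff[OF x, of y n] y by auto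
  qed
  obtain g k where g: "continuous_on {0..1} g" and k: "strict_mono (k :: nat \<Rightarrow> nat)"
    and unif: "\<And>e. e > 0 \<Longrightarrow> \<exists>N. \<forall>n x. n \<ge> N \<and> x \<in> {0..1} \<longrightarrow> norm (F (k n) x - g x) < e"
    using Arzela_Ascoli[of "{0..1::real}" F "2 * B"] F_bound equi compact_Icc by metis
  have "(\<lambda>n. primitive (X (k n))) \<longlonglongrightarrow> abs_l2 g"
  proof (rule LIMSEQ_I)
    fix e :: real assume e: "e > 0"
    then obtain N where N: "\<And>n x. n \<ge> N \<Longrightarrow> x \<in> {0..1} \<Longrightarrow> \<bar>F (k n) x - g x\<bar> < e / 2"
      using unif[of "e / 2"] by auto
    have "norm (primitive (X (k n)) - abs_l2 g) < e" if n: "n \<ge> N" for n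
    proof -
      have sq: "sq_integrable (F (k n))" "sq_integrable g"
        using g by (simp_all add: F_def sq_integrable_prim sq_integrable_continuous)
      then have sqd: "sq_integrable (\<lambda>x. F (k n) x - g x)" by (rule sq_integrable_diff)
      have "(norm (primitive (X (k n)) - abs_l2 g))\<^sup>2 = (\<integral>x. (F (k n) x - g x)\<^sup>2 \<partial>leb01)"
        using sq by (simp add: primitive_def flip: F_def) (simp add: abs_l2_diff norm_abs_l2 sqd)
      also have "\<dots> \<le> (\<integral>x. (e / 2)\<^sup>2 \<partial>leb01)"
      proof (rule integral_mono)
        show "integrable leb01 (\<lambda>x. (F (k n) x - g x)\<^sup>2)" using sqd by (simp add: sq_integrable_def)
        fix x assume "x \<in> space leb01"
        then show "(F (k n) x - g x)\<^sup>2 \<le> (e / 2)\<^sup>2"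
          using N[OF n, of x] e by (subst abs_le_square_iff[symmetric]) auto
      qed simp
      finally have "(norm (primitive (X (k n)) - abs_l2 g))\<^sup>2 \<le> (e / 2)\<^sup>2" by simp
      then have "norm (primitive (X (k n)) - abs_l2 g) \<le> e / 2"
        by (rule power2_le_imp_le) (use e in simp)
      then show ?thesis using e by linarith
    qed
    then show "\<exists>no. \<forall>n\<ge>no. norm (primitive (X (k n)) - abs_l2 g) < e" by blast
  qed
  then show ?thesis using k by blast
qed

section \<open>Products, the operator and the weight\<close>

text \<open>The two terms integrate \<open>U s * V t\<close> over the two triangles into which the
  diagonal, a null set, cuts the unit square. This is integration by parts for primitives starting
  at \<open>0\<close>.\<close>

lemma Fubini_triangle:
  assumes U: "sq_integrable U" and V: "sq_integrable V"
  shows "(\<integral>s. U s * inner (l2_ind s) (abs_l2 V) \<partial>leb01) + (\<integral>t. V t * inner (l2_ind t) (abs_l2 U) \<partial>leb01)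
    = (\<integral>s. U s \<partial>leb01) * (\<integral>t. V t \<partial>leb01)"
proof -
  interpret pair_sigma_finite leb01 leb01
    by (rule pair_sigma_finite.intro) (rule leb01.sigma_finite_measure_axioms)+
  have [measurable]: "U \<in> borel_measurable leb01" "V \<in> borel_measurable leb01"
    using U V by (simp_all add: sq_integrable_measurable)
  have id_meas [measurable]: "(\<lambda>x. x) \<in> borel_measurable leb01"
    using id_borel_measurable_lebesgue_on by (simp add: id_def)
  have intU: "integrable leb01 U" and intV: "integrable leb01 V"
    using U V by (simp_all add: sq_integrable_integrable)
  \<comment> \<open>The triangle \<open>s < t\<close>: integrating over \<open>t\<close> first
    leaves the complement of \<open>{0..s}\<close>, integrating over \<open>s\<close> first the
    interval \<open>{0..t}\<close> up to the point \<open>t\<close>.\<close>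
  let ?P = "\<lambda>(t, s). if s < t then U s * V t else 0"
  have meas [measurable]: "?P \<in> borel_measurable (leb01 \<Otimes>\<^sub>M leb01)"
  proof -
    have [measurable]: "fst \<in> borel_measurable (leb01 \<Otimes>\<^sub>M leb01)" "snd \<in> borel_measurable (leb01 \<Otimes>\<^sub>M leb01)"
      using measurable_compose[OF measurable_fst id_meas] measurable_compose[OF measurable_snd id_meas] by simp_all
    have "(\<lambda>p. if snd p < fst p then U (snd p) * V (fst p) else 0) \<in> borel_measurable (leb01 \<Otimes>\<^sub>M leb01)"
      by measurable
    then show ?thesis by (simp add: case_prod_unfold)
  qed
  have "integrable (leb01 \<Otimes>\<^sub>M leb01) (\<lambda>p. V (fst p) * U (snd p))"
  proof (rule Fubini_integrable)
    show "integrable leb01 (\<lambda>x. \<integral>y. norm (V (fst (x, y)) * U (snd (x, y))) \<partial>leb01)"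
      using intU intV by (simp add: abs_mult)
    show "AE x in leb01. integrable leb01 (\<lambda>y. V (fst (x, y)) * U (snd (x, y)))"
      using intU by simp
  qed measurable
  then have int: "integrable (leb01 \<Otimes>\<^sub>M leb01) ?P"
    by (rule Bochner_Integration.integrable_bound[OF _ meas]) (auto simp: abs_mult)
  have split: "(\<integral>t. (if s < t then U s * V t else 0) \<partial>leb01)
      = U s * (\<integral>t. V t \<partial>leb01) - U s * inner (l2_ind s) (abs_l2 V)" if "s \<in> {0..1}" for s
  proof -
    have int_ind: "integrable leb01 (\<lambda>t. indicator {0..s} t * V t)"
      by (intro sq_integrable_mult sq_integrable_indicator V)
    have "(\<integral>t. (if s < t then U s * V t else 0) \<partial>leb01)
        = (\<integral>t. U s * (V t - indicator {0..s} t * V t) \<partial>leb01)"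
      using that by (intro Bochner_Integration.integral_cong) (auto simp: indicator_def)
    then show ?thesis using int_ind intV by (simp add: inner_ind V right_diff_distrib)
  qed
  have point: "(\<integral>s. (if s < t then U s * V t else 0) \<partial>leb01) = V t * inner (l2_ind t) (abs_l2 U)"
    if "t \<in> {0..1}" for t
  proof -
    have "(\<integral>s. (if s < t then U s * V t else 0) \<partial>leb01) = (\<integral>s. V t * (indicator {0..t} s * U s) \<partial>leb01)"
    proof (rule integral_cong_AE)
      have "AE s in lebesgue. s \<noteq> t" by (intro AE_completion AE_lborel_singleton)
      then have "AE s in leb01. s \<noteq> t" by (subst AE_restrict_space_iff) auto
      moreover have "AE s in leb01. s \<in> {0..1}" by (intro AE_I2) simp
      ultimately show "AE s in leb01. (if s < t then U s * V t else 0) = V t * (indicator {0..t} s * U s)"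
        by eventually_elim (auto simp: indicator_def)
    qed (use sq_integrable_measurable[OF sq_integrable_indicator] in measurable)
    then show ?thesis by (simp add: inner_ind U)
  qed
  have intUp: "integrable leb01 (\<lambda>s. U s * inner (l2_ind s) (abs_l2 V))"
    using sq_integrable_mult[OF U sq_integrable_prim[of 0 "abs_l2 V"]] by (simp add: prim_def)
  have "(\<integral>t. V t * inner (l2_ind t) (abs_l2 U) \<partial>leb01)
      = (\<integral>t. (\<integral>s. (if s < t then U s * V t else 0) \<partial>leb01) \<partial>leb01)"
    by (intro Bochner_Integration.integral_cong) (simp_all add: point)
  also have "\<dots> = (\<integral>s. (\<integral>t. (if s < t then U s * V t else 0) \<partial>leb01) \<partial>leb01)"
    by (rule Fubini_integral[OF int, symmetric])
  also have "\<dots> = (\<integral>s. U s * (\<integral>t. V t \<partial>leb01) - U s * inner (l2_ind s) (abs_l2 V) \<partial>leb01)"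
    by (intro Bochner_Integration.integral_cong) (simp_all add: split)
  also have "\<dots> = (\<integral>s. U s \<partial>leb01) * (\<integral>t. V t \<partial>leb01) - (\<integral>s. U s * inner (l2_ind s) (abs_l2 V) \<partial>leb01)"
    using intU intUp by simp
  finally show ?thesis by simp
qed

lemma sq_integrable_mult_continuous:
  "sq_integrable f \<Longrightarrow> continuous_on {0..1} g \<Longrightarrow> sq_integrable (\<lambda>x. g x * f x)"
proof -
  assume f: "sq_integrable f" and g: "continuous_on {0..1} g"
  have "bounded (g ` {0..1})"
    using g by (intro compact_imp_bounded compact_continuous_image) auto
  then obtain B where "\<forall>y\<in>g ` {0..1}. norm y \<le> B" unfolding bounded_iff by blast
  then show ?thesis
    using f sq_integrable_measurable[OF sq_integrable_continuous[OF g]]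
    by (intro sq_integrable_bounded_mult[where B = B]) auto
qed

lemma L2_deriv_increment: "L2_deriv f f' \<Longrightarrow> x \<in> {0..1} \<Longrightarrow> inner (l2_ind x) (abs_l2 f') = f x - f 0"
  by (metis L2_deriv_iff add_diff_cancel_left')

text \<open>Cutting both derivatives off at \<open>x\<close> turns the product rule on
  \<open>{0..x}\<close> into \<open>Fubini_triangle\<close> on the whole unit interval.\<close>

lemma L2_deriv_mult:
  assumes f: "L2_deriv f f'" and g: "L2_deriv g g'"
  shows "L2_deriv (\<lambda>x. f x * g x) (\<lambda>x. g x * f' x + f x * g' x)"
proof -
  note cont = L2_deriv_continuous[OF f] L2_deriv_continuous[OF g]
  note sq = L2_deriv_sq[OF f] L2_deriv_sq[OF g]
  have sq1: "sq_integrable (\<lambda>x. g x * f' x)" and sq2: "sq_integrable (\<lambda>x. f x * g' x)"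
    by (intro sq_integrable_mult_continuous sq cont)+
  have "f x * g x = f 0 * g 0 + inner (l2_ind x) (abs_l2 (\<lambda>x. g x * f' x + f x * g' x))"
    if x: "x \<in> {0..1}" for x
  proof -
    define U where "U s = indicator {0..x} s * f' s" for s
    define V where "V s = indicator {0..x} s * g' s" for s
    have sq_ind: "sq_integrable (\<lambda>s. indicator {0..x} s * h s)" if "sq_integrable h" for h
      by (rule sq_integrable_bounded_mult[OF that sq_integrable_measurable[OF sq_integrable_indicator], where B = 1])
        (simp add: indicator_def)
    have U: "sq_integrable U" and V: "sq_integrable V"
      unfolding U_def[abs_def] V_def[abs_def] by (intro sq_ind sq)+
    have intU: "(\<integral>s. U s \<partial>leb01) = f x - f 0" and intV: "(\<integral>s. V s \<partial>leb01) = g x - g 0"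
      unfolding U_def V_def
      using L2_deriv_increment[OF f x] L2_deriv_increment[OF g x] sq by (simp_all add: inner_ind)
    have cut: "inner (l2_ind s) (abs_l2 (\<lambda>z. indicator {0..x} z * h z)) = inner (l2_ind s) (abs_l2 h)"
      if "sq_integrable h" "s \<le> x" for s h
      using that by (simp add: inner_ind sq_ind)
        (intro Bochner_Integration.integral_cong, auto simp: indicator_def)
    have loc: "indicator {0..x} s * h s * inner (l2_ind s) (abs_l2 (\<lambda>z. indicator {0..x} z * k' z))
        = indicator {0..x} s * h s * (k s - k 0)"
      if "L2_deriv k k'" "s \<in> {0..1}" for h k k' s
    proof (cases "s \<le> x")
      case True
      then show ?thesis
        by (simp only: cut[OF L2_deriv_sq[OF that(1)] True] L2_deriv_increment[OF that])
    qed (simp add: indicator_def)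
    have "(\<integral>s. U s * inner (l2_ind s) (abs_l2 V) \<partial>leb01) = (\<integral>s. U s * (g s - g 0) \<partial>leb01)"
      unfolding U_def V_def by (intro Bochner_Integration.integral_cong) (simp_all add: loc[OF g])
    moreover have "(\<integral>s. V s * inner (l2_ind s) (abs_l2 U) \<partial>leb01) = (\<integral>s. V s * (f s - f 0) \<partial>leb01)"
      unfolding U_def V_def by (intro Bochner_Integration.integral_cong) (simp_all add: loc[OF f])
    ultimately have "(\<integral>s. U s * (g s - g 0) \<partial>leb01) + (\<integral>s. V s * (f s - f 0) \<partial>leb01)
        = (f x - f 0) * (g x - g 0)"
      using Fubini_triangle[OF U V] by (simp add: intU intV)
    moreover have "(\<integral>s. U s * (g s - g 0) \<partial>leb01) = (\<integral>s. U s * g s \<partial>leb01) - g 0 * (f x - f 0)"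
      using sq_integrable_mult[OF U L2_deriv_sq_fun[OF g]] sq_integrable_integrable[OF U]
      by (simp add: right_diff_distrib intU) (simp add: algebra_simps)
    moreover have "(\<integral>s. V s * (f s - f 0) \<partial>leb01) = (\<integral>s. V s * f s \<partial>leb01) - f 0 * (g x - g 0)"
      using sq_integrable_mult[OF V L2_deriv_sq_fun[OF f]] sq_integrable_integrable[OF V]
      by (simp add: right_diff_distrib intV) (simp add: algebra_simps)
    moreover have "inner (l2_ind x) (abs_l2 (\<lambda>x. g x * f' x + f x * g' x))
        = (\<integral>s. U s * g s \<partial>leb01) + (\<integral>s. V s * f s \<partial>leb01)"
    proof -
      have "inner (l2_ind x) (abs_l2 (\<lambda>x. g x * f' x + f x * g' x)) = (\<integral>s. U s * g s + V s * f s \<partial>leb01)"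
        unfolding inner_ind[OF sq_integrable_add[OF sq1 sq2]] U_def V_def by (simp add: algebra_simps)
      then show ?thesis
        using sq_integrable_mult[OF V L2_deriv_sq_fun[OF f]] sq_integrable_mult[OF U L2_deriv_sq_fun[OF g]]
        by simp
    qed
    ultimately show ?thesis by (simp add: algebra_simps)
  qed
  then show ?thesis unfolding L2_deriv_iff using sq_integrable_add[OF sq1 sq2] by blast
qed

lemma L2_deriv_C1:
  assumes "\<And>x. x \<in> {0..1} \<Longrightarrow> (f has_real_derivative f' x) (at x within {0..1})"
    and "continuous_on {0..1} f'"
  shows "L2_deriv f f'"
  unfolding L2_deriv_def
proof (intro conjI ballI)
  show "sq_integrable f'" by (rule sq_integrable_continuous) fact
  fix x :: real assume x: "x \<in> {0..1}"
  show "(f' has_integral (f x - f 0)) {0..x}"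
  proof (rule fundamental_theorem_of_calculus)
    fix y assume "y \<in> {0..x}"
    then have "(f has_real_derivative f' y) (at y within {0..x})"
      using x by (intro has_field_derivative_subset[OF assms(1)]) auto
    then show "(f has_vector_derivative f' y) (at y within {0..x})"
      by (simp add: has_real_derivative_iff_has_vector_derivative)
  qed (use x in simp)
qed

section \<open>The differential operator in terms of primitives\<close>

lemma primitive_eq_iff [simp]: "primitive y = primitive y' \<longleftrightarrow> y = y'"
  using inj_primitive by (simp add: inj_eq)

text \<open>\<open>c\<close> is the derivative at \<open>0\<close> and \<open>g\<close> the second
  derivative. Starting the outer primitive at \<open>D * c\<close> builds in the left boundary
  condition, so only the right one remains as an equation.\<close>

lemma A_op_iff:
  "(u, v) \<in> A_op D k0 \<longleftrightarrow> (\<exists>c g. u = primitive (D * c, primitive (c, g))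
     \<and> v = D *\<^sub>R g - primitive (c, g) - k0 *\<^sub>R u \<and> prim c g 1 = 0)"
proof
  assume "(u, v) \<in> A_op D k0"
  then obtain f f' f'' where u: "u = abs_l2 f" and v: "v = abs_l2 (\<lambda>z. D * f'' z - f' z - k0 * f z)"
    and d: "L2_deriv f f'" "L2_deriv f' f''" and bc: "D * f' 0 - f 0 = 0" "f' 1 = 0"
    unfolding A_op_def by auto
  have w: "abs_l2 f' = primitive (f' 0, abs_l2 f'')" using L2_deriv_primitive[OF d(2)] .
  have sq: "sq_integrable f" "sq_integrable f'" "sq_integrable f''"
    using d by (auto intro: L2_deriv_sq L2_deriv_sq_fun)
  have "u = primitive (D * f' 0, abs_l2 f')" using L2_deriv_primitive[OF d(1)] bc(1) u by simp
  moreover have "v = D *\<^sub>R abs_l2 f'' - abs_l2 f' - k0 *\<^sub>R u"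
    by (simp add: u v abs_l2_scale abs_l2_diff sq sq_integrable_scale sq_integrable_diff)
  moreover have "prim (f' 0) (abs_l2 f'') 1 = 0"
    using L2_deriv_eq_prim[OF d(2), of 1] bc(2) by simp
  ultimately show "\<exists>c g. u = primitive (D * c, primitive (c, g)) \<and> v = D *\<^sub>R g - primitive (c, g) - k0 *\<^sub>R u \<and> prim c g 1 = 0"
    unfolding w by blast
next
  assume "\<exists>c g. u = primitive (D * c, primitive (c, g)) \<and> v = D *\<^sub>R g - primitive (c, g) - k0 *\<^sub>R u \<and> prim c g 1 = 0"
  then obtain c g where u: "u = primitive (D * c, primitive (c, g))"
    and v: "v = D *\<^sub>R g - primitive (c, g) - k0 *\<^sub>R u" and bc: "prim c g 1 = 0" by blast
  obtain f'' where f'': "sq_integrable f''" "g = abs_l2 f''" by (rule l2_cases)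
  define f' where "f' = prim c g"
  define f where "f = prim (D * c) (abs_l2 f')"
  have d: "L2_deriv f' f''" "L2_deriv f f'"
    unfolding f_def f'_def f''(2) by (intro L2_deriv_prim sq_integrable_prim f''(1))+
  have w: "primitive (c, g) = abs_l2 f'" by (simp add: primitive_def f'_def)
  have uf: "u = abs_l2 f" unfolding u w by (simp add: primitive_def f_def)
  have sq: "sq_integrable f" "sq_integrable f'" using d by (auto intro: L2_deriv_sq_fun)
  have "v = D *\<^sub>R g - abs_l2 f' - k0 *\<^sub>R abs_l2 f" unfolding v w uf ..
  then have "v = abs_l2 (\<lambda>z. D * f'' z - f' z - k0 * f z)"
    by (simp add: f'' abs_l2_scale abs_l2_diff sq sq_integrable_scale sq_integrable_diff)
  moreover have "D * f' 0 - f 0 = 0" "f' 1 = 0" using bc by (simp_all add: f_def f'_def)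
  ultimately show "(u, v) \<in> A_op D k0" unfolding A_op_def using uf d by blast
qed

lemma A_op_shift: "(u, v) \<in> A_op D k0 \<longleftrightarrow> (u, v + k0 *\<^sub>R u) \<in> A_op D 0"
  unfolding A_op_iff by (auto simp: algebra_simps)

lemma A_op_single_valued: "(u, v) \<in> A_op D k0 \<Longrightarrow> (u, v') \<in> A_op D k0 \<Longrightarrow> v = v'"
  unfolding A_op_iff by auto

lemma A_op_scale: "(u, v) \<in> A_op D k0 \<Longrightarrow> (c *\<^sub>R u, c *\<^sub>R v) \<in> A_op D k0"
proof -
  assume "(u, v) \<in> A_op D k0"
  then obtain b g where *: "u = primitive (D * b, primitive (b, g))" "v = D *\<^sub>R g - primitive (b, g) - k0 *\<^sub>R u" "prim b g 1 = 0"
    unfolding A_op_iff by blast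
  have 1: "primitive (c * b, c *\<^sub>R g) = c *\<^sub>R primitive (b, g)"
    using linear_scale[OF linear_primitive, of c "(b, g)"] by simp
  have 2: "primitive (D * (c * b), c *\<^sub>R primitive (b, g)) = c *\<^sub>R u"
    using linear_scale[OF linear_primitive, of c "(D * b, primitive (b, g))"] by (simp add: *(1) mult_ac)
  have "c *\<^sub>R u = primitive (D * (c * b), primitive (c * b, c *\<^sub>R g))" unfolding 1 2 ..
  moreover have "c *\<^sub>R v = D *\<^sub>R (c *\<^sub>R g) - primitive (c * b, c *\<^sub>R g) - k0 *\<^sub>R (c *\<^sub>R u)"
    unfolding 1 *(2) by (simp add: scaleR_diff_right mult.commute)
  moreover have "prim (c * b) (c *\<^sub>R g) 1 = c * prim b g 1" by (simp add: prim_def distrib_left)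
  ultimately show ?thesis unfolding A_op_iff using *(3) by fastforce
qed

lemma A_op_add:
  assumes "(u, v) \<in> A_op D k0" "(u', v') \<in> A_op D k0"
  shows "(u + u', v + v') \<in> A_op D k0"
proof -
  obtain b g where *: "u = primitive (D * b, primitive (b, g))" "v = D *\<^sub>R g - primitive (b, g) - k0 *\<^sub>R u" "prim b g 1 = 0"
    using assms(1) unfolding A_op_iff by blast
  obtain b' g' where **: "u' = primitive (D * b', primitive (b', g'))" "v' = D *\<^sub>R g' - primitive (b', g') - k0 *\<^sub>R u'" "prim b' g' 1 = 0"
    using assms(2) unfolding A_op_iff by blast
  have 1: "primitive (b + b', g + g') = primitive (b, g) + primitive (b', g')"
    using linear_add[OF linear_primitive, of "(b, g)" "(b', g')"] by simp
  have 2: "primitive (D * (b + b'), primitive (b, g) + primitive (b', g')) = u + u'"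
    using linear_add[OF linear_primitive, of "(D * b, primitive (b, g))" "(D * b', primitive (b', g'))"]
    by (simp add: *(1) **(1) distrib_left)
  have "u + u' = primitive (D * (b + b'), primitive (b + b', g + g'))" unfolding 1 2 ..
  moreover have "v + v' = D *\<^sub>R (g + g') - primitive (b + b', g + g') - k0 *\<^sub>R (u + u')"
    unfolding 1 *(2) **(2) by (simp add: algebra_simps)
  moreover have "prim (b + b') (g + g') 1 = 0" using *(3) **(3) by (simp add: prim_def inner_add_right)
  ultimately show ?thesis unfolding A_op_iff by blast
qed

section \<open>The isometry that removes the weight\<close>

definition weight :: "real \<Rightarrow> real \<Rightarrow> real" where
  "weight D z = exp (- z / (2 * D))"

lemma continuous_on_weight: "continuous_on S (weight D)"
  unfolding weight_def by (cases "D = 0") (auto intro!: continuous_intros)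

lemma weight_mult_self: "weight D z * weight D z = rho D z"
  by (simp add: weight_def rho_def exp_add[symmetric])

lemma weight_inverse: "weight (- D) z * weight D z = 1"
  by (simp add: weight_def exp_add[symmetric])

lemma sq_integrable_weight: "sq_integrable f \<Longrightarrow> sq_integrable (\<lambda>z. weight D z * f z)"
  by (rule sq_integrable_mult_continuous[OF _ continuous_on_weight])

text \<open>\<open>J D\<close> multiplies by the square root of \<open>rho D\<close>: an isometry from \<open>ip_rho D\<close> to the unweighted
  inner product, with inverse \<open>J (- D)\<close>.\<close>

lift_definition J :: "real \<Rightarrow> l2 \<Rightarrow> l2" is "\<lambda>D f z. weight D z * f z"
  by (auto simp: L2_rel_def intro!: sq_integrable_weight elim: eventually_mono)

lemma J_abs_l2: "sq_integrable f \<Longrightarrow> J D (abs_l2 f) = abs_l2 (\<lambda>z. weight D z * f z)"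
  by (simp add: J.abs_eq L2_rel_refl)

lemma J_inverse: "J (- D) (J D u) = u"
  by transfer (simp add: L2_rel_def mult.assoc[symmetric] weight_inverse)

text \<open>On the unit interval the weight is at most \<open>exp (1 / (2 * \<bar>D\<bar>))\<close>.
  The absolute value lets the lemma apply at \<open>- D\<close> as well, where the weight increases
  for positive \<open>D\<close>.\<close>

lemma bounded_linear_J: "bounded_linear (J D)"
proof (rule bounded_linear_intro[where K = "exp (1 / (2 * \<bar>D\<bar>))"])
  show "J D (u + v) = J D u + J D v" for u v
    by transfer (auto simp: L2_rel_def distrib_left intro!: sq_integrable_add sq_integrable_weight)
  show "J D (c *\<^sub>R u) = c *\<^sub>R J D u" for c u
    by transfer (auto simp: L2_rel_def mult.left_commute intro!: sq_integrable_scale sq_integrable_weight)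
  show "norm (J D u) \<le> norm u * exp (1 / (2 * \<bar>D\<bar>))" for u
  proof (rule power2_le_imp_le)
    obtain f where f: "sq_integrable f" "u = abs_l2 f" by (rule l2_cases)
    have "(norm (J D u))\<^sup>2 = (\<integral>z. (weight D z * f z)\<^sup>2 \<partial>leb01)"
      by (simp add: f J_abs_l2 norm_abs_l2 sq_integrable_weight)
    also have "\<dots> \<le> (\<integral>z. (exp (1 / (2 * \<bar>D\<bar>)))\<^sup>2 * (f z)\<^sup>2 \<partial>leb01)"
    proof (rule integral_mono)
      show "integrable leb01 (\<lambda>z. (weight D z * f z)\<^sup>2)"
        using sq_integrable_weight[OF f(1)] by (simp add: sq_integrable_def)
      show "integrable leb01 (\<lambda>z. (exp (1 / (2 * \<bar>D\<bar>)))\<^sup>2 * (f z)\<^sup>2)"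
        using f(1) by (simp add: sq_integrable_def)
      fix z assume "z \<in> space leb01"
      then have z: "0 \<le> z" "z \<le> 1" by auto
      have "- z / (2 * D) \<le> \<bar>- z / (2 * D)\<bar>" by (rule abs_ge_self)
      also have "\<dots> = z / (2 * \<bar>D\<bar>)" using z by (simp add: abs_mult)
      also have "\<dots> \<le> 1 / (2 * \<bar>D\<bar>)" using z by (intro divide_right_mono) auto
      finally have "weight D z \<le> exp (1 / (2 * \<bar>D\<bar>))" by (simp add: weight_def)
      then have "(weight D z)\<^sup>2 \<le> (exp (1 / (2 * \<bar>D\<bar>)))\<^sup>2"
        by (intro power_mono) (auto simp: weight_def)
      then show "(weight D z * f z)\<^sup>2 \<le> (exp (1 / (2 * \<bar>D\<bar>)))\<^sup>2 * (f z)\<^sup>2"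
        unfolding power_mult_distrib by (rule mult_right_mono) simp
    qed
    also have "\<dots> = (norm u * exp (1 / (2 * \<bar>D\<bar>)))\<^sup>2"
      by (simp add: f power_mult_distrib norm_abs_l2)
    finally show "(norm (J D u))\<^sup>2 \<le> (norm u * exp (1 / (2 * \<bar>D\<bar>)))\<^sup>2" .
  qed simp
qed

lemma inner_J: "inner (J D u) (J D v) = ip_rho D u v"
proof -
  obtain f g where f: "sq_integrable f" "u = abs_l2 f" and g: "sq_integrable g" "v = abs_l2 g"
    by (meson l2_cases)
  have *: "weight D z * f z * (weight D z * g z) = f z * g z * rho D z" for z
    unfolding weight_mult_self[symmetric] by (simp only: mult_ac)
  show ?thesis
    by (simp add: f g J_abs_l2 inner_abs_l2 sq_integrable_weight ip_rho.abs_eq L2_rel_refl) (simp only: *)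
qed

section \<open>The inverse operator and its eigenvectors\<close>

lemma ip_rho_abs_l2:
  "sq_integrable f \<Longrightarrow> sq_integrable g \<Longrightarrow> ip_rho D (abs_l2 f) (abs_l2 g) = (\<integral>z. f z * g z * rho D z \<partial>leb01)"
  by (simp add: ip_rho.abs_eq L2_rel_refl)

lemma inner_ind_1:
  assumes "sq_integrable f" shows "inner (l2_ind 1) (abs_l2 f) = (\<integral>z. f z \<partial>leb01)"
  unfolding inner_ind[OF assms] by (intro Bochner_Integration.integral_cong) auto

lemma L2_deriv_exp: "L2_deriv (\<lambda>z. exp (a * z)) (\<lambda>z. a * exp (a * z))"
  by (rule L2_deriv_C1) (auto intro!: derivative_eq_intros continuous_intros)

lemma sq_integrable_mult_rho:
  assumes "sq_integrable f" "sq_integrable g"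
  shows "integrable leb01 (\<lambda>z. f z * g z * rho D z)"
proof -
  have "sq_integrable (\<lambda>z. weight D z * (weight D z * g z))"
    by (intro sq_integrable_weight assms)
  from sq_integrable_mult[OF assms(1) this] show ?thesis
    by (simp only: mult_ac weight_mult_self[symmetric])
qed

locale convection_diffusion =
  fixes D :: real
  assumes D_pos: "D > 0"
begin

text \<open>\<open>E\<close> turns the energy form $f(0)h(0) + D\int f'h'\rho$ into the standard inner product of
  \<open>real \<times> l2\<close>.\<close>

definition E :: "real \<times> l2 \<Rightarrow> real \<times> l2" where
  "E y = (fst y, sqrt D *\<^sub>R J D (snd y))"

definition E_inv :: "real \<times> l2 \<Rightarrow> real \<times> l2" where
  "E_inv z = (fst z, J (- D) ((1 / sqrt D) *\<^sub>R snd z))"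

lemma J_J_inverse [simp]: "J D (J (- D) x) = x" "J (- D) (J D x) = x"
  using J_inverse[of "- D" x] J_inverse[of D x] by simp_all

sublocale J: bounded_linear "J D" by (rule bounded_linear_J)
sublocale J': bounded_linear "J (- D)" by (rule bounded_linear_J)
sublocale I: bounded_linear primitive by (rule bounded_linear_primitive)

lemma J_eq_iff [simp]: "J D u = J D v \<longleftrightarrow> u = v"
  using J_J_inverse(2) by metis

lemma E_E_inv [simp]: "E (E_inv z) = z" "E_inv (E y) = y"
  using D_pos by (simp_all add: E_def E_inv_def J.scaleR J'.scaleR)

lemma bounded_linear_E_inv: "bounded_linear E_inv"
  unfolding E_inv_def[abs_def]
  by (intro bounded_linear_Pair bounded_linear_fst
      bounded_linear_compose[OF bounded_linear_J]
      bounded_linear_compose[OF bounded_linear_scaleR_right] bounded_linear_snd)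

lemma bounded_linear_E: "bounded_linear E"
  unfolding E_def[abs_def]
  by (intro bounded_linear_Pair bounded_linear_fst
      bounded_linear_compose[OF bounded_linear_scaleR_right]
      bounded_linear_compose[OF bounded_linear_J] bounded_linear_snd)

sublocale E: bounded_linear E by (rule bounded_linear_E)

lemma E_eq_iff [simp]: "E y = E y' \<longleftrightarrow> y = y'"
  using E_E_inv(2) by metis

lemma E_eq_0_iff [simp]: "E y = 0 \<longleftrightarrow> y = 0"
  using E_eq_iff[of y 0] by (simp only: E.zero)

lemma J_eq_0_iff [simp]: "J D u = 0 \<longleftrightarrow> u = 0"
  using J_eq_iff[of u 0] by (simp only: J.zero)

lemma primitive_eq_0_iff [simp]: "primitive y = 0 \<longleftrightarrow> y = 0"
  using primitive_eq_iff[of y 0] by (simp only: I.zero)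

lemma inner_E: "inner (E y) (E y') = fst y * fst y' + D * ip_rho D (snd y) (snd y')"
  using D_pos by (simp add: E_def inner_J)

text \<open>The operator is \<open>D / rho\<close> times the derivative of \<open>rho * u'\<close>,
  so integrating the derivative of \<open>rho * u' * k\<close> produces both sides. The boundary
  term at \<open>1\<close> drops out by the right condition; the one at \<open>0\<close> becomes the
  product of the values there by the left one.\<close>

lemma form_identity:
  assumes A: "(primitive y, v) \<in> A_op D 0"
  shows "inner (E y) (E y') = - inner (J D v) (J D (primitive y'))"
proof -
  obtain c g where y: "y = (D * c, primitive (c, g))" and v: "v = D *\<^sub>R g - primitive (c, g)" and bc: "prim c g 1 = 0"
    using A unfolding A_op_iff by auto
  obtain b h where y': "y' = (b, h)" by fastforce
  obtain f'' where f'': "sq_integrable f''" "g = abs_l2 f''" by (rule l2_cases)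
  obtain h' where h': "sq_integrable h'" "h = abs_l2 h'" by (rule l2_cases)
  \<comment> \<open>\<open>f\<close> represents the derivative of the element of the domain,
    \<open>k\<close> the test function.\<close>
  define f where "f = prim c g"
  define k where "k = prim b h"
  have f: "L2_deriv f f''" "sq_integrable f" and k: "L2_deriv k h'" "sq_integrable k"
    unfolding f_def k_def f'' h' by (intro L2_deriv_prim sq_integrable_prim f'' h')+
  have r: "L2_deriv (rho D) (\<lambda>z. - (1 / D) * rho D z)"
    using L2_deriv_exp[of "- (1 / D)"] by (simp only: rho_def[abs_def])
  have sqv: "sq_integrable (\<lambda>z. D * f'' z - f z)"
    by (intro sq_integrable_diff sq_integrable_scale f f'')
  let ?F = "\<lambda>x. k x * (f x * (- (1 / D) * rho D x) + rho D x * f'' x) + rho D x * f x * h' x"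
  have F: "L2_deriv (\<lambda>x. rho D x * f x * k x) ?F"
    by (intro L2_deriv_mult r f k)
  have "(\<integral>z. ?F z \<partial>leb01) = rho D 1 * f 1 * k 1 - rho D 0 * f 0 * k 0"
    using L2_deriv_increment[OF F, of 1] unfolding inner_ind_1[OF L2_deriv_sq[OF F]] by simp
  then have "(\<integral>z. ?F z \<partial>leb01) = - (c * b)"
    using bc by (simp add: f_def k_def rho_def)
  moreover have "D * ?F z = (D * f'' z - f z) * k z * rho D z + D * (f z * h' z * rho D z)" for z
    using D_pos by (simp add: field_simps)
  ultimately have "D * - (c * b) = (\<integral>z. (D * f'' z - f z) * k z * rho D z + D * (f z * h' z * rho D z) \<partial>leb01)"
    by (metis (no_types, lifting) Bochner_Integration.integral_cong integral_mult_right_zero)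
  also have "\<dots> = (\<integral>z. (D * f'' z - f z) * k z * rho D z \<partial>leb01) + D * (\<integral>z. f z * h' z * rho D z \<partial>leb01)"
    using sq_integrable_mult_rho[OF sqv k(2)] sq_integrable_mult_rho[OF f(2) h'(1)] by simp
  also have "(\<integral>z. (D * f'' z - f z) * k z * rho D z \<partial>leb01) = ip_rho D v (primitive y')"
  proof -
    have "v = D *\<^sub>R g - abs_l2 f" by (simp add: v primitive_def f_def)
    then have "v = abs_l2 (\<lambda>z. D * f'' z - f z)"
      by (simp add: abs_l2_scale abs_l2_diff f f'' sq_integrable_scale)
    moreover have "primitive y' = abs_l2 k" by (simp add: y' primitive_def k_def)
    ultimately show ?thesis by (simp add: ip_rho_abs_l2 sqv k)
  qed
  also have "(\<integral>z. f z * h' z * rho D z \<partial>leb01) = ip_rho D (snd y) h"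
    unfolding y h'(2) primitive_def snd_conv fst_conv f_def[symmetric] by (simp add: ip_rho_abs_l2 f h')
  finally show ?thesis by (simp add: inner_E inner_J y y')
qed

text \<open>The equation says that \<open>rho * f'\<close> has derivative
  \<open>rho * q / D\<close>. One integration with the constant fixed by the right boundary
  condition, and a second one started at \<open>D * f' 0\<close>, solve it explicitly.\<close>

lemma A_op_surj: "\<exists>u. (u, v) \<in> A_op D 0"
proof -
  obtain q where q: "sq_integrable q" "v = abs_l2 q" by (rule l2_cases)
  define p where "p z = rho D z * q z / D" for z
  have "sq_integrable (\<lambda>z. (1 / D) * (rho D z * q z))"
    using D_pos
    by (intro sq_integrable_scale sq_integrable_mult_continuous q) (auto simp: rho_def[abs_def] intro!: continuous_intros)
  then have p: "sq_integrable p" by (simp add: p_def[abs_def])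
  \<comment> \<open>Minus the whole integral of \<open>p\<close> as initial value makes
    \<open>P\<close> vanish at \<open>1\<close>.\<close>
  define P where "P = prim (- inner (l2_ind 1) (abs_l2 p)) (abs_l2 p)"
  have P: "L2_deriv P p" unfolding P_def by (rule L2_deriv_prim[OF p])
  define f' where "f' z = P z * exp ((1 / D) * z)" for z
  define f'' where "f'' z = exp ((1 / D) * z) * p z + P z * ((1 / D) * exp ((1 / D) * z))" for z
  have f'': "L2_deriv f' f''"
    unfolding f'_def[abs_def] f''_def[abs_def] by (intro L2_deriv_mult P L2_deriv_exp)
  define f where "f = prim (D * f' 0) (abs_l2 f')"
  have f: "L2_deriv f f'" unfolding f_def by (rule L2_deriv_prim[OF L2_deriv_sq_fun[OF f'']])
  have *: "D * f'' z - f' z - 0 * f z = q z" for z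
  proof -
    have "exp ((1 / D) * z) * rho D z = 1" by (simp add: rho_def exp_add[symmetric])
    then have "exp ((1 / D) * z) * p z = q z / D" unfolding p_def by (simp add: mult.assoc[symmetric])
    then show ?thesis using D_pos by (simp add: f'_def f''_def field_simps)
  qed
  have bc: "D * f' 0 - f 0 = 0" "f' 1 = 0"
    by (simp_all add: f_def f'_def P_def) (simp add: prim_def)
  have "v = abs_l2 (\<lambda>z. D * f'' z - f' z - 0 * f z)" unfolding * q(2) ..
  then have "(abs_l2 f, v) \<in> A_op D 0" unfolding A_op_def using f f'' bc by blast
  then show ?thesis by blast
qed

lemma A_op_zero: "(0, 0) \<in> A_op D k0"
proof -
  obtain u where "(u, 0) \<in> A_op D 0" using A_op_surj by blast
  from A_op_scale[OF this, of 0] show ?thesis using A_op_shift[of 0 0 D k0] by simp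
qed

lemma A_op_range: "(u, v) \<in> A_op D k0 \<Longrightarrow> \<exists>y. u = primitive y"
  unfolding A_op_iff by blast

text \<open>A difference of solutions has zero energy by \<open>form_identity\<close>, and the
  energy is definite because it controls the value at \<open>0\<close> and the derivative.\<close>

lemma A_op_inject:
  assumes "(u, v) \<in> A_op D 0" "(u', v) \<in> A_op D 0"
  shows "u = u'"
proof -
  have "(u - u', 0) \<in> A_op D 0"
    using A_op_add[OF assms(1) A_op_scale[OF assms(2), of "-1"]] by simp
  moreover obtain y where y: "u - u' = primitive y" using A_op_range calculation by blast
  ultimately have "inner (E y) (E y) = 0" using form_identity[of y 0 y] by (simp add: J.zero)
  then have "u - u' = 0" using y by simp
  then show ?thesis by simp
qed

definition sol :: "l2 \<Rightarrow> l2" where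
  "sol v = (SOME u. (u, - v) \<in> A_op D 0)"

lemma sol_A_op: "(sol v, - v) \<in> A_op D 0"
  unfolding sol_def by (rule someI_ex) (rule A_op_surj)

lemma sol_eqI: "(u, - v) \<in> A_op D 0 \<Longrightarrow> sol v = u"
  using A_op_inject sol_A_op by blast

text \<open>The embedding of \<open>H1\<close>, with its energy inner product, into weighted L2,
  read in isometric coordinates on both sides.\<close>

definition K :: "real \<times> l2 \<Rightarrow> l2" where
  "K z = J D (primitive (E_inv z))"

definition Y :: "l2 \<Rightarrow> real \<times> l2" where
  "Y x = E (inv primitive (sol (J (- D) x)))"

lemma bounded_linear_K: "bounded_linear K"
  unfolding K_def[abs_def]
  by (intro bounded_linear_compose[OF bounded_linear_J] bounded_linear_compose[OF bounded_linear_primitive]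
      bounded_linear_E_inv)

sublocale K: bounded_linear K by (rule bounded_linear_K)

lemma primitive_inv_sol: "primitive (inv primitive (sol v)) = sol v"
  using A_op_range[OF sol_A_op] by (metis f_inv_into_f rangeI)

text \<open>\<open>form_identity\<close> with the solution inserted is the weak formulation of the
  boundary value problem, which is adjointness in these coordinates.\<close>

lemma Y_adjoint: "inner (Y x) z = inner x (K z)"
proof -
  have "(primitive (inv primitive (sol (J (- D) x))), - J (- D) x) \<in> A_op D 0"
    unfolding primitive_inv_sol by (rule sol_A_op)
  from form_identity[OF this, of "E_inv z"] show ?thesis
    by (simp add: Y_def K_def J.neg)
qed

lemma K_Y: "K (Y x) = J D (sol (J (- D) x))"
  by (simp add: K_def Y_def primitive_inv_sol)

text \<open>Linearity and the bound are read off from adjointness to the bounded \<open>K\<close>;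
  the solution operator, defined by choice, is never estimated directly.\<close>

lemma bounded_linear_Y: "bounded_linear Y"
proof -
  obtain B where B: "B > 0" "\<And>z. norm (K z) \<le> norm z * B" using K.pos_bounded by blast
  show ?thesis
  proof (rule bounded_linear_intro[where K = B])
    show "Y (a + b) = Y a + Y b" for a b
      by (rule vector_eq_rdot[THEN iffD1]) (simp add: Y_adjoint inner_add_left)
    show "Y (c *\<^sub>R a) = c *\<^sub>R Y a" for a c
      by (rule vector_eq_rdot[THEN iffD1]) (simp add: Y_adjoint)
    show "norm (Y x) \<le> norm x * B" for x
    proof (cases "Y x = 0")
      case False
      have "norm (Y x) * norm (Y x) = inner x (K (Y x))"
        by (simp add: Y_adjoint[symmetric] norm_eq_sqrt_inner)
      also have "\<dots> \<le> norm x * norm (K (Y x))" by (rule norm_cauchy_schwarz)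
      also have "\<dots> \<le> norm x * (norm (Y x) * B)" by (intro mult_left_mono B) auto
      finally have "norm (Y x) * norm (Y x) \<le> (norm x * B) * norm (Y x)" by (simp only: mult_ac)
      then show ?thesis by (rule mult_right_le_imp_le) (use False in simp)
    qed (use B in simp)
  qed
qed

definition inverse_op :: "l2 \<Rightarrow> l2" where
  "inverse_op x = K (Y x)"

lemma bounded_linear_inverse_op: "bounded_linear inverse_op"
  unfolding inverse_op_def[abs_def] by (rule bounded_linear_compose[OF bounded_linear_K bounded_linear_Y])

sublocale inverse_op: bounded_linear inverse_op by (rule bounded_linear_inverse_op)

lemma inverse_op_symmetric: "inner (inverse_op x) y = inner x (inverse_op y)"
  unfolding inverse_op_def by (metis Y_adjoint inner_commute)

lemma inverse_op_nonneg: "inner (inverse_op x) x \<ge> 0"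
  unfolding inverse_op_def by (metis Y_adjoint inner_commute inner_ge_zero)

lemma compact_inverse_op:
  assumes "\<And>n::nat. norm (X n) \<le> 1"
  shows "\<exists>r l. strict_mono (r :: nat \<Rightarrow> nat) \<and> (\<lambda>n. inverse_op (X (r n))) \<longlonglongrightarrow> l"
proof -
  have bl: "bounded_linear (\<lambda>x. E_inv (Y x))"
    by (rule bounded_linear_compose[OF bounded_linear_E_inv bounded_linear_Y])
  then obtain B where B: "B > 0" "\<And>x. norm (E_inv (Y x)) \<le> norm x * B"
    using bounded_linear.pos_bounded by blast
  have "norm (E_inv (Y (X n))) \<le> 1 * B" for n
    by (rule order_trans[OF B(2)]) (intro mult_right_mono assms, use B in simp)
  then obtain r l where "strict_mono (r :: nat \<Rightarrow> nat)"
      "(\<lambda>n. primitive (E_inv (Y (X (r n))))) \<longlonglongrightarrow> l"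
    using compact_primitive[of "\<lambda>n. E_inv (Y (X n))" "1 * B"] by blast
  then show ?thesis unfolding inverse_op_def K_def using J.tendsto by blast
qed

text \<open>The factor \<open>c\<close> stays on the left so that the relation holds before
  \<open>c\<close> is known to be nonzero.\<close>

lemma inverse_op_eigen:
  assumes "(u, c *\<^sub>R u) \<in> A_op D 0"
  shows "c *\<^sub>R inverse_op (J D u) = - J D u"
proof -
  have "sol (- (c *\<^sub>R u)) = u" by (rule sol_eqI) (simp add: assms)
  then have "inverse_op (J D (- (c *\<^sub>R u))) = J D u" by (simp add: inverse_op_def K_Y)
  then have "- (c *\<^sub>R inverse_op (J D u)) = J D u" by (simp add: J.neg J.scaleR inverse_op.neg inverse_op.scaleR)
  then show ?thesis by (metis minus_minus)
qed

section \<open>Sign, orthogonality and completeness of the eigenvectors\<close>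

lemma eigenvalue_negative:
  assumes "(u, c *\<^sub>R u) \<in> A_op D 0" "u \<noteq> 0"
  shows "c < 0"
proof -
  obtain y where y: "u = primitive y" using A_op_range assms(1) by blast
  have "inner (E y) (E y) = - c * inner (J D u) (J D u)"
    using form_identity[of y "c *\<^sub>R u" y] assms(1) y by (simp add: J.scaleR)
  moreover have "inner (E y) (E y) > 0" "inner (J D u) (J D u) > 0" using assms(2) y by auto
  ultimately show ?thesis by (simp add: zero_less_mult_iff mult_less_0_iff)
qed

text \<open>The energy form is symmetric, so evaluating it on the two eigenvectors in both orders
  gives one inner product with the factors \<open>c\<close> and \<open>c'\<close>.\<close>

lemma eigenvectors_orthogonal:
  assumes u: "(u, c *\<^sub>R u) \<in> A_op D 0" and u': "(u', c' *\<^sub>R u') \<in> A_op D 0" and "c \<noteq> c'"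
  shows "inner (J D u) (J D u') = 0"
proof -
  obtain y y' where y: "u = primitive y" "u' = primitive y'" using A_op_range u u' by meson
  have "inner (E y) (E y') = - c * inner (J D u) (J D u')"
    using form_identity[of y "c *\<^sub>R u" y'] u y by (simp add: J.scaleR)
  moreover have "inner (E y') (E y) = - c' * inner (J D u') (J D u)"
    using form_identity[of y' "c' *\<^sub>R u'" y] u' y by (simp add: J.scaleR)
  ultimately have "c * inner (J D u) (J D u') = c' * inner (J D u) (J D u')"
    using inner_commute[of "E y" "E y'"] inner_commute[of "J D u" "J D u'"] by auto
  then show ?thesis using \<open>c \<noteq> c'\<close> by simp
qed

text \<open>The orthogonal complement \<open>W\<close> of all eigenvectors is closed and invariant
  under \<open>inverse_op\<close>. Were it nontrivial, it would contain an eigenvector, which is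
  then orthogonal to itself.\<close>

lemma eigenvectors_complete:
  assumes "\<And>u c. (u, c *\<^sub>R u) \<in> A_op D 0 \<Longrightarrow> inner w (J D u) = 0"
  shows "w = 0"
proof (rule ccontr)
  assume "w \<noteq> 0"
  define EV where "EV = {u. \<exists>c. (u, c *\<^sub>R u) \<in> A_op D 0}"
  define W where "W = (\<Inter>u\<in>EV. {x. inner x (J D u) = 0})"
  have W_iff: "x \<in> W \<longleftrightarrow> (\<forall>u\<in>EV. inner x (J D u) = 0)" for x by (auto simp: W_def)
  have "closed W" unfolding W_def by (intro closed_INT ballI closed_Collect_eq continuous_intros)
  have "subspace W"
    by (rule subspaceI) (auto simp: W_iff inner_add_left)
  have "inverse_op x \<in> W" if x: "x \<in> W" for x
    unfolding W_iff
  proof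
    fix u assume u: "u \<in> EV"
    then obtain c where c: "(u, c *\<^sub>R u) \<in> A_op D 0" by (auto simp: EV_def)
    show "inner (inverse_op x) (J D u) = 0"
    proof (cases "u = 0")
      case False
      have "c * inner (inverse_op x) (J D u) = inner x (c *\<^sub>R inverse_op (J D u))" by (simp add: inverse_op_symmetric)
      also have "\<dots> = 0" using x u by (simp add: inverse_op_eigen[OF c] W_iff)
      finally show ?thesis using eigenvalue_negative[OF c False] by simp
    qed (simp add: J.zero)
  qed
  then have inv: "inverse_op ` W \<subseteq> W" by blast
  have w: "w \<in> W" using assms by (auto simp: W_iff EV_def)
  \<comment> \<open>A zero solution has zero right-hand side, since the operator is single valued at
    \<open>0\<close>.\<close>
  have "inverse_op w \<noteq> 0"
  proof
    assume "inverse_op w = 0"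
    then have "sol (J (- D) w) = 0" using J_eq_iff[of _ 0] by (simp add: inverse_op_def K_Y J.zero)
    then have "(0, - J (- D) w) \<in> A_op D 0" using sol_A_op[of "J (- D) w"] by simp
    then have "J (- D) w = 0" using A_op_single_valued[OF _ A_op_zero] by fastforce
    then have "J D (J (- D) w) = 0" by (simp only: J.zero)
    then show False using \<open>w \<noteq> 0\<close> by simp
  qed
  then obtain x c where x: "x \<in> W" "x \<noteq> 0" "c > 0" "inverse_op x = c *\<^sub>R x"
    using compact_positive_eigenvector[OF bounded_linear_inverse_op inverse_op_symmetric inverse_op_nonneg compact_inverse_op
        \<open>subspace W\<close> \<open>closed W\<close> inv w] by blast
  define u where "u = J (- D) x"
  have xu: "x = J D u" by (simp add: u_def)
  have "J D (sol u) = J D (c *\<^sub>R u)" using x(4) by (simp add: inverse_op_def K_Y xu J.scaleR)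
  then have "(c *\<^sub>R u, - u) \<in> A_op D 0" using sol_A_op[of u] by simp
  from A_op_scale[OF this, of "1 / c"] have "(u, (- (1 / c)) *\<^sub>R u) \<in> A_op D 0"
    using x(3) by simp
  then have "u \<in> EV" unfolding EV_def by blast
  then have "inner x x = 0" using x(1) by (simp add: W_iff xu)
  then show False using x(2) by simp
qed

text \<open>Orthonormal eigenvectors with eigenvalues in \<open>{- C..<0}\<close> have images under
  \<open>inverse_op\<close> at mutual distance at least \<open>1 / C\<close>, contradicting
  compactness.\<close>

lemma eigenvalues_not_bounded_below:
  fixes u :: "nat \<Rightarrow> l2"
  assumes eig: "\<And>n. (u n, c n *\<^sub>R u n) \<in> A_op D 0" and "inj c"
    and unit: "\<And>n. norm (J D (u n)) = 1" and bound: "\<And>n. c n \<ge> - C"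
  shows False
proof -
  have u0: "u n \<noteq> 0" for n using unit[of n] by (auto simp: J.zero)
  have neg: "c n < 0" for n by (rule eigenvalue_negative[OF eig u0])
  have C: "C > 0" using neg[of 0] bound[of 0] by linarith
  obtain r l where r: "strict_mono (r :: nat \<Rightarrow> nat)" and l: "(\<lambda>n. inverse_op (J D (u (r n)))) \<longlonglongrightarrow> l"
    using compact_inverse_op[of "\<lambda>n. J D (u n)"] unit by auto
  have inverse_op: "inverse_op (J D (u n)) = (- (1 / c n)) *\<^sub>R J D (u n)" for n
  proof -
    have "(1 / c n) *\<^sub>R (c n *\<^sub>R inverse_op (J D (u n))) = (1 / c n) *\<^sub>R (- J D (u n))"
      using inverse_op_eigen[OF eig] by simp
    then show ?thesis using neg[of n] by simp
  qed
  \<comment> \<open>Consecutive members of the convergent subsequence suffice: their differences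
    tend to zero.\<close>
  have "(\<lambda>n. inverse_op (J D (u (r (Suc n)))) - inverse_op (J D (u (r n)))) \<longlonglongrightarrow> l - l"
    by (intro tendsto_diff l LIMSEQ_Suc)
  then have "(\<lambda>n. (norm (inverse_op (J D (u (r (Suc n)))) - inverse_op (J D (u (r n)))))\<^sup>2) \<longlonglongrightarrow> (norm (0::l2))\<^sup>2"
    by (intro tendsto_intros) simp
  then have lim: "(\<lambda>n. (norm (inverse_op (J D (u (r (Suc n)))) - inverse_op (J D (u (r n)))))\<^sup>2) \<longlonglongrightarrow> 0" by simp
  have "(1 / C)\<^sup>2 \<le> (norm (inverse_op (J D (u m)) - inverse_op (J D (u n))))\<^sup>2" if "m \<noteq> n" for m n
  proof -
    have "c m \<noteq> c n" using \<open>inj c\<close> that by (simp add: inj_eq)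
    then have orth: "inner (J D (u m)) (J D (u n)) = 0" "inner (J D (u n)) (J D (u m)) = 0"
      using eigenvectors_orthogonal[OF eig eig] by metis+
    have self: "inner (J D (u n)) (J D (u n)) = 1" for n
      using unit[of n] by (simp add: norm_eq_sqrt_inner)
    have "(norm (inverse_op (J D (u m)) - inverse_op (J D (u n))))\<^sup>2 = (1 / c m)\<^sup>2 + (1 / c n)\<^sup>2"
      unfolding inverse_op power2_norm_eq_inner by (simp add: inner_diff orth self power2_eq_square)
    moreover have "(1 / C)\<^sup>2 \<le> (1 / c m)\<^sup>2"
    proof -
      have "1 / C \<le> 1 / - c m" using neg[of m] bound[of m] by (intro frac_le) auto
      then have "(1 / C)\<^sup>2 \<le> (1 / - c m)\<^sup>2" using C by (intro power_mono) auto
      then show ?thesis by (simp add: power_divide)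
    qed
    ultimately show ?thesis using zero_le_power2[of "1 / c n"] by linarith
  qed
  moreover have "r (Suc n) \<noteq> r n" for n using strict_monoD[OF r, of n "Suc n"] by simp
  ultimately have "(1 / C)\<^sup>2 \<le> 0"
    by (intro LIMSEQ_le_const[OF lim]) blast
  then show False using C by simp
qed

section \<open>Simplicity of the eigenvalues\<close>

lemma L2_deriv_has_derivative:
  assumes f: "L2_deriv f f'" and f': "continuous_on {0..1} f'" and x: "x \<in> {0..1}"
  shows "(f has_real_derivative f' x) (at x within {0..1})"
proof -
  have "((\<lambda>x. f 0 + integral {0..x} f') has_real_derivative f' x) (at x within {0..1})"
    using DERIV_add[OF DERIV_const[of "f 0"] integral_has_real_derivative[OF f' x]] by simp
  then show ?thesis
  proof (rule has_field_derivative_transform_within[OF _ zero_less_one x])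
    fix y :: real assume "y \<in> {0..1}"
    then have "(f' has_integral (f y - f 0)) {0..y}" using f by (simp add: L2_deriv_def)
    then show "f 0 + integral {0..y} f' = f y" by (simp add: integral_unique)
  qed
qed

text \<open>An energy estimate backwards from the right end point: with both Cauchy data zero there,
  \<open>exp (C x) * (f x\<^sup>2 + f' x\<^sup>2)\<close> is nondecreasing and vanishes at \<open>1\<close>.\<close>

lemma eigenvector_zero:
  assumes A: "(primitive y, c *\<^sub>R primitive y) \<in> A_op D 0" and end0: "prim (fst y) (snd y) 1 = 0"
  shows "y = 0"
proof -
  obtain b g where y: "y = (D * b, primitive (b, g))" and cu: "c *\<^sub>R primitive y = D *\<^sub>R g - primitive (b, g)" and bc: "prim b g 1 = 0"
    using A unfolding A_op_iff by auto
  define p where "p = prim b g"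
  define f where "f = prim (D * b) (primitive (b, g))"
  have contp: "continuous_on {0..1} p" and contf: "continuous_on {0..1} f"
    unfolding p_def f_def by (rule continuous_on_prim)+
  have sq: "sq_integrable p" "sq_integrable f" using contp contf by (simp_all add: sq_integrable_continuous)
  have w: "primitive (b, g) = abs_l2 p" and u: "primitive y = abs_l2 f"
    by (simp_all add: primitive_def p_def f_def y)
  \<comment> \<open>The eigenvalue equation expresses the second derivative by \<open>f\<close> and
    \<open>p\<close>, so it has a continuous representative and the weak derivatives are classical
    ones.\<close>
  define q where "q x = (c * f x + p x) / D" for x
  have contq: "continuous_on {0..1} q"
    unfolding q_def[abs_def] using D_pos by (intro continuous_intros contp contf) auto
  have "D *\<^sub>R g = c *\<^sub>R abs_l2 f + abs_l2 p" using cu unfolding w u by simp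
  also have "\<dots> = D *\<^sub>R abs_l2 q"
    using D_pos by (simp add: abs_l2_scale abs_l2_add sq sq_integrable_scale sq_integrable_continuous[OF contq])
      (simp add: q_def)
  finally have g: "g = abs_l2 q" using D_pos by simp
  have Df: "L2_deriv f p" unfolding f_def w by (rule L2_deriv_prim[OF sq(1)])
  have Dp: "L2_deriv p q"
    unfolding p_def g by (rule L2_deriv_prim[OF sq_integrable_continuous[OF contq]])
  have df: "(f has_real_derivative p x) (at x)" and dp: "(p has_real_derivative q x) (at x)"
    if "0 < x" "x < 1" for x
    using L2_deriv_has_derivative[OF Df contp, of x] L2_deriv_has_derivative[OF Dp contq, of x] that
      at_within_Icc_at[of 0 x 1] by auto
  \<comment> \<open>The summand \<open>1\<close> absorbs the cross term
    \<open>2 * f t * p t\<close>, the summand \<open>\<bar>c\<bar> / D\<close> the one coming from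
    \<open>2 * p t * q t\<close>; what remains is \<open>2 * (p t)\<^sup>2 / D\<close>.\<close>
  define C where "C = 1 + \<bar>c\<bar> / D"
  define F where "F x = exp (C * x) * ((f x)\<^sup>2 + (p x)\<^sup>2)" for x
  have "F x \<le> F 1" if x: "x \<in> {0..1}" for x
  proof (rule DERIV_nonneg_imp_increasing_open[of x 1 F])
    show "x \<le> 1" using x by simp
    show "continuous_on {x..1} F"
      unfolding F_def[abs_def] using x
      by (intro continuous_intros continuous_on_subset[OF contf] continuous_on_subset[OF contp]) auto
    fix t assume t: "x < t" "t < 1"
    then have "0 < t" using x by auto
    note d = df[OF this t(2)] dp[OF this t(2)]
    let ?d = "exp (C * t) * (C * ((f t)\<^sup>2 + (p t)\<^sup>2) + 2 * f t * p t + 2 * p t * q t)"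
    have "(F has_real_derivative ?d) (at t)"
      unfolding F_def[abs_def]
      by (auto intro!: derivative_eq_intros d simp: algebra_simps)
    moreover have "?d \<ge> 0"
    proof -
      have ab: "- ((f t)\<^sup>2 + (p t)\<^sup>2) \<le> 2 * (f t * p t)" "2 * \<bar>f t * p t\<bar> \<le> (f t)\<^sup>2 + (p t)\<^sup>2"
        using zero_le_power2[of "f t + p t"] zero_le_power2[of "\<bar>f t\<bar> - \<bar>p t\<bar>"]
        by (auto simp: power2_sum power2_diff abs_mult)
      have "2 * p t * q t = (c / D) * (2 * (f t * p t)) + 2 * (p t)\<^sup>2 / D"
        using D_pos by (simp add: q_def field_simps power2_eq_square)
      moreover have "(c / D) * (2 * (f t * p t)) \<ge> - (\<bar>c\<bar> / D * ((f t)\<^sup>2 + (p t)\<^sup>2))"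
      proof -
        have "\<bar>(c / D) * (2 * (f t * p t))\<bar> = \<bar>c\<bar> / D * (2 * \<bar>f t * p t\<bar>)"
          using D_pos by (simp add: abs_mult)
        also have "\<dots> \<le> \<bar>c\<bar> / D * ((f t)\<^sup>2 + (p t)\<^sup>2)"
          using D_pos ab(2) by (intro mult_left_mono) auto
        finally show ?thesis by (rule minus_le_iff[THEN iffD1, OF abs_le_D2])
      qed
      moreover have "2 * (p t)\<^sup>2 / D \<ge> 0" using D_pos by simp
      ultimately have "C * ((f t)\<^sup>2 + (p t)\<^sup>2) + 2 * f t * p t + 2 * p t * q t \<ge> 0"
        using ab(1) unfolding C_def by (simp add: distrib_right)
      then show ?thesis by simp
    qed
    ultimately show "\<exists>d. (F has_real_derivative d) (at t) \<and> 0 \<le> d" by blast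
  qed
  moreover have "F 1 = 0" using bc end0 by (simp add: F_def p_def f_def y)
  ultimately have "f x = 0" if "x \<in> {0..1}" for x
    using that by (force simp: F_def mult_le_0_iff sum_power2_le_zero_iff)
  then have "abs_l2 f = abs_l2 (\<lambda>x. 0)"
    by (intro abs_l2_cong sq sq_integrable_zero) auto
  then have "primitive y = primitive 0" by (simp add: u zero_l2_def[symmetric] I.zero)
  then show ?thesis by (simp only: primitive_eq_iff)
qed

text \<open>Two eigenvectors can be combined so that the value at \<open>1\<close> cancels, where
  the derivative vanishes anyway; \<open>eigenvector_zero\<close> then makes the combination
  zero.\<close>

lemma eigenvalue_simple:
  assumes u: "(u, c *\<^sub>R u) \<in> A_op D 0" and u': "(u', c *\<^sub>R u') \<in> A_op D 0" and "u \<noteq> 0"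
  shows "\<exists>t. u' = t *\<^sub>R u"
proof -
  obtain y y' where y: "u = primitive y" "u' = primitive y'" using A_op_range u u' by meson
  let ?v = "\<lambda>y. prim (fst y) (snd y) 1"
  have "?v y \<noteq> 0" using eigenvector_zero[of y c] u \<open>u \<noteq> 0\<close> y by (auto simp: I.zero)
  define z where "z = ?v y *\<^sub>R y' - ?v y' *\<^sub>R y"
  have Iz: "primitive z = ?v y *\<^sub>R u' - ?v y' *\<^sub>R u" by (simp add: z_def I.diff I.scaleR y)
  have "(primitive z, c *\<^sub>R primitive z) \<in> A_op D 0"
    using A_op_add[OF A_op_scale[OF u', of "?v y"] A_op_scale[OF u, of "- ?v y'"]]
    by (simp add: Iz scaleR_diff_right mult.commute)
  moreover have "?v z = 0"
    by (simp add: z_def prim_def inner_diff_right algebra_simps)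
  ultimately have "z = 0" by (rule eigenvector_zero)
  then have "?v y *\<^sub>R u' = ?v y' *\<^sub>R u" using Iz by (simp add: I.zero)
  then have "(1 / ?v y) *\<^sub>R (?v y *\<^sub>R u') = (1 / ?v y) *\<^sub>R (?v y' *\<^sub>R u)" by (simp only:)
  then have "u' = (?v y' / ?v y) *\<^sub>R u" using \<open>?v y \<noteq> 0\<close> by simp
  then show ?thesis by blast
qed

end

section \<open>The spectral representation\<close>

context convection_diffusion
begin

lemma unit_eigenvector:
  assumes "(u, c *\<^sub>R u) \<in> A_op D 0" "u \<noteq> 0"
  shows "\<exists>v. (v, c *\<^sub>R v) \<in> A_op D 0 \<and> norm (J D v) = 1"
proof -
  let ?v = "(1 / norm (J D u)) *\<^sub>R u"
  have "(?v, c *\<^sub>R ?v) \<in> A_op D 0"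
    using A_op_scale[OF assms(1), of "1 / norm (J D u)"] by (simp add: mult.commute)
  moreover have "norm (J D ?v) = 1" using assms(2) by (simp add: J.scaleR)
  ultimately show ?thesis by blast
qed

lemma A_op_lincomb:
  "finite F \<Longrightarrow> (\<And>c. c \<in> F \<Longrightarrow> (u c, v c) \<in> A_op D 0)
    \<Longrightarrow> (\<Sum>c\<in>F. a c *\<^sub>R u c, \<Sum>c\<in>F. a c *\<^sub>R v c) \<in> A_op D 0"
  by (induction F rule: finite_induct) (simp_all add: A_op_zero A_op_add A_op_scale)

text \<open>The constant \<open>1\<close> violates the boundary conditions, so it is not a finite combination of
  eigenvectors.\<close>

lemma infinite_eigenvalues: "infinite {c. \<exists>u. u \<noteq> 0 \<and> (u, c *\<^sub>R u) \<in> A_op D 0}" (is "infinite ?L")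
proof
  assume fin: "finite ?L"
  have "\<forall>c\<in>?L. \<exists>v. (v, c *\<^sub>R v) \<in> A_op D 0 \<and> norm (J D v) = 1"
    using unit_eigenvector by blast
  from bchoice[OF this] obtain u
    where "\<forall>c\<in>?L. (u c, c *\<^sub>R u c) \<in> A_op D 0 \<and> norm (J D (u c)) = 1" ..
  then have u: "\<And>c. c \<in> ?L \<Longrightarrow> (u c, c *\<^sub>R u c) \<in> A_op D 0"
      and unit: "\<And>c. c \<in> ?L \<Longrightarrow> norm (J D (u c)) = 1"
    by blast+
  define x where "x = J D (primitive (1, 0))"
  define s where "s = (\<Sum>c\<in>?L. inner x (J D (u c)) *\<^sub>R u c)"
  \<comment> \<open>\<open>s\<close> is the projection of the constant onto the finitely many
    eigenlines. The remainder is orthogonal to every eigenvector, since each is a multiple of some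
    \<open>u d\<close>.\<close>
  have "x - J D s = 0"
  proof (rule eigenvectors_complete)
    fix w d assume w: "(w, d *\<^sub>R w) \<in> A_op D 0"
    show "inner (x - J D s) (J D w) = 0"
    proof (cases "w = 0")
      case False
      then have d: "d \<in> ?L" using w by blast
      have u0: "u d \<noteq> 0" using unit[OF d] by (auto simp: J.zero)
      obtain t where t: "w = t *\<^sub>R u d" using eigenvalue_simple[OF u[OF d] w u0] by blast
      have "inner (J D s) (J D (u d)) = (\<Sum>c\<in>?L. inner x (J D (u c)) * inner (J D (u c)) (J D (u d)))"
        by (simp add: s_def J.sum J.scaleR inner_sum_left)
      also have "\<dots> = (\<Sum>c\<in>?L. if c = d then inner x (J D (u c)) else 0)"
      proof (rule sum.cong[OF refl])
        fix c assume c: "c \<in> ?L"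
        show "inner x (J D (u c)) * inner (J D (u c)) (J D (u d)) = (if c = d then inner x (J D (u c)) else 0)"
          using eigenvectors_orthogonal[OF u[OF c] u[OF d]] unit[OF d] by (auto simp: norm_eq_sqrt_inner)
      qed
      also have "\<dots> = inner x (J D (u d))" using fin d by simp
      finally show ?thesis by (simp add: t J.scaleR inner_diff_left)
    qed (simp add: J.zero)
  qed
  then have "primitive (1, 0) = s" by (simp add: x_def)
  moreover have "(s, \<Sum>c\<in>?L. inner x (J D (u c)) *\<^sub>R (c *\<^sub>R u c)) \<in> A_op D 0"
    unfolding s_def by (rule A_op_lincomb[OF fin u])
  ultimately obtain c g where cg: "primitive (1, 0) = primitive (D * c, primitive (c, g))"
    unfolding A_op_iff by auto
  \<comment> \<open>Injectivity of \<open>primitive\<close> makes the derivative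
    \<open>primitive (c, g)\<close> zero, hence \<open>c = 0\<close>, against
    \<open>1 = D * c\<close>.\<close>
  then have "1 = D * c" "primitive (c, g) = 0" by simp_all
  then show False by (simp add: zero_prod_def)
qed

text \<open>Infinitely many eigenvalues above some \<open>- C\<close> would give a sequence excluded
  by \<open>eigenvalues_not_bounded_below\<close>, so the set is a countable union of finite
  sets.\<close>

lemma countable_eigenvalues: "countable {c. \<exists>u. u \<noteq> 0 \<and> (u, c *\<^sub>R u) \<in> A_op D 0}" (is "countable ?L")
proof -
  have "finite {c \<in> ?L. c \<ge> - C}" for C
  proof (rule ccontr)
    assume "infinite {c \<in> ?L. c \<ge> - C}"
    from infinite_countable_subset[OF this]
    obtain c :: "nat \<Rightarrow> real" where c: "inj c \<and> range c \<subseteq> {c \<in> ?L. c \<ge> - C}" ..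
    then have "c n \<in> ?L" and bound: "c n \<ge> - C" for n by auto
    then have "\<forall>n. \<exists>v. (v, c n *\<^sub>R v) \<in> A_op D 0 \<and> norm (J D v) = 1"
      using unit_eigenvector by blast
    from choice[OF this] obtain u
      where "\<forall>n. (u n, c n *\<^sub>R u n) \<in> A_op D 0 \<and> norm (J D (u n)) = 1" ..
    then show False
      using eigenvalues_not_bounded_below[of u c C] c bound by blast
  qed
  then have "countable (\<Union>N::nat. {c \<in> ?L. c \<ge> - real N})"
    by (intro countable_UN) (auto intro: countable_finite)
  moreover have "?L = (\<Union>N::nat. {c \<in> ?L. c \<ge> - real N})"
  proof -
    have "\<exists>N::nat. c \<ge> - real N" for c :: real
      using real_arch_simple[of "- c"] by (metis minus_le_iff)
    then show ?thesis by blast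
  qed
  ultimately show ?thesis by simp
qed

text \<open>Any bijection of the naturals with the countably infinite set of eigenvalues will do.
  This is what keeps the statement about all eigensystems from being vacuous.\<close>

lemma eigen_system_exists: "\<exists>l \<phi>. eigen_system D k0 l \<phi> \<and> (\<forall>n. l n < - k0)"
proof -
  let ?L = "{c. \<exists>u. u \<noteq> 0 \<and> (u, c *\<^sub>R u) \<in> A_op D 0}"
  obtain c :: "nat \<Rightarrow> real" where c: "bij_betw c UNIV ?L"
    using countable_infiniteE'[OF countable_eigenvalues infinite_eigenvalues] by blast
  then have inL: "\<And>n. c n \<in> ?L" and inj: "inj c" and range: "range c = ?L"
    by (auto simp: bij_betw_def)
  have "\<forall>n. \<exists>v. (v, c n *\<^sub>R v) \<in> A_op D 0 \<and> norm (J D v) = 1"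
  proof
    fix n
    obtain v where "v \<noteq> 0" "(v, c n *\<^sub>R v) \<in> A_op D 0" using inL[of n] by blast
    then show "\<exists>v. (v, c n *\<^sub>R v) \<in> A_op D 0 \<and> norm (J D v) = 1" using unit_eigenvector by blast
  qed
  from choice[OF this] obtain u
    where "\<forall>n. (u n, c n *\<^sub>R u n) \<in> A_op D 0 \<and> norm (J D (u n)) = 1" ..
  then have u: "\<And>n. (u n, c n *\<^sub>R u n) \<in> A_op D 0" "\<And>n. norm (J D (u n)) = 1" by blast+
  have shift: "(x, d *\<^sub>R x) \<in> A_op D k0 \<longleftrightarrow> (x, (d + k0) *\<^sub>R x) \<in> A_op D 0" for x d
    by (simp add: A_op_shift[of _ _ D k0] scaleR_add_left)
  let ?l = "\<lambda>n. c n - k0"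
  have "inj ?l" using inj by (simp add: inj_def)
  moreover have "range ?l = eigenvalues (A_op D k0)"
  proof
    show "range ?l \<subseteq> eigenvalues (A_op D k0)"
    proof
      fix d assume "d \<in> range ?l"
      then obtain n where "d = ?l n" by blast
      then show "d \<in> eigenvalues (A_op D k0)"
        using inL[of n] by (auto simp: eigenvalues_def eigenspace_def shift)
    qed
    show "eigenvalues (A_op D k0) \<subseteq> range ?l"
    proof
      fix d assume "d \<in> eigenvalues (A_op D k0)"
      then have "d + k0 \<in> range c" unfolding range by (auto simp: eigenvalues_def eigenspace_def shift)
      then obtain n where "d + k0 = c n" by blast
      then have "d = ?l n" by simp
      then show "d \<in> range ?l" by blast
    qed
  qed
  moreover have "u n \<in> eigenspace (A_op D k0) (?l n)" "ip_norm (ip_rho D) (u n) = 1" for n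
    using u by (simp_all add: eigenspace_def shift ip_norm_def inner_J[symmetric] norm_eq_sqrt_inner)
  moreover have "?l n < - k0" for n
  proof -
    have "u n \<noteq> 0" using u(2)[of n] by (auto simp: J.zero)
    then show ?thesis using eigenvalue_negative[OF u(1)] by simp
  qed
  ultimately show ?thesis unfolding eigen_system_def by blast
qed

lemma isometric_model_J: "isometric_model UNIV (ip_rho D) (J D)"
proof
  show "bij_betw (J D) UNIV UNIV"
    by (rule bij_betw_byWitness[where f' = "J (- D)"]) auto
qed (simp_all add: J.add J.scaleR inner_J)

end

text \<open>Of \<open>\<gamma>\<close> only the uniform gap
  \<open>\<epsilon> \<le> \<mu> - l n\<close> is retained; it makes the weights invertible with
  bounded inverse.\<close>

locale eigen_data = convection_diffusion D for D +
  fixes k0 \<mu> \<epsilon> :: real and l :: "nat \<Rightarrow> real" and \<phi> :: "nat \<Rightarrow> l2"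
  assumes k0_pos: "k0 > 0" and eigen_system: "eigen_system D k0 l \<phi>"
    and \<epsilon>_pos: "\<epsilon> > 0" and gap: "\<epsilon> \<le> \<mu> - l n"
begin

text \<open>Eigenvalue of \<open>- L\<close>, equal to the squared energy norm of the normalised
  eigenfunction.\<close>

definition \<nu> :: "nat \<Rightarrow> real" where
  "\<nu> n = - (l n + k0)"

lemma eigen: "(\<phi> n, - \<nu> n *\<^sub>R \<phi> n) \<in> A_op D 0"
proof -
  have "(\<phi> n, l n *\<^sub>R \<phi> n) \<in> A_op D k0"
    using eigen_system by (simp add: eigen_system_def eigenspace_def)
  moreover have "- \<nu> n *\<^sub>R \<phi> n = l n *\<^sub>R \<phi> n + k0 *\<^sub>R \<phi> n"
    by (simp add: \<nu>_def scaleR_add_left)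
  ultimately show ?thesis using A_op_shift by metis
qed

lemma norm_\<phi>: "norm (J D (\<phi> n)) = 1"
  using eigen_system by (simp add: eigen_system_def ip_norm_def inner_J[symmetric] norm_eq_sqrt_inner)

lemma \<phi>_nonzero: "\<phi> n \<noteq> 0"
  using norm_\<phi>[of n] by auto

lemma \<nu>_pos: "\<nu> n > 0"
  using eigenvalue_negative[OF eigen \<phi>_nonzero] by simp

lemma inj_l: "inj l"
  using eigen_system by (simp add: eigen_system_def)

lemma inj_\<nu>: "inj \<nu>"
  using inj_l by (auto simp: inj_def \<nu>_def)

abbreviation e :: "nat \<Rightarrow> l2" where
  "e n \<equiv> J D (\<phi> n)"

sublocale e: orthonormal_basis e
proof
  show "inner (e m) (e n) = (if m = n then 1 else 0)" for m n
  proof (cases "m = n")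
    case True
    then show ?thesis using norm_\<phi>[of n] by (simp add: norm_eq_sqrt_inner)
  next
    case False
    then have "- \<nu> m \<noteq> - \<nu> n" using inj_\<nu> by (simp add: inj_eq)
    then show ?thesis using eigenvectors_orthogonal[OF eigen eigen] False by simp
  qed
next
  fix x assume x: "\<And>n. inner x (e n) = 0"
  show "x = 0"
  proof (rule eigenvectors_complete)
    fix u c assume u: "(u, c *\<^sub>R u) \<in> A_op D 0"
    show "inner x (J D u) = 0"
    proof (cases "u = 0")
      case False
      have "(u, (c - k0) *\<^sub>R u) \<in> A_op D k0"
        using u by (simp add: A_op_shift[of _ _ D k0] scaleR_diff_left)
      then have "c - k0 \<in> range l"
        using False eigen_system by (auto simp: eigen_system_def eigenvalues_def eigenspace_def)
      then obtain n where "c - k0 = l n" by blast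
      then have c: "c = - \<nu> n" by (simp add: \<nu>_def)
      obtain t where "u = t *\<^sub>R \<phi> n"
        using eigenvalue_simple[OF eigen u[unfolded c] \<phi>_nonzero] by blast
      then show ?thesis using x by (simp add: J.scaleR)
    qed (simp add: J.zero)
  qed
qed

text \<open>The enumeration is arbitrary, so the limit rests on finiteness: infinitely many
  \<open>\<nu> n\<close> below \<open>C\<close> would form a subsequence excluded by
  compactness.\<close>

lemma \<nu>_at_top: "filterlim \<nu> at_top sequentially"
  unfolding filterlim_at_top
proof
  fix C :: real
  have "finite {n. \<not> C \<le> \<nu> n}"
  proof (rule ccontr)
    assume "infinite {n. \<not> C \<le> \<nu> n}"
    then obtain r :: "nat \<Rightarrow> nat" where r: "strict_mono r" "\<And>n. \<not> C \<le> \<nu> (r n)"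
      using infinite_enumerate by (metis mem_Collect_eq)
    have "inj (\<lambda>n. - \<nu> (r n))"
      by (rule injI) (use inj_\<nu> strict_mono_eq[OF r(1)] in \<open>simp add: inj_eq\<close>)
    moreover have "- C \<le> - \<nu> (r n)" for n using r(2)[of n] by simp
    ultimately show False
      using eigenvalues_not_bounded_below[of "\<lambda>n. \<phi> (r n)" "\<lambda>n. - \<nu> (r n)" C] eigen norm_\<phi> by blast
  qed
  then show "\<forall>\<^sub>F n in sequentially. C \<le> \<nu> n"
    unfolding cofinite_eq_sequentially[symmetric] eventually_cofinite .
qed

lemma primitive_inv_\<phi>: "primitive (inv primitive (\<phi> n)) = \<phi> n"
  using A_op_range[OF eigen[of n]] by (metis f_inv_into_f rangeI)

lemma inner_E_\<phi>: "inner (E (inv primitive (\<phi> n))) z = \<nu> n * inner (e n) (K z)"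
  using form_identity[of "inv primitive (\<phi> n)" "- \<nu> n *\<^sub>R \<phi> n" "E_inv z"] eigen[of n]
  by (simp add: primitive_inv_\<phi> K_def J.neg J.scaleR)

abbreviation b :: "nat \<Rightarrow> real \<times> l2" where
  "b n \<equiv> (1 / sqrt (\<nu> n)) *\<^sub>R E (inv primitive (\<phi> n))"

lemma K_E: "K (E y) = J D (primitive y)"
  by (simp add: K_def)

text \<open>The eigenvalue relation turns the energy pairing into an L2 pairing. This links the two
  bases, so that membership in \<open>H1\<close> becomes a weighted summability condition on L2
  coordinates.\<close>

lemma inner_b: "inner z (b n) = sqrt (\<nu> n) * inner (K z) (e n)"
proof -
  have "\<nu> n / sqrt (\<nu> n) = sqrt (\<nu> n)" using \<nu>_pos[of n] by (simp add: real_div_sqrt)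
  moreover have "inner z (b n) = \<nu> n / sqrt (\<nu> n) * inner (K z) (e n)"
    using inner_E_\<phi>[of n z] inner_commute[of z "E (inv primitive (\<phi> n))"] inner_commute[of "K z" "e n"]
    by simp
  ultimately show ?thesis by metis
qed

text \<open>Totality is inherited from \<open>e\<close> because the embedding \<open>K\<close> is
  injective, orthogonality because the energy pairing of eigenfunctions is a multiple of their L2
  pairing.\<close>

sublocale b: orthonormal_basis b
proof
  fix m n
  have "inner (b m) (b n) = sqrt (\<nu> n) * (1 / sqrt (\<nu> m)) * inner (e m) (e n)"
    unfolding inner_b K.scaleR K_E primitive_inv_\<phi> by simp
  then show "inner (b m) (b n) = (if m = n then 1 else 0)"
    using \<nu>_pos[of n] by (simp add: e.orthonormal)
next
  fix z assume z: "\<And>n. inner z (b n) = 0"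
  have "inner (K z) (e n) = 0" for n
    using z[of n] unfolding inner_b using \<nu>_pos[of n] by simp
  then have "K z = 0" by (rule e.total)
  then have "E_inv z = 0" by (simp add: K_def)
  then show "z = 0" by (metis E_E_inv(1) E.zero)
qed

text \<open>A Poincare inequality: the bounded \<open>K\<close> maps an element of squared norm
  \<open>\<nu> n\<close> to the unit vector \<open>e n\<close>.\<close>

lemma \<nu>_lower: "\<exists>\<delta>>0. \<forall>n. \<delta> \<le> \<nu> n"
proof -
  obtain B where B: "B > 0" "\<And>z. norm (K z) \<le> norm z * B" using K.pos_bounded by blast
  have "1 / B\<^sup>2 \<le> \<nu> n" for n
  proof -
    let ?z = "E (inv primitive (\<phi> n))"
    have K: "K ?z = e n" by (simp add: K_E primitive_inv_\<phi>)
    have "(norm ?z)\<^sup>2 = \<nu> n"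
      using inner_E_\<phi>[of n ?z] by (simp add: power2_norm_eq_inner K e.orthonormal)
    moreover have "1 \<le> (norm ?z * B)\<^sup>2"
      using B(2)[of ?z] by (simp add: K norm_\<phi>)
    ultimately show ?thesis using B(1) by (simp add: power_mult_distrib field_simps)
  qed
  then show ?thesis using B(1) by (intro exI[of _ "1 / B\<^sup>2"]) simp
qed

lemma weights_comparable:
  "\<exists>C>0. \<forall>n. \<mu> - l n \<le> C * \<nu> n \<and> \<nu> n \<le> C * (\<mu> - l n)"
proof -
  obtain \<delta> where \<delta>: "\<delta> > 0" "\<And>n. \<delta> \<le> \<nu> n" using \<nu>_lower by blast
  define a where "a = \<bar>\<mu> + k0\<bar>"
  \<comment> \<open>The weights differ by \<open>\<mu> + k0\<close>, of absolute value
    \<open>a\<close>; \<open>a / \<delta>\<close> absorbs it when bounding by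
    \<open>\<nu> n\<close>, and \<open>a / \<epsilon>\<close> when bounding by
    \<open>\<mu> - l n\<close>.\<close>
  define C where "C = 1 + a / \<delta> + a / \<epsilon>"
  have a: "a \<ge> 0" by (simp add: a_def)
  have "\<mu> - l n \<le> C * \<nu> n \<and> \<nu> n \<le> C * (\<mu> - l n)" for n
  proof
    have eq: "\<mu> - l n = \<mu> + k0 + \<nu> n" by (simp add: \<nu>_def)
    have "a / \<delta> * \<delta> \<le> a / \<delta> * \<nu> n" using \<delta> a by (intro mult_left_mono) auto
    moreover have "0 \<le> a / \<epsilon> * \<nu> n" using \<nu>_pos[of n] a \<epsilon>_pos by simp
    moreover have "a / \<delta> * \<delta> = a" using \<delta> by simp
    ultimately show "\<mu> - l n \<le> C * \<nu> n" unfolding C_def distrib_right eq by (simp add: a_def)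
    have "a / \<epsilon> * \<epsilon> \<le> a / \<epsilon> * (\<mu> - l n)" using \<epsilon>_pos gap[of n] a by (intro mult_left_mono) auto
    moreover have "0 \<le> a / \<delta> * (\<mu> - l n)" using gap[of n] a \<epsilon>_pos \<delta> by simp
    moreover have "a / \<epsilon> * \<epsilon> = a" using \<epsilon>_pos by simp
    ultimately have "a \<le> a / \<delta> * (\<mu> - l n) + a / \<epsilon> * (\<mu> - l n)" by linarith
    moreover have "\<nu> n \<le> (\<mu> - l n) + a" unfolding eq a_def by simp
    ultimately show "\<nu> n \<le> C * (\<mu> - l n)" unfolding C_def distrib_right by simp
  qed
  moreover have "C > 0" using a \<delta> \<epsilon>_pos by (simp add: C_def add_pos_nonneg)
  ultimately show ?thesis by blast
qed

lemma weight_pos: "\<mu> - l n > 0"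
  using gap[of n] \<epsilon>_pos by linarith

lemma summable_weights_iff:
  "summable (\<lambda>n. (\<mu> - l n) * (x n)\<^sup>2) \<longleftrightarrow> summable (\<lambda>n. \<nu> n * (x n)\<^sup>2)"
proof -
  obtain C where C: "C > 0" "\<And>n. \<mu> - l n \<le> C * \<nu> n" "\<And>n. \<nu> n \<le> C * (\<mu> - l n)"
    using weights_comparable by blast
  have 1: "norm ((\<mu> - l n) * (x n)\<^sup>2) \<le> C * (\<nu> n * (x n)\<^sup>2)" for n
    using mult_right_mono[OF C(2)[of n], of "(x n)\<^sup>2"] weight_pos[of n] by (simp add: abs_mult mult.assoc)
  have 2: "norm (\<nu> n * (x n)\<^sup>2) \<le> C * ((\<mu> - l n) * (x n)\<^sup>2)" for n
    using mult_right_mono[OF C(3)[of n], of "(x n)\<^sup>2"] \<nu>_pos[of n] by (simp add: abs_mult mult.assoc)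
  show ?thesis
  proof
    assume "summable (\<lambda>n. (\<mu> - l n) * (x n)\<^sup>2)"
    then show "summable (\<lambda>n. \<nu> n * (x n)\<^sup>2)"
      by (rule summable_comparison_test'[OF summable_mult]) (rule 2)
  next
    assume "summable (\<lambda>n. \<nu> n * (x n)\<^sup>2)"
    then show "summable (\<lambda>n. (\<mu> - l n) * (x n)\<^sup>2)"
      by (rule summable_comparison_test'[OF summable_mult]) (rule 1)
  qed
qed

section \<open>Identification of the fractional power space with \<open>H1\<close>\<close>

lemma X_half_iff: "f \<in> X_half D l \<phi> \<mu> \<longleftrightarrow> summable (\<lambda>n. (\<mu> - l n) * (inner (J D f) (e n))\<^sup>2)"
  by (simp add: X_half_def inner_J)

lemma H1_iff: "f \<in> H1 \<longleftrightarrow> (\<exists>z. J D f = K z)"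
proof
  assume "f \<in> H1"
  then obtain y where "f = primitive y" using H1_eq by blast
  then show "\<exists>z. J D f = K z" using K_E by metis
qed (auto simp: K_def H1_eq)

lemma square_inner_b: "(inner z (b n))\<^sup>2 = \<nu> n * (inner (K z) (e n))\<^sup>2"
  using \<nu>_pos[of n] by (simp only: inner_b power_mult_distrib) simp

text \<open>Up to comparable weights, \<open>X_half\<close> asks that the would-be energy
  coordinates be square summable; Bessel and Riesz-Fischer in the basis \<open>b\<close> give the
  two inclusions.\<close>

lemma X_half_eq: "X_half D l \<phi> \<mu> = H1"
proof safe
  fix f assume "f \<in> H1"
  then obtain z where "J D f = K z" by (auto simp: H1_iff)
  then show "f \<in> X_half D l \<phi> \<mu>"
    using b.summable_coord[of z] unfolding X_half_iff summable_weights_iff square_inner_b by simp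
next
  fix f assume "f \<in> X_half D l \<phi> \<mu>"
  then have "summable (\<lambda>n. \<nu> n * (inner (J D f) (e n))\<^sup>2)"
    unfolding X_half_iff summable_weights_iff .
  then have s: "summable (\<lambda>n. (sqrt (\<nu> n) * inner (J D f) (e n))\<^sup>2)"
    using \<nu>_pos by (simp add: power_mult_distrib less_imp_le)
  define z where "z = b.combination (\<lambda>n. sqrt (\<nu> n) * inner (J D f) (e n))"
  have "inner (J D f) (e n) = inner (K z) (e n)" for n
    using b.inner_combination[OF s, of n] inner_b[of z n] \<nu>_pos[of n] unfolding z_def by simp
  then have "J D f = K z" by (rule e.coord_eqI)
  then show "f \<in> H1" unfolding H1_iff by blast
qed

text \<open>\<open>half_power\<close> followed by \<open>J D\<close>, written as a combination to
  expose its coordinates; outside \<open>H1\<close> the series need not converge.\<close>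

definition U :: "l2 \<Rightarrow> l2" where
  "U f = e.combination (\<lambda>n. sqrt (\<mu> - l n) * inner (J D f) (e n))"

lemma summable_H1:
  assumes "f \<in> H1"
  shows "summable (\<lambda>n. (sqrt (\<mu> - l n) * inner (J D f) (e n))\<^sup>2)"
proof -
  have "(sqrt (\<mu> - l n) * inner (J D f) (e n))\<^sup>2 = (\<mu> - l n) * (inner (J D f) (e n))\<^sup>2" for n
    using weight_pos[of n] by (simp add: power_mult_distrib)
  then show ?thesis using assms X_half_iff X_half_eq by simp
qed

lemma inner_U: "f \<in> H1 \<Longrightarrow> inner (U f) (e n) = sqrt (\<mu> - l n) * inner (J D f) (e n)"
  unfolding U_def by (rule e.inner_combination[OF summable_H1])

text \<open>The isometry \<open>J D\<close> carries the defining limit into the class topology,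
  where existence and uniqueness settle the definite description.\<close>

lemma J_half_power:
  assumes f: "f \<in> H1"
  shows "J D (half_power D l \<phi> \<mu> f) = U f"
proof -
  interpret M: isometric_model UNIV "ip_rho D" "J D" by (rule isometric_model_J)
  have "limitin (ip_topology UNIV (ip_rho D))
     (\<lambda>N. \<Sum>n<N. (sqrt (\<mu> - l n) * ip_rho D f (\<phi> n)) *\<^sub>R \<phi> n) w sequentially
     \<longleftrightarrow> J D w = U f" for w
  proof -
    have "(\<lambda>N. J D (\<Sum>n<N. (sqrt (\<mu> - l n) * ip_rho D f (\<phi> n)) *\<^sub>R \<phi> n)) \<longlonglongrightarrow> U f"
      using e.combination_sums[OF summable_H1[OF f]]
      by (simp add: sums_def J.sum J.scaleR U_def inner_J)
    then show ?thesis
      using LIMSEQ_unique by (auto simp: M.limitin_iff)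
  qed
  then have "half_power D l \<phi> \<mu> f = (THE w. J D w = U f)" unfolding half_power_def by simp
  also have "\<dots> = J (- D) (U f)" by (rule the_equality) (simp, metis J_J_inverse(2))
  finally show ?thesis by simp
qed

lemma ip_half_eq: "f \<in> H1 \<Longrightarrow> g \<in> H1 \<Longrightarrow> ip_half D l \<phi> \<mu> f g = inner (U f) (U g)"
  by (simp add: ip_half_def J_half_power inner_J[symmetric])

lemma subspace_H1: "subspace H1"
  unfolding H1_eq by (rule linear_subspace_image[OF linear_primitive subspace_UNIV])

sublocale M: isometric_model H1 "ip_half D l \<phi> \<mu>" U
proof
  show "subspace H1" by (rule subspace_H1)
  show "U (x + y) = U x + U y" if "x \<in> H1" "y \<in> H1" for x y
    by (rule e.coord_eqI)
      (simp add: that inner_U subspace_add[OF subspace_H1] J.add inner_add_left distrib_left)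
  show "U (c *\<^sub>R x) = c *\<^sub>R U x" if "x \<in> H1" for x c
    by (rule e.coord_eqI) (simp add: that inner_U subspace_scale[OF subspace_H1] J.scaleR)
  show "ip_half D l \<phi> \<mu> x y = inner (U x) (U y)" if "x \<in> H1" "y \<in> H1" for x y
    using that by (rule ip_half_eq)
  show "bij_betw U H1 UNIV"
    unfolding bij_betw_def
  proof
    show "inj_on U H1"
    proof (rule inj_onI)
      fix x y assume xy: "x \<in> H1" "y \<in> H1" "U x = U y"
      have "inner (J D x) (e n) = inner (J D y) (e n)" for n
        using inner_U[OF xy(1), of n] inner_U[OF xy(2), of n] xy(3) weight_pos[of n] by simp
      then have "J D x = J D y" by (rule e.coord_eqI)
      then show "x = y" by simp
    qed
    show "U ` H1 = UNIV"
    proof (intro equalityI subsetI)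
      fix y :: l2
      \<comment> \<open>The gap enters here: the inverse of \<open>U\<close> is a bounded
        multiplier, whose values satisfy the \<open>X_half\<close> condition and so lie in
        \<open>H1\<close>.\<close>
      have bound: "\<bar>1 / sqrt (\<mu> - l n)\<bar> \<le> 1 / sqrt \<epsilon>" for n
        using gap[of n] \<epsilon>_pos by (simp add: frac_le)
      define x where "x = J (- D) (e.multiplier (\<lambda>n. 1 / sqrt (\<mu> - l n)) y)"
      have x: "inner (J D x) (e n) = 1 / sqrt (\<mu> - l n) * inner y (e n)" for n
        unfolding x_def J_J_inverse by (rule e.inner_multiplier[OF bound])
      have "(\<mu> - l n) * (inner (J D x) (e n))\<^sup>2 = (inner y (e n))\<^sup>2" for n
        using weight_pos[of n] by (simp add: x power_divide)
      then have "x \<in> H1" using e.summable_coord[of y] by (simp add: X_half_iff flip: X_half_eq)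
      moreover have "U x = y"
        by (rule e.coord_eqI) (use weight_pos in \<open>simp add: inner_U[OF \<open>x \<in> H1\<close>] x less_imp_neq[symmetric]\<close>)
      ultimately show "y \<in> U ` H1" by blast
    qed simp
  qed
qed

lemma \<phi>_H1: "\<phi> n \<in> H1"
  unfolding H1_eq using primitive_inv_\<phi> by (metis rangeI)

lemma U_phi_half: "phi_half l \<phi> \<mu> n \<in> H1" "U (phi_half l \<phi> \<mu> n) = e n"
proof -
  show "phi_half l \<phi> \<mu> n \<in> H1"
    unfolding phi_half_def by (intro subspace_scale subspace_H1 \<phi>_H1)
  have "U (phi_half l \<phi> \<mu> n) = (1 / sqrt (\<mu> - l n)) *\<^sub>R U (\<phi> n)"
    unfolding phi_half_def by (rule M.U_scale[OF \<phi>_H1])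
  also have "\<dots> = e n"
    by (rule e.coord_eqI) (use weight_pos in \<open>auto simp: inner_U[OF \<phi>_H1] e.orthonormal less_imp_neq[symmetric]\<close>)
  finally show "U (phi_half l \<phi> \<mu> n) = e n" .
qed

lemma dom_half_iff:
  "f \<in> dom_half D l \<phi> \<mu> \<longleftrightarrow> f \<in> H1 \<and> summable (\<lambda>n. (l n * inner (U f) (e n))\<^sup>2)"
  unfolding dom_half_def X_half_eq by (auto simp: ip_half_eq U_phi_half power_mult_distrib)

text \<open>Symmetry of the energy form, evaluated by \<open>form_identity\<close> once with
  \<open>u\<close> and once with \<open>\<phi> n\<close> as the element of the domain.\<close>

lemma inner_A_op:
  assumes "(u, v) \<in> A_op D k0"
  shows "inner (J D v) (e n) = l n * inner (J D u) (e n)"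
proof -
  have A: "(u, v + k0 *\<^sub>R u) \<in> A_op D 0" using assms A_op_shift by blast
  obtain y where y: "u = primitive y" using A_op_range A by blast
  have "inner (E y) (E (inv primitive (\<phi> n))) = - inner (J D (v + k0 *\<^sub>R u)) (e n)"
    using form_identity[of y _ "inv primitive (\<phi> n)"] A by (simp add: y primitive_inv_\<phi>)
  moreover have "inner (E (inv primitive (\<phi> n))) (E y) = \<nu> n * inner (e n) (J D u)"
    by (simp add: inner_E_\<phi> K_E y)
  ultimately have "- inner (J D (v + k0 *\<^sub>R u)) (e n) = \<nu> n * inner (J D u) (e n)"
    using inner_commute[of "E y" "E (inv primitive (\<phi> n))"] inner_commute[of "e n" "J D u"] by simp
  then show ?thesis by (simp add: J.add J.scaleR inner_add_left \<nu>_def algebra_simps)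
qed

text \<open>Makes the operator literally the maximal multiplication operator of
  \<open>diagonal_operator\<close>, from which the spectral and semigroup claims are
  inherited.\<close>

lemma A_half_iff:
  "(x, y) \<in> A_half D k0 l \<phi> \<mu> \<longleftrightarrow> x \<in> H1 \<and> y \<in> H1 \<and> (\<forall>n. inner (U y) (e n) = l n * inner (U x) (e n))"
proof
  assume "(x, y) \<in> A_half D k0 l \<phi> \<mu>"
  then have A: "(x, y) \<in> A_op D k0" and dom: "x \<in> H1" "summable (\<lambda>n. (l n * inner (U x) (e n))\<^sup>2)"
    by (auto simp: A_half_def dom_half_iff)
  \<comment> \<open>The domain condition on \<open>x\<close> is, term by term, the
    \<open>X_half\<close> condition on the image \<open>y\<close>, so the graph stays inside
    \<open>H1\<close>.\<close>
  have "(\<mu> - l n) * (inner (J D y) (e n))\<^sup>2 = (l n * inner (U x) (e n))\<^sup>2" for n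
    using weight_pos[of n] by (simp add: inner_A_op[OF A] inner_U[OF dom(1)] power_mult_distrib)
  then have y: "y \<in> H1" using dom(2) by (simp add: X_half_iff flip: X_half_eq)
  then show "x \<in> H1 \<and> y \<in> H1 \<and> (\<forall>n. inner (U y) (e n) = l n * inner (U x) (e n))"
    using dom(1) by (simp add: inner_U inner_A_op[OF A])
next
  assume *: "x \<in> H1 \<and> y \<in> H1 \<and> (\<forall>n. inner (U y) (e n) = l n * inner (U x) (e n))"
  then have x: "x \<in> H1" and y: "y \<in> H1" by blast+
  have xy: "inner (J D y) (e n) = l n * inner (J D x) (e n)" for n
  proof -
    have "sqrt (\<mu> - l n) * inner (J D y) (e n) = inner (U y) (e n)" by (simp only: inner_U[OF y])
    also have "\<dots> = l n * inner (U x) (e n)" using * by blast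
    also have "\<dots> = sqrt (\<mu> - l n) * (l n * inner (J D x) (e n))" by (simp only: inner_U[OF x] mult_ac)
    finally show ?thesis using weight_pos[of n] by simp
  qed
  \<comment> \<open>Surjectivity gives \<open>w\<close> in the domain with
    \<open>L w = y + k0 *\<^sub>R x\<close>. Comparing coordinates, \<open>\<nu> n > 0\<close>
    forces \<open>w = x\<close>, so \<open>x\<close> inherits regularity and boundary
    conditions.\<close>
  obtain w where w: "(w, y + k0 *\<^sub>R x) \<in> A_op D 0" using A_op_surj by blast
  then have w': "(w, y + k0 *\<^sub>R x - k0 *\<^sub>R w) \<in> A_op D k0" using A_op_shift[of w _ D k0] by simp
  have "inner (J D x) (e n) = inner (J D w) (e n)" for n
  proof -
    have "\<nu> n * inner (J D x) (e n) = \<nu> n * inner (J D w) (e n)"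
      using inner_A_op[OF w', of n] xy[of n]
      by (simp add: J.add J.diff J.scaleR inner_add_left inner_diff_left \<nu>_def algebra_simps)
    then show ?thesis using \<nu>_pos[of n] by simp
  qed
  then have "J D x = J D w" by (rule e.coord_eqI)
  then have A: "(x, y) \<in> A_op D k0" using w' by simp
  have "(\<lambda>n. (l n * inner (U x) (e n))\<^sup>2) = (\<lambda>n. (inner (U y) (e n))\<^sup>2)" using * by simp
  then have "x \<in> dom_half D l \<phi> \<mu>" using x e.summable_coord[of "U y"] by (simp add: dom_half_iff)
  then show "(x, y) \<in> A_half D k0 l \<phi> \<mu>" using A by (simp add: A_half_def)
qed

lemma Domain_A_half: "Domain (A_half D k0 l \<phi> \<mu>) = dom_half D l \<phi> \<mu>"
proof
  show "Domain (A_half D k0 l \<phi> \<mu>) \<subseteq> dom_half D l \<phi> \<mu>" by (auto simp: A_half_def)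
  show "dom_half D l \<phi> \<mu> \<subseteq> Domain (A_half D k0 l \<phi> \<mu>)"
  proof
    fix f assume f: "f \<in> dom_half D l \<phi> \<mu>"
    then have "f \<in> H1" and s: "summable (\<lambda>n. (l n * inner (U f) (e n))\<^sup>2)" by (auto simp: dom_half_iff)
    then have "(f, M.W (e.combination (\<lambda>n. l n * inner (U f) (e n)))) \<in> A_half D k0 l \<phi> \<mu>"
      by (simp add: A_half_iff)
    then show "f \<in> Domain (A_half D k0 l \<phi> \<mu>)" by blast
  qed
qed

text \<open>\<open>\<nu> n > 0\<close> means \<open>l n < - k0\<close>, so \<open>k0\<close> serves
  as the decay rate \<open>\<omega>\<close>.\<close>

sublocale diag: diagonal_operator e H1 "ip_half D l \<phi> \<mu>" U l k0 "A_half D k0 l \<phi> \<mu>"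
proof
  show "inj l" by (rule inj_l)
  show "k0 > 0" by (rule k0_pos)
  show "l n \<le> - k0" for n using \<nu>_pos[of n] by (simp add: \<nu>_def)
  have "filterlim (\<lambda>n. - (k0 + \<nu> n)) at_bot sequentially"
    unfolding filterlim_uminus_at_top[symmetric]
    by (rule filterlim_tendsto_add_at_top[OF tendsto_const \<nu>_at_top])
  then show "filterlim l at_bot sequentially" by (simp add: \<nu>_def)
  show "(x, y) \<in> A_half D k0 l \<phi> \<mu> \<longleftrightarrow> x \<in> H1 \<and> y \<in> H1 \<and> (\<forall>n. inner (U y) (e n) = l n * inner (U x) (e n))" for x y
    by (rule A_half_iff)
qed

text \<open>Injectivity of \<open>primitive\<close> determines the derivative from the class, so the
  definite description in \<open>H1_norm\<close> has exactly one candidate.\<close>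

lemma H1_norm_primitive: "H1_norm (primitive (c, g)) = sqrt ((norm (primitive (c, g)))\<^sup>2 + (norm g)\<^sup>2)"
  unfolding H1_norm_def
proof (rule the_equality)
  obtain h where h: "sq_integrable h" "g = abs_l2 h" by (rule l2_cases)
  show "\<exists>f f'. L2_deriv f f' \<and> primitive (c, g) = abs_l2 f
     \<and> sqrt ((norm (primitive (c, g)))\<^sup>2 + (norm g)\<^sup>2) = sqrt ((\<integral>z. (f z)\<^sup>2 \<partial>leb01) + (\<integral>z. (f' z)\<^sup>2 \<partial>leb01))"
    using L2_deriv_prim[OF h(1), of c] h
    by (intro exI[of _ "prim c g"] exI[of _ h]) (simp add: primitive_def norm_abs_l2 sq_integrable_prim)
  fix r assume "\<exists>f f'. L2_deriv f f' \<and> primitive (c, g) = abs_l2 f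
     \<and> r = sqrt ((\<integral>z. (f z)\<^sup>2 \<partial>leb01) + (\<integral>z. (f' z)\<^sup>2 \<partial>leb01))"
  then obtain f f' where f: "L2_deriv f f'" "primitive (c, g) = abs_l2 f"
    and r: "r = sqrt ((\<integral>z. (f z)\<^sup>2 \<partial>leb01) + (\<integral>z. (f' z)\<^sup>2 \<partial>leb01))" by blast
  have "primitive (c, g) = primitive (f 0, abs_l2 f')" using f L2_deriv_primitive by simp
  then have g: "g = abs_l2 f'" by simp
  show "r = sqrt ((norm (primitive (c, g)))\<^sup>2 + (norm g)\<^sup>2)"
  proof -
    have "(norm (primitive (c, g)))\<^sup>2 = (\<integral>z. (f z)\<^sup>2 \<partial>leb01)"
      unfolding f(2) by (rule norm_abs_l2[OF L2_deriv_sq_fun[OF f(1)]])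
    moreover have "(norm g)\<^sup>2 = (\<integral>z. (f' z)\<^sup>2 \<partial>leb01)"
      unfolding g by (rule norm_abs_l2[OF L2_deriv_sq[OF f(1)]])
    ultimately show ?thesis by (simp only: r)
  qed
qed

text \<open>Both norms are compared with the energy norm of \<open>E (c, g)\<close>: Parseval in the
  two bases relates it to \<open>ip_half\<close> through comparable weights, boundedness of
  \<open>E\<close> and \<open>E_inv\<close> and the trace inequality relate it to
  \<open>H1_norm\<close>.\<close>

lemma equivalent_norms: "equivalent_norms_on H1 H1_norm (ip_norm (ip_half D l \<phi> \<mu>))"
proof -
  obtain C where C: "C > 0" "\<And>n. \<mu> - l n \<le> C * \<nu> n" "\<And>n. \<nu> n \<le> C * (\<mu> - l n)"
    using weights_comparable by blast
  obtain B1 where B1: "B1 > 0" "\<And>y. norm (E y) \<le> norm y * B1" using E.pos_bounded by blast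
  obtain B2 where B2: "B2 > 0" "\<And>z. norm (E_inv z) \<le> norm z * B2"
    using bounded_linear.pos_bounded[OF bounded_linear_E_inv] by blast
  have main: "ip_norm (ip_half D l \<phi> \<mu>) x \<le> 3 * B1 * sqrt C * H1_norm x \<and>
      H1_norm x \<le> 3 * B2 * sqrt C * ip_norm (ip_half D l \<phi> \<mu>) x" if x: "x \<in> H1" for x
  proof -
    obtain c g where y: "x = primitive (c, g)" using x unfolding H1_eq by (metis rangeE surj_pair)
    define z where "z = E (c, g)"
    have Kz: "K z = J D x" by (simp add: z_def K_E y)
    let ?a = "\<lambda>n. (\<mu> - l n) * (inner (J D x) (e n))\<^sup>2" and ?b = "\<lambda>n. \<nu> n * (inner (J D x) (e n))\<^sup>2"
    have "(\<lambda>n. (inner (U x) (e n))\<^sup>2) sums (norm (U x))\<^sup>2" by (rule e.parseval_norm)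
    moreover have "(inner (U x) (e n))\<^sup>2 = ?a n" for n
      using weight_pos[of n] by (simp add: inner_U[OF x] power_mult_distrib)
    ultimately have sa: "?a sums (norm (U x))\<^sup>2" by simp
    have sb: "?b sums (norm z)\<^sup>2" using b.parseval_norm[of z] by (simp only: square_inner_b Kz)
    have "(norm (U x))\<^sup>2 \<le> C * (norm z)\<^sup>2"
      by (rule sums_le[OF _ sa sums_mult[OF sb]])
        (use C(2) in \<open>simp add: mult.assoc[symmetric] mult_right_mono\<close>)
    then have Uz: "norm (U x) \<le> sqrt C * norm z"
      using C(1) by (metis norm_ge_zero real_sqrt_le_mono real_sqrt_mult real_sqrt_unique)
    have "(norm z)\<^sup>2 \<le> C * (norm (U x))\<^sup>2"
      by (rule sums_le[OF _ sb sums_mult[OF sa]])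
        (use C(3) in \<open>simp add: mult.assoc[symmetric] mult_right_mono\<close>)
    then have zU: "norm z \<le> sqrt C * norm (U x)"
      using C(1) by (metis norm_ge_zero real_sqrt_le_mono real_sqrt_mult real_sqrt_unique)
    have H: "H1_norm x = sqrt ((norm x)\<^sup>2 + (norm g)\<^sup>2)" using H1_norm_primitive y by simp
    have Hx: "norm x \<le> H1_norm x" "norm g \<le> H1_norm x"
      unfolding H by (simp_all add: real_le_rsqrt)
    \<comment> \<open>\<open>\<bar>c\<bar>\<close> costs \<open>norm x + norm g\<close>, and
      \<open>norm g\<close> is counted once more: three terms, each at most
      \<open>H1_norm x\<close>. The \<open>3\<close> in \<open>Hy\<close> arises likewise.\<close>
    have yH: "norm (c, g) \<le> 3 * H1_norm x"
    proof -
      have "norm (c, g) \<le> \<bar>c\<bar> + norm g" using norm_Pair_le[of c g] by simp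
      then show ?thesis using boundary_le[of c g] Hx y by simp
    qed
    have Hy: "H1_norm x \<le> 3 * norm (c, g)"
    proof -
      have "H1_norm x \<le> norm x + norm g"
        unfolding H by (rule sqrt_sum_squares_le_sum) simp_all
      moreover have "norm x \<le> \<bar>c\<bar> + norm g" unfolding y by (rule norm_primitive_le)
      ultimately show ?thesis using norm_fst_le[of c g] norm_snd_le[of g c] by simp
    qed
    have "norm (U x) \<le> sqrt C * (3 * H1_norm x * B1)"
    proof -
      have "norm z \<le> norm (c, g) * B1" unfolding z_def by (rule B1)
      also have "\<dots> \<le> 3 * H1_norm x * B1" using yH B1(1) by (intro mult_right_mono) auto
      finally have "sqrt C * norm z \<le> sqrt C * (3 * H1_norm x * B1)"
        using C(1) by (intro mult_left_mono) simp_all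
      then show ?thesis by (rule order_trans[OF Uz])
    qed
    moreover have "H1_norm x \<le> 3 * (sqrt C * norm (U x) * B2)"
    proof -
      have "norm (c, g) \<le> norm z * B2" using B2(2)[of z] by (simp add: z_def)
      also have "\<dots> \<le> sqrt C * norm (U x) * B2" using zU B2(1) by (intro mult_right_mono) auto
      finally show ?thesis using Hy by simp
    qed
    ultimately show ?thesis by (simp add: M.ip_norm_eq[OF x] mult_ac)
  qed
  show ?thesis
    unfolding equivalent_norms_on_def
  proof (intro exI conjI ballI)
    show "0 < 1 / (3 * B2 * sqrt C)" "0 < 3 * B1 * sqrt C" using B1 B2 C by simp_all
    show "1 / (3 * B2 * sqrt C) * H1_norm x \<le> ip_norm (ip_half D l \<phi> \<mu>) x" if "x \<in> H1" for x
    proof -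
      have "0 < 3 * B2 * sqrt C" using B2 C by simp
      then show ?thesis using main[OF that] by (simp add: pos_divide_le_eq mult.commute)
    qed
    show "ip_norm (ip_half D l \<phi> \<mu>) x \<le> 3 * B1 * sqrt C * H1_norm x" if "x \<in> H1" for x
      using main[OF that] by blast
  qed
qed

end

theorem corollaryV1:
  fixes D k0 :: real
  assumes "D > 0" and "k0 > 0"
  shows "(\<exists>l \<phi> \<gamma>. eigen_system D k0 l \<phi> \<and> (\<forall>n. l n < \<gamma>)) \<and>
    (\<forall>l \<phi> \<gamma> \<epsilon> \<mu>. eigen_system D k0 l \<phi> \<and> (\<forall>n. l n < \<gamma>) \<and> \<epsilon> > 0 \<and> \<mu> = \<gamma> + \<epsilon> \<longrightarrow>
       X_half D l \<phi> \<mu> = H1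
       \<and> equivalent_norms_on H1 H1_norm (ip_norm (ip_half D l \<phi> \<mu>))
       \<and> Domain (A_half D k0 l \<phi> \<mu>) = dom_half D l \<phi> \<mu>
       \<and> self_adjoint_on H1 (ip_half D l \<phi> \<mu>) (A_half D k0 l \<phi> \<mu>)
       \<and> riesz_spectral_on H1 (ip_half D l \<phi> \<mu>) (A_half D k0 l \<phi> \<mu>)
       \<and> (\<exists>T. c0_semigroup_on H1 (ip_half D l \<phi> \<mu>) T
            \<and> generator_on H1 (ip_half D l \<phi> \<mu>) T = A_half D k0 l \<phi> \<mu>
            \<and> exponentially_stable_on H1 (ip_half D l \<phi> \<mu>) T
            \<and> compact_semigroup_on H1 (ip_half D l \<phi> \<mu>) T))"
proof (intro conjI allI impI)
  interpret convection_diffusion D by unfold_locales fact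
  show "\<exists>l \<phi> \<gamma>. eigen_system D k0 l \<phi> \<and> (\<forall>n. l n < \<gamma>)"
    using eigen_system_exists by blast
next
  fix l \<phi> \<gamma> \<epsilon> \<mu>
  assume *: "eigen_system D k0 l \<phi> \<and> (\<forall>n. l n < \<gamma>) \<and> \<epsilon> > 0 \<and> \<mu> = \<gamma> + \<epsilon>"
  interpret eigen_data D k0 \<mu> \<epsilon> l \<phi>
  proof
    show "D > 0" "k0 > 0" by fact+
    show "eigen_system D k0 l \<phi>" "\<epsilon> > 0" using * by blast+
    have "l n < \<gamma>" "\<mu> = \<gamma> + \<epsilon>" for n using * by blast+
    then show "\<epsilon> \<le> \<mu> - l n" for n by (simp add: less_imp_le)
  qed
  show "X_half D l \<phi> \<mu> = H1" by (rule X_half_eq)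
  show "equivalent_norms_on H1 H1_norm (ip_norm (ip_half D l \<phi> \<mu>))" by (rule equivalent_norms)
  show "Domain (A_half D k0 l \<phi> \<mu>) = dom_half D l \<phi> \<mu>" by (rule Domain_A_half)
  show "self_adjoint_on H1 (ip_half D l \<phi> \<mu>) (A_half D k0 l \<phi> \<mu>)" by (rule diag.self_adjoint)
  show "riesz_spectral_on H1 (ip_half D l \<phi> \<mu>) (A_half D k0 l \<phi> \<mu>)" by (rule diag.riesz_spectral)
  show "\<exists>T. c0_semigroup_on H1 (ip_half D l \<phi> \<mu>) T
            \<and> generator_on H1 (ip_half D l \<phi> \<mu>) T = A_half D k0 l \<phi> \<mu>
            \<and> exponentially_stable_on H1 (ip_half D l \<phi> \<mu>) T
            \<and> compact_semigroup_on H1 (ip_half D l \<phi> \<mu>) T"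
    using diag.c0_semigroup diag.generator diag.exponentially_stable diag.compact_semigroup by blast
qed

end
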